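(* Let $(L,\mathbb{F})$ be a Lévy process on $(\Omega,\mathscr{F},\mathbb{P};\mathbb{F})$ with finite horizon $T>0$, and assume that $L$ is not monotone, i.e. neither $L$ nor $-L$ is a subordinator. Let $\varphi_T(\kappa)=\mathbb{E}_{\mathbb{P}}[\exp(\kappa L_T)]$, $\kappa\in\mathbb{R}$, and suppose that $\varphi_T$ is not identically equal to $+\infty$ on $\mathbb{R}\setminus\{0\}$. Then the minimal entropy martingale measure (MEMM) $\mathbb{P}^*$ in the class $\tilde{\mathscr{M}}^{\rm loc}_a$ coincides with the Esscher martingale measure (EMM) $\mathbb{P}^E$: $\mathbb{P}^*$ exists if and only if $\mathbb{P}^E$ exists, and in this case $\mathbb{P}^*=\mathbb{P}^E$.
   Context: Time runs over $[0,T]$, $\mathbb{F}=(\mathscr{F}_t)_{t\in[0,T]}$, and $(L,\mathbb{F})$ is a real-valued Lévy process with respect to $\mathbb{F}$ under $\mathbb{P}$ (càdlàg, $L_0=0$, $\mathbb{F}$-adapted, stationary increments $L_t-L_s$ independent of $\mathscr{F}_s$). Probability measures below are considered on $\mathscr{F}_T$. Relative entropy: $I_T(\mathbb{Q},\mathbb{P})=\mathbb{E}_{\mathbb{P}}\big[\frac{d\mathbb{Q}}{d\mathbb{P}}|_{\mathscr{F}_T}\log\frac{d\mathbb{Q}}{d\mathbb{P}}|_{\mathscr{F}_T}\big]$ if $\mathbb{Q}|_{\mathscr{F}_T}\ll\mathbb{P}|_{\mathscr{F}_T}$, and $+\infty$ otherwise. $\tilde{\mathscr{M}}^{\rm loc}_a$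 is the set of probability measures $\mathbb{Q}$ with $\mathbb{Q}|_{\mathscr{F}_T}\ll\mathbb{P}|_{\mathscr{F}_T}$ for which there is a sequence $(\tau_k)_{k\ge1}$ of $\mathbb{F}$-stopping times such that $\{\tau_k=T\}\uparrow\Omega$ as $k\to\infty$ and $\mathbb{E}_{\mathbb{Q}}[L_{\tau_k\wedge T}]=0$ (in particular this expectation exists) for all $k\ge1$. A MEMM in a class $\mathscr{C}$ is a $\mathbb{P}^*\in\mathscr{C}$ with $I_T(\mathbb{P}^*,\mathbb{P})=\inf_{\mathbb{Q}\in\mathscr{C}}I_T(\mathbb{Q},\mathbb{P})$. For $\kappa\in\mathbb{R}$ with $\varphi_T(\kappa)<\infty$, the Esscher measure $\mathbb{P}^\kappa$ is defined by $d\mathbb{P}^\kappa=\frac{\exp(\kappa L_T)}{\varphi_T(\kappa)}\,d\mathbb{P}$. If $(L,\mathbb{F})$ is a martingale under $\mathbb{P}^{\kappa}$ for some such $\kappa$, then $\mathbb{P}^\kappa$ is called the EMM and denoted $\mathbb{P}^E$. *)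

theory Defs
  imports "HOL-Probability.Probability"
begin

(* The minimum of t and T as a real number, for T >= 0. The library notions filtration and
   stopping_time quantify over a whole index type; indexing by [0,infinity] and freezing
   at T, i.e. taking \<lambda>t. F (cap T t), applies them to a filtration F on [0,T]. The values of F
   outside [0,T] are never used. *)
definition cap :: "real \<Rightarrow> ennreal \<Rightarrow> real" where
  "cap T t = enn2real (min t (ennreal T))"

lemma cap_ennreal: "0 \<le> t \<Longrightarrow> t \<le> T \<Longrightarrow> cap T (ennreal t) = t"
  by (simp add: cap_def min_absorb1 ennreal_leI)

lemma cap_in: "0 \<le> T \<Longrightarrow> cap T t \<in> {0..T}"
  unfolding cap_def by (auto simp: enn2real_leI)

lemma cap_mono: "s \<le> t \<Longrightarrow> cap T s \<le> cap T t"
  unfolding cap_def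
  by (intro enn2real_mono) (auto simp: min_less_iff_disj intro: min.coboundedI1)

lemma filtration_cap_iff:
  assumes "0 \<le> T"
  shows "filtration \<Omega> (\<lambda>t. F (cap T t)) \<longleftrightarrow>
    (\<forall>t\<in>{0..T}. space (F t) = \<Omega>) \<and>
    (\<forall>s\<in>{0..T}. \<forall>t\<in>{0..T}. s \<le> t \<longrightarrow> sets (F s) \<subseteq> sets (F t))"
proof (intro iffI)
  assume f: "filtration \<Omega> (\<lambda>t. F (cap T t))"
  have "space (F t) = \<Omega>" if "t \<in> {0..T}" for t
    using filtration.space_F[OF f, of "ennreal t"] that by (simp add: cap_ennreal)
  moreover have "sets (F s) \<subseteq> sets (F t)" if "s \<in> {0..T}" "t \<in> {0..T}" "s \<le> t" for s t
    using filtration.sets_F_mono[OF f, of "ennreal s" "ennreal t"] that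
    by (simp add: cap_ennreal ennreal_leI)
  ultimately show "(\<forall>t\<in>{0..T}. space (F t) = \<Omega>) \<and>
    (\<forall>s\<in>{0..T}. \<forall>t\<in>{0..T}. s \<le> t \<longrightarrow> sets (F s) \<subseteq> sets (F t))" by blast
next
  assume "(\<forall>t\<in>{0..T}. space (F t) = \<Omega>) \<and>
    (\<forall>s\<in>{0..T}. \<forall>t\<in>{0..T}. s \<le> t \<longrightarrow> sets (F s) \<subseteq> sets (F t))"
  then show "filtration \<Omega> (\<lambda>t. F (cap T t))"
    using cap_in[OF assms] cap_mono by unfold_locales blast+
qed

definition cadlag_on :: "real \<Rightarrow> (real \<Rightarrow> real) \<Rightarrow> bool" where
  "cadlag_on T f \<longleftrightarrow>
    (\<forall>t\<in>{0..<T}. continuous (at_right t) f) \<and>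
    (\<forall>t\<in>{0<..T}. \<exists>l. (f \<longlongrightarrow> l) (at_left t))"

locale levy_process = prob_space M
  for M :: "'a measure" +
  fixes T :: real and F :: "real \<Rightarrow> 'a measure" and L :: "real \<Rightarrow> 'a \<Rightarrow> real"
  assumes horizon_pos: "0 < T"
    and filtration_F: "filtration (space M) (\<lambda>t. F (cap T t))"
    and subalgebra_F: "subalgebra M (F T)"
    and adapted: "\<And>t. t \<in> {0..T} \<Longrightarrow> L t \<in> borel_measurable (F t)"
    and starts_at_0: "\<And>\<omega>. \<omega> \<in> space M \<Longrightarrow> L 0 \<omega> = 0"
    and cadlag: "\<And>\<omega>. \<omega> \<in> space M \<Longrightarrow> cadlag_on T (\<lambda>t. L t \<omega>)"
    and stationary_increments: "\<And>s t h. 0 \<le> s \<Longrightarrow> s \<le> t \<Longrightarrow> 0 \<le> h \<Longrightarrow> t + h \<le> T \<Longrightarrow>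
      distr M borel (\<lambda>\<omega>. L (t + h) \<omega> - L (s + h) \<omega>) = distr M borel (\<lambda>\<omega>. L t \<omega> - L s \<omega>)"
    and independent_increments: "\<And>s t. 0 \<le> s \<Longrightarrow> s \<le> t \<Longrightarrow> t \<le> T \<Longrightarrow>
      indep_set (sets (F s)) {(\<lambda>\<omega>. L t \<omega> - L s \<omega>) -` B \<inter> space M | B. B \<in> sets borel}"

definition subordinator ::
    "'a measure \<Rightarrow> real \<Rightarrow> (real \<Rightarrow> 'a measure) \<Rightarrow> (real \<Rightarrow> 'a \<Rightarrow> real) \<Rightarrow> bool" where
  "subordinator M T F L \<longleftrightarrow>
    levy_process M T F L \<and> (AE \<omega> in M. mono_on {0..T} (\<lambda>t. L t \<omega>))"

definition martingale ::
    "'a measure \<Rightarrow> real \<Rightarrow> (real \<Rightarrow> 'a measure) \<Rightarrow> (real \<Rightarrow> 'a \<Rightarrow> real) \<Rightarrow> bool" where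
  "martingale Q T F X \<longleftrightarrow>
    (\<forall>t\<in>{0..T}. X t \<in> borel_measurable (F t) \<and> integrable Q (X t)) \<and>
    (\<forall>s\<in>{0..T}. \<forall>t\<in>{s..T}. AE \<omega> in Q. real_cond_exp Q (F s) (X t) \<omega> = X s \<omega>)"

(* P and Q live on the same sigma-algebra. The expectation of D log D is taken in the extended
   sense, positive part minus negative part; the negative part is bounded by exp (-1). *)
definition rel_entropy :: "'a measure \<Rightarrow> 'a measure \<Rightarrow> ereal" where
  "rel_entropy Q P =
    (if absolutely_continuous P Q then
       (let D = (\<lambda>\<omega>. enn2real (RN_deriv P Q \<omega>)) in
          enn2ereal (\<integral>\<^sup>+\<omega>. ennreal (D \<omega> * ln (D \<omega>)) \<partial>P)
          - enn2ereal (\<integral>\<^sup>+\<omega>. ennreal (- (D \<omega> * ln (D \<omega>))) \<partial>P))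
     else \<infinity>)"

(* Here and below, a probability measure on F_T is a measure whose sigma-algebra is exactly F_T. *)
definition M_loc_a ::
    "'a measure \<Rightarrow> real \<Rightarrow> (real \<Rightarrow> 'a measure) \<Rightarrow> (real \<Rightarrow> 'a \<Rightarrow> real) \<Rightarrow> 'a measure set" where
  "M_loc_a M T F L =
    {Q. prob_space Q \<and> sets Q = sets (F T) \<and>
        absolutely_continuous (restr_to_subalg M (F T)) Q \<and>
        (\<exists>\<tau> :: nat \<Rightarrow> 'a \<Rightarrow> ennreal.
           (\<forall>k. stopping_time (\<lambda>t. F (cap T t)) (\<tau> k)) \<and>
           incseq (\<lambda>k. {\<omega> \<in> space M. \<tau> k \<omega> = ennreal T}) \<and>
           (\<Union>k. {\<omega> \<in> space M. \<tau> k \<omega> = ennreal T}) = space M \<and>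
           (\<forall>k. integrable Q (\<lambda>\<omega>. L (cap T (\<tau> k \<omega>)) \<omega>) \<and>
                (\<integral>\<omega>. L (cap T (\<tau> k \<omega>)) \<omega> \<partial>Q) = 0))}"

definition is_MEMM ::
    "'a measure \<Rightarrow> real \<Rightarrow> (real \<Rightarrow> 'a measure) \<Rightarrow> 'a measure set \<Rightarrow> 'a measure \<Rightarrow> bool" where
  "is_MEMM M T F C Q \<longleftrightarrow> Q \<in> C \<and>
     rel_entropy Q (restr_to_subalg M (F T)) =
       (INF Q'\<in>C. rel_entropy Q' (restr_to_subalg M (F T)))"

definition phi :: "'a measure \<Rightarrow> real \<Rightarrow> (real \<Rightarrow> 'a \<Rightarrow> real) \<Rightarrow> real \<Rightarrow> ennreal" where
  "phi M T L \<kappa> = (\<integral>\<^sup>+\<omega>. ennreal (exp (\<kappa> * L T \<omega>)) \<partial>M)"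

definition esscher_measure ::
    "'a measure \<Rightarrow> real \<Rightarrow> (real \<Rightarrow> 'a measure) \<Rightarrow> (real \<Rightarrow> 'a \<Rightarrow> real) \<Rightarrow> real \<Rightarrow> 'a measure" where
  "esscher_measure M T F L \<kappa> =
     density (restr_to_subalg M (F T)) (\<lambda>\<omega>. ennreal (exp (\<kappa> * L T \<omega>)) / phi M T L \<kappa>)"

definition is_EMM ::
    "'a measure \<Rightarrow> real \<Rightarrow> (real \<Rightarrow> 'a measure) \<Rightarrow> (real \<Rightarrow> 'a \<Rightarrow> real) \<Rightarrow> 'a measure \<Rightarrow> bool" where
  "is_EMM M T F L Q \<longleftrightarrow>
     (\<exists>\<kappa>. phi M T L \<kappa> < \<infinity> \<and> Q = esscher_measure M T F L \<kappa> \<and> martingale Q T F L)"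

end

theory Submission
  imports Defs
begin

text \<open>
Write \<open>X = L T\<close> and \<open>\<phi>(\<kappa>)\<close> for the mean of \<open>exp (\<kappa> X)\<close>, let \<open>I(Q)\<close> be the entropy
of \<open>Q\<close> relative to \<open>M\<close> on \<open>F T\<close>, and let \<open>E\<^sub>\<kappa>\<close> be the Esscher measure. The entropy
problem is dual to minimising \<open>\<phi>\<close>: the infimum of \<open>I\<close> over the class is
\<open>- ln (min \<phi>)\<close>, and a measure that attains it can only be the Esscher measure at the minimiser.

Lower bound and rigidity. Where \<open>\<phi>(\<kappa>)\<close> is finite, \<open>exp (\<kappa> L t)\<close> divided by the
power \<open>\<phi>(\<kappa>) powr (t / T)\<close> is a positive martingale, at least along the dyadic times, and by
Fatou's lemma its mean at any stopping time is at most one. Let \<open>Q\<close> be in the class, with localizing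
times \<open>\<tau> k\<close>. Testing the Donsker-Varadhan inequality against the logarithm of this martingale at
\<open>\<tau> k\<close>, the term with \<open>L\<close> has \<open>Q\<close>-mean zero, and as \<open>\<tau> k\<close> becomes \<open>T\<close> what
remains is \<open>I(Q) \<ge> - ln \<phi>(\<kappa>)\<close>. Adding a small multiple of the indicator of an event to the test
function shows that equality forces \<open>Q = E\<^sub>\<kappa>\<close> (\<open>entropy_lower_bound\<close>,
\<open>entropy_rigidity\<close>). If \<open>L\<close> is a martingale under \<open>E\<^sub>\<kappa>\<close>, then \<open>E\<^sub>\<kappa>\<close> is in the class
and has entropy \<open>- ln \<phi>(\<kappa>)\<close>, so it is the unique minimiser.

From a minimiser to the Esscher martingale measure. A measure needs only a centred \<open>X\<close> to belong to
the class, so the class contains exponential tilts of \<open>M\<close> restricted to \<open>\<bar>X\<bar> \<le> n\<close>, with the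
exponent that minimises the truncated \<open>\<phi>\<close>; their entropy is minus the logarithm of that minimum.
Since \<open>L\<close> is not monotone, \<open>X\<close> takes both signs with positive probability
(\<open>mono_of_terminal_nonneg\<close>), the exponents stay bounded, and at a limit point \<open>\<kappa>\<close> Fatou's
lemma bounds \<open>\<phi>(\<kappa>)\<close> by the limit of the truncated minima
(\<open>mgf_minimiser_of_centred_truncations\<close>). So a minimiser \<open>Q\<close> has entropy at most
\<open>- ln \<phi>(\<kappa>)\<close>, and rigidity gives \<open>Q = E\<^sub>\<kappa>\<close>. In particular \<open>E\<^sub>\<kappa>\<close> is in the class,
although its localizing times are unknown and \<open>X\<close> might have a nonzero mean under it when \<open>\<kappa>\<close>
is an end point of the interval where \<open>\<phi>\<close> is finite. The lower bounds for the other exponents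
show that \<open>\<kappa>\<close> minimises \<open>\<phi>\<close>; together with a second exponent of finite \<open>\<phi>\<close> this makes
\<open>X\<close> integrable under \<open>E\<^sub>\<kappa>\<close> (\<open>integrable_esscher_of_minimal\<close>). Under \<open>E\<^sub>\<kappa>\<close> the process
is again a Levy process (\<open>levy_process_esscher\<close>), so Wald's identity holds at \<open>\<tau> k\<close>: the mean of
\<open>L\<close> at \<open>\<tau> k\<close>, which is zero, is a multiple of the mean of \<open>X\<close> by a factor that tends to one.
Hence \<open>X\<close> is centred, and \<open>L\<close> is a martingale (\<open>martingale_of_centred\<close>).
\<close>

section \<open>Relative entropy and its variational lower bound\<close>

text \<open>Translates the difference of extended integrals by which \<open>rel_entropy\<close> is defined
  into a Bochner integral.\<close>
lemma enn2ereal_diff_integral: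
  fixes f :: "'a \<Rightarrow> real"
  assumes f: "f \<in> borel_measurable M" and neg: "(\<integral>\<^sup>+x. ennreal (- f x) \<partial>M) < \<infinity>"
  shows "enn2ereal (\<integral>\<^sup>+x. ennreal (f x) \<partial>M) - enn2ereal (\<integral>\<^sup>+x. ennreal (- f x) \<partial>M) =
    (if integrable M f then ereal (\<integral>x. f x \<partial>M) else \<infinity>)"
proof (cases "(\<integral>\<^sup>+x. ennreal (f x) \<partial>M) < \<infinity>")
  case True
  then have int: "integrable M f"
    using f neg by (intro real_integrable_def[THEN iffD2]) auto
  obtain a where a: "(\<integral>\<^sup>+x. ennreal (f x) \<partial>M) = ennreal a" "0 \<le> a"
    using True by (metis ennreal_cases infinity_ennreal_def less_irrefl)
  obtain b where b: "(\<integral>\<^sup>+x. ennreal (- f x) \<partial>M) = ennreal b" "0 \<le> b"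
    using neg by (metis ennreal_cases infinity_ennreal_def less_irrefl)
  show ?thesis
    using int by (simp add: real_lebesgue_integral_def a b enn2ereal_ennreal)
next
  case False
  then have inf: "(\<integral>\<^sup>+x. ennreal (f x) \<partial>M) = \<infinity>"
    by (simp add: less_top[symmetric])
  then have "\<not> integrable M f"
    by (simp add: real_integrable_def)
  moreover obtain b where b: "(\<integral>\<^sup>+x. ennreal (- f x) \<partial>M) = ennreal b" "0 \<le> b"
    using neg by (metis ennreal_cases infinity_ennreal_def less_irrefl)
  ultimately show ?thesis
    by (simp add: inf b enn2ereal_ennreal)
qed

lemma mult_ln_ge: "x * ln x \<ge> x - 1" if "0 \<le> x" for x :: real
proof (cases "x = 0")
  case False
  with that have "0 < x" by simp
  have "- ln x \<le> 1 / x - 1"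
    using ln_le_minus_one[of "1 / x"] \<open>0 < x\<close> by (simp add: ln_div)
  then have "x * (- ln x) \<le> x * (1 / x - 1)"
    using \<open>0 < x\<close> by (intro mult_left_mono) auto
  then show ?thesis
    using \<open>0 < x\<close> by (simp add: algebra_simps)
qed simp

text \<open>Since \<open>x ln x \<ge> -1\<close>, the negative part has a finite integral, and the entropy can
  be infinite only because the positive part is.\<close>
lemma rel_entropy_eq:
  fixes P Q :: "'a measure"
  defines "D \<equiv> (\<lambda>\<omega>. enn2real (RN_deriv P Q \<omega>))"
  assumes P: "prob_space P" and ac: "absolutely_continuous P Q"
  shows "rel_entropy Q P =
    (if integrable P (\<lambda>\<omega>. D \<omega> * ln (D \<omega>)) then ereal (\<integral>\<omega>. D \<omega> * ln (D \<omega>) \<partial>P) else \<infinity>)"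
proof -
  interpret P: prob_space P by fact
  have [measurable]: "D \<in> borel_measurable P"
    by (simp add: D_def)
  have D0: "0 \<le> D \<omega>" for \<omega>
    by (simp add: D_def)
  have "(\<integral>\<^sup>+\<omega>. ennreal (- (D \<omega> * ln (D \<omega>))) \<partial>P) \<le> (\<integral>\<^sup>+\<omega>. 1 \<partial>P)"
    using mult_ln_ge[OF D0] D0
    by (intro nn_integral_mono) (smt (verit) ennreal_leI ennreal_1)
  also have "\<dots> < \<infinity>"
    by (simp add: P.emeasure_space_1)
  finally have "(\<integral>\<^sup>+\<omega>. ennreal (- (D \<omega> * ln (D \<omega>))) \<partial>P) < \<infinity>" .
  then show ?thesis
    using enn2ereal_diff_integral[of "\<lambda>\<omega>. D \<omega> * ln (D \<omega>)" P] ac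
    unfolding rel_entropy_def Let_def D_def[symmetric] by simp
qed

lemma rel_entropy_density:
  fixes d :: "'a \<Rightarrow> real"
  assumes P: "prob_space P" and d: "d \<in> borel_measurable P" "\<And>\<omega>. 0 \<le> d \<omega>"
    and int: "integrable P (\<lambda>\<omega>. d \<omega> * ln (d \<omega>))"
  shows "rel_entropy (density P (\<lambda>\<omega>. ennreal (d \<omega>))) P = ereal (\<integral>\<omega>. d \<omega> * ln (d \<omega>) \<partial>P)"
proof -
  interpret P: prob_space P by fact
  let ?Q = "density P (\<lambda>\<omega>. ennreal (d \<omega>))"
  let ?D = "\<lambda>\<omega>. enn2real (RN_deriv P ?Q \<omega>)"
  have m [measurable]: "d \<in> borel_measurable P" by fact
  have "AE \<omega> in P. ennreal (d \<omega>) = RN_deriv P ?Q \<omega>"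
    by (intro P.RN_deriv_unique) auto
  then have ae: "AE \<omega> in P. ?D \<omega> * ln (?D \<omega>) = d \<omega> * ln (d \<omega>)"
    by eventually_elim (metis d(2) enn2real_ennreal)
  have "integrable P (\<lambda>\<omega>. ?D \<omega> * ln (?D \<omega>))"
    using int by (subst integrable_cong_AE[OF _ _ ae]) auto
  moreover have "(\<integral>\<omega>. ?D \<omega> * ln (?D \<omega>) \<partial>P) = (\<integral>\<omega>. d \<omega> * ln (d \<omega>) \<partial>P)"
    by (rule integral_cong_AE[OF _ _ ae]) auto
  moreover have "absolutely_continuous P ?Q"
    by (intro absolutely_continuousI_density) auto
  ultimately show ?thesis
    using rel_entropy_eq[OF P, of ?Q] by simp
qed

text \<open>The Fenchel inequality for the conjugate pair \<open>x ln x - x\<close> and \<open>exp y\<close>: it is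
  \<open>1 + z \<le> exp z\<close> at \<open>z = y - ln x\<close>, multiplied by \<open>x\<close>.\<close>
lemma fenchel_mult_ln: "x * y \<le> x * ln x - x + exp y" if "0 \<le> x" for x y :: real
proof (cases "x = 0")
  case False
  with that have x: "0 < x" by simp
  have "x * (1 + (y - ln x)) \<le> x * exp (y - ln x)"
    using x exp_ge_add_one_self by (intro mult_left_mono) auto
  also have "\<dots> = exp y"
    using x by (simp add: exp_diff)
  finally show ?thesis
    by (simp add: algebra_simps)
qed simp

text \<open>The easy half of the Donsker-Varadhan formula. With \<open>D\<close> the density of \<open>Q\<close>, the
  Fenchel inequality gives \<open>D (g - ln C) \<le> D ln D - D + exp g / C\<close> pointwise; integrated under
  \<open>P\<close>, the last two terms contribute at most \<open>-1 + 1\<close>. It bounds the entropy from below by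
  testing it against any single function \<open>g\<close>, which spares all work with entropies on the
  \<open>\<sigma>\<close>-algebras of stopping times.\<close>
lemma donsker_varadhan:
  fixes P Q :: "'a measure"
  assumes P: "prob_space P" and Q: "prob_space Q" and sets: "sets Q = sets P"
    and ac: "absolutely_continuous P Q"
    and g: "integrable Q g" and C: "(\<integral>\<^sup>+\<omega>. ennreal (exp (g \<omega>)) \<partial>P) \<le> ennreal C" "0 < C"
  shows "ereal ((\<integral>\<omega>. g \<omega> \<partial>Q) - ln C) \<le> rel_entropy Q P"
proof -
  interpret P: prob_space P by fact
  interpret Q: prob_space Q by fact
  let ?R = "RN_deriv P Q"
  define D where "D = (\<lambda>\<omega>. enn2real (?R \<omega>))"
  have [measurable]: "D \<in> borel_measurable P"
    by (simp add: D_def)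
  have mg [measurable]: "g \<in> borel_measurable P"
    using g sets by (metis borel_measurable_integrable measurable_cong_sets)
  have D0: "0 \<le> D \<omega>" for \<omega>
    by (simp add: D_def)
  have "AE \<omega> in P. ?R \<omega> \<noteq> \<infinity>"
    using P.RN_deriv_finite[OF _ ac sets] Q.sigma_finite_measure_axioms by simp
  then have "AE \<omega> in P. ?R \<omega> = ennreal (D \<omega>)"
    by eventually_elim (simp add: D_def ennreal_enn2real_if)
  then have "density P ?R = density P (\<lambda>\<omega>. ennreal (D \<omega>))"
    by (intro density_cong) auto
  then have QD: "Q = density P (\<lambda>\<omega>. ennreal (D \<omega>))"
    using P.density_RN_deriv[OF ac sets] by simp
  have intg: "integrable P (\<lambda>\<omega>. D \<omega> * g \<omega>)"
    using g D0 unfolding QD by (subst (asm) integrable_density) auto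
  have eqg: "(\<integral>\<omega>. g \<omega> \<partial>Q) = (\<integral>\<omega>. D \<omega> * g \<omega> \<partial>P)"
    using D0 unfolding QD by (subst integral_density) auto
  have "integrable Q (\<lambda>_. 1 :: real)" by simp
  then have intD: "integrable P D"
    using D0 unfolding QD by (subst (asm) integrable_density) auto
  have "(\<integral>\<omega>. 1 \<partial>Q) = (\<integral>\<omega>. D \<omega> * 1 \<partial>P)"
    using D0 unfolding QD by (subst integral_density) auto
  then have D1: "(\<integral>\<omega>. D \<omega> \<partial>P) = 1"
    using Q.prob_space by simp
  have inte: "integrable P (\<lambda>\<omega>. exp (g \<omega>))"
    using C(1) by (intro integrableI_bounded) (auto simp: le_less_trans)
  have eC: "(\<integral>\<omega>. exp (g \<omega>) \<partial>P) \<le> C"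
    using C by (subst integral_eq_nn_integral) (auto intro!: enn2real_leI)
  have re: "rel_entropy Q P =
      (if integrable P (\<lambda>\<omega>. D \<omega> * ln (D \<omega>)) then ereal (\<integral>\<omega>. D \<omega> * ln (D \<omega>) \<partial>P) else \<infinity>)"
    unfolding D_def by (rule rel_entropy_eq[OF P ac])
  show ?thesis
  proof (cases "integrable P (\<lambda>\<omega>. D \<omega> * ln (D \<omega>))")
    case True
    have "(\<integral>\<omega>. D \<omega> * g \<omega> - ln C * D \<omega> \<partial>P)
        \<le> (\<integral>\<omega>. D \<omega> * ln (D \<omega>) - D \<omega> + exp (g \<omega>) / C \<partial>P)"
    proof (intro integral_mono)
      show "D \<omega> * g \<omega> - ln C * D \<omega> \<le> D \<omega> * ln (D \<omega>) - D \<omega> + exp (g \<omega>) / C" for \<omega>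
        using fenchel_mult_ln[OF D0, of \<omega> "g \<omega> - ln C"] C(2)
        by (simp add: exp_diff algebra_simps)
    qed (use True intg intD inte in auto)
    also have "\<dots> = (\<integral>\<omega>. D \<omega> * ln (D \<omega>) \<partial>P) - 1 + (\<integral>\<omega>. exp (g \<omega>) \<partial>P) / C"
      using True intD inte D1 by simp
    also have "\<dots> \<le> (\<integral>\<omega>. D \<omega> * ln (D \<omega>) \<partial>P)"
      using eC C(2) by simp
    finally show ?thesis
      using True intg intD D1 by (simp add: re eqg)
  next
    case False
    then show ?thesis
      by (simp add: re)
  qed
qed

text \<open>On \<open>B\<close> the logarithm of the density is \<open>\<kappa> X - ln c\<close>. When the tilted mean of \<open>X\<close>
  is zero, only the normalising constant survives in the entropy.\<close>
lemma exponential_tilt: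
  fixes X :: "'a \<Rightarrow> real"
  assumes P: "prob_space P" and X [measurable]: "X \<in> borel_measurable P"
    and B [measurable]: "B \<in> sets P"
    and int: "integrable P (\<lambda>\<omega>. exp (\<kappa> * X \<omega>) * indicator B \<omega>)"
    and c: "c = (\<integral>\<omega>. exp (\<kappa> * X \<omega>) * indicator B \<omega> \<partial>P)" "0 < c"
    and intX: "integrable P (\<lambda>\<omega>. X \<omega> * (exp (\<kappa> * X \<omega>) * indicator B \<omega>))"
    and centred: "(\<integral>\<omega>. X \<omega> * (exp (\<kappa> * X \<omega>) * indicator B \<omega>) \<partial>P) = 0"
  defines "Q \<equiv> density P (\<lambda>\<omega>. ennreal (exp (\<kappa> * X \<omega>) * indicator B \<omega> / c))"
  shows "prob_space Q" "integrable Q X" "(\<integral>\<omega>. X \<omega> \<partial>Q) = 0" "rel_entropy Q P = ereal (- ln c)"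
proof -
  interpret P: prob_space P by fact
  let ?d = "\<lambda>\<omega>. exp (\<kappa> * X \<omega>) * indicator B \<omega> / c"
  have d0: "0 \<le> ?d \<omega>" for \<omega>
    using c(2) by (simp add: indicator_def)
  show "prob_space Q"
  proof (rule prob_spaceI)
    have "emeasure Q (space Q) = (\<integral>\<^sup>+\<omega>. ennreal (?d \<omega>) \<partial>P)"
      unfolding Q_def by (subst emeasure_density)
        (auto intro!: nn_integral_cong simp: indicator_def)
    also have "\<dots> = ennreal (\<integral>\<omega>. ?d \<omega> \<partial>P)"
      using int d0 by (intro nn_integral_eq_integral) auto
    also have "\<dots> = 1"
      using c by simp
    finally show "emeasure Q (space Q) = 1" .
  qed
  have dX: "?d \<omega> * X \<omega> = X \<omega> * (exp (\<kappa> * X \<omega>) * indicator B \<omega>) / c" for \<omega>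
    by simp
  show "integrable Q X"
    unfolding Q_def using d0 intX by (subst integrable_density) (auto simp: dX simp del: times_divide_eq_left)
  show "(\<integral>\<omega>. X \<omega> \<partial>Q) = 0"
    unfolding Q_def using d0 centred by (subst integral_density) (auto simp: dX simp del: times_divide_eq_left)
  have dln: "?d \<omega> * ln (?d \<omega>) =
      \<kappa> / c * (X \<omega> * (exp (\<kappa> * X \<omega>) * indicator B \<omega>)) - ln c / c * (exp (\<kappa> * X \<omega>) * indicator B \<omega>)" for \<omega>
    using c(2) by (auto simp: indicator_def ln_div field_simps)
  have "rel_entropy Q P = ereal (\<integral>\<omega>. ?d \<omega> * ln (?d \<omega>) \<partial>P)"
    unfolding Q_def
  proof (intro rel_entropy_density P d0)
    show "integrable P (\<lambda>\<omega>. ?d \<omega> * ln (?d \<omega>))"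
      unfolding dln using int intX by auto
  qed auto
  also have "(\<integral>\<omega>. ?d \<omega> * ln (?d \<omega>) \<partial>P) = - ln c"
    unfolding dln using int intX centred c by simp
  finally show "rel_entropy Q P = ereal (- ln c)" .
qed

section \<open>Minimising a moment generating function through centred truncations\<close>

text \<open>Fatou's lemma, in the form in which a uniform bound passes to a pointwise limit.\<close>
lemma nn_integral_limit_le:
  fixes f :: "nat \<Rightarrow> 'a \<Rightarrow> ennreal"
  assumes "\<And>i. f i \<in> borel_measurable M" "\<And>x. x \<in> space M \<Longrightarrow> (\<lambda>i. f i x) \<longlonglongrightarrow> g x"
    and "\<And>i. (\<integral>\<^sup>+x. f i x \<partial>M) \<le> C"
  shows "(\<integral>\<^sup>+x. g x \<partial>M) \<le> C"
proof -
  have "(\<integral>\<^sup>+x. g x \<partial>M) = (\<integral>\<^sup>+x. liminf (\<lambda>i. f i x) \<partial>M)"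
    using assms(2) by (intro nn_integral_cong) (metis lim_imp_Liminf sequentially_bot)
  also have "\<dots> \<le> liminf (\<lambda>i. \<integral>\<^sup>+x. f i x \<partial>M)"
    by (intro nn_integral_liminf assms)
  also have "\<dots> \<le> C"
    using assms(3) by (intro Liminf_le) (auto intro!: always_eventually)
  finally show ?thesis .
qed

lemma exp_upper_quadratic: "exp x \<le> 1 + x + 2 * x\<^sup>2" if "\<bar>x\<bar> \<le> 1 / 2" for x :: real
proof -
  have "1 - x \<le> exp (- x)"
    using exp_ge_add_one_self[of "- x"] by simp
  then have "exp x * (1 - x) \<le> exp x * exp (- x)"
    by (intro mult_left_mono) auto
  then have "exp x * (1 - x) \<le> 1"
    by (simp add: exp_minus)
  also have "\<dots> \<le> 1 + x\<^sup>2 * (1 - 2 * x)"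
    using that by simp
  also have "\<dots> = (1 + x + 2 * x\<^sup>2) * (1 - x)"
    by (simp add: power2_eq_square algebra_simps)
  finally show ?thesis
    using that by (subst (asm) mult_le_cancel_right_pos) auto
qed

context prob_space
begin

text \<open>Some interval \<open>[a, N]\<close> with \<open>a > 0\<close> carries a mass \<open>p > 0\<close>. Every truncation at a
  level \<open>n \<ge> N\<close> keeps that mass, so the truncated moment generating function at \<open>\<kappa> > 0\<close> is
  at least \<open>p exp (\<kappa> a)\<close>. The thresholds work for all these \<open>n\<close> at once; this is what keeps
  the minimisers of the truncated functions bounded.\<close>
lemma truncated_mgf_unbounded:
  assumes X [measurable]: "X \<in> borel_measurable M" and pos: "0 < prob {\<omega>\<in>space M. 0 < X \<omega>}"
  shows "\<exists>N K. \<forall>n\<ge>N. \<forall>\<kappa>>K.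
    1 < (\<integral>\<omega>. exp (\<kappa> * X \<omega>) * indicator {\<omega>\<in>space M. \<bar>X \<omega>\<bar> \<le> real n} \<omega> \<partial>M)"
proof -
  let ?A = "\<lambda>m. {\<omega>\<in>space M. 1 / real (Suc m) \<le> X \<omega> \<and> X \<omega> \<le> real (Suc m)}"
  have "\<exists>m. prob (?A m) \<noteq> 0"
  proof (rule ccontr)
    assume "\<not> ?thesis"
    then have "emeasure M (\<Union>m. ?A m) = 0"
      by (intro emeasure_UN_eq_0) (auto simp: emeasure_eq_measure)
    moreover have "{\<omega>\<in>space M. 0 < X \<omega>} \<subseteq> (\<Union>m. ?A m)"
    proof
      fix \<omega> assume \<omega>: "\<omega> \<in> {\<omega>\<in>space M. 0 < X \<omega>}"
      obtain m1 where m1: "1 / real (Suc m1) < X \<omega>"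
        using \<omega> nat_approx_posE by blast
      obtain m2 where m2: "X \<omega> < real m2"
        using reals_Archimedean2 by blast
      have "1 / real (Suc (max m1 m2)) \<le> 1 / real (Suc m1)"
        by (intro divide_left_mono) auto
      then show "\<omega> \<in> (\<Union>m. ?A m)"
        using m1 m2 \<omega> by (intro UN_I[of "max m1 m2"]) auto
    qed
    then have "emeasure M {\<omega>\<in>space M. 0 < X \<omega>} \<le> emeasure M (\<Union>m. ?A m)"
      by (intro emeasure_mono) auto
    ultimately have "emeasure M {\<omega>\<in>space M. 0 < X \<omega>} = 0"
      by simp
    then show False
      using pos by (simp add: emeasure_eq_measure)
  qed
  then obtain m where m: "0 < prob (?A m)"
    using zero_less_measure_iff by blast
  define a where "a = 1 / real (Suc m)"
  have a: "0 < a" by (simp add: a_def)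
  let ?p = "prob (?A m)"
  show ?thesis
  proof (intro exI allI impI)
    \<comment> \<open>Beyond this threshold \<open>exp (\<kappa> a) p \<ge> \<kappa> a p > 1\<close>.\<close>
    fix n \<kappa> assume n: "Suc m \<le> n" and \<kappa>: "1 / (a * ?p) < \<kappa>"
    then have k0: "0 < \<kappa>"
      using a m by (meson less_trans zero_less_divide_1_iff mult_pos_pos)
    have "1 < \<kappa> * a * ?p"
      using \<kappa> a m by (simp add: divide_simps mult.assoc)
    also have "\<dots> \<le> exp (\<kappa> * a) * ?p"
      by (intro mult_right_mono order_trans[OF _ exp_ge_add_one_self]) auto
    also have "\<dots> = (\<integral>\<omega>. exp (\<kappa> * a) * indicator (?A m) \<omega> \<partial>M)"
      by simp
    also have "\<dots> \<le> (\<integral>\<omega>. exp (\<kappa> * X \<omega>) * indicator {\<omega>\<in>space M. \<bar>X \<omega>\<bar> \<le> real n} \<omega> \<partial>M)"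
    proof (intro integral_mono)
      have "?A m \<in> events"
        by measurable
      then show "integrable M (\<lambda>\<omega>. exp (\<kappa> * a) * indicator (?A m) \<omega>)"
        by (intro integrable_mult_right integrable_real_indicator) (auto simp: emeasure_eq_measure)
      show "integrable M (\<lambda>\<omega>. exp (\<kappa> * X \<omega>) * indicator {\<omega>\<in>space M. \<bar>X \<omega>\<bar> \<le> real n} \<omega>)"
        using k0 by (intro integrable_const_bound[where B="exp (\<kappa> * real n)"])
          (auto simp: indicator_def)
      show "exp (\<kappa> * a) * indicator (?A m) \<omega>
          \<le> exp (\<kappa> * X \<omega>) * indicator {\<omega>\<in>space M. \<bar>X \<omega>\<bar> \<le> real n} \<omega>" for \<omega>
      proof (cases "\<omega> \<in> ?A m")
        case True
        then have X: "a \<le> X \<omega>" "X \<omega> \<le> real (Suc m)"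
          by (auto simp: a_def)
        then have "\<bar>X \<omega>\<bar> \<le> real n"
          using a n by linarith
        then show ?thesis
          using True X(1) k0 by (simp add: indicator_def)
      next
        case False
        show ?thesis
          unfolding indicator_simps(2)[OF False] by simp
      qed
    qed
    finally show "1 < \<dots>" .
  qed
qed

text \<open>Outside \<open>[-K, K]\<close> the function exceeds \<open>1\<close>, hence its value at \<open>0\<close>, so its minimum over
  this interval is global. At the minimiser the derivative vanishes. The derivative is not taken
  under the integral: with \<open>D\<close> the integral in the conclusion, the quadratic bound for \<open>exp\<close>
  gives \<open>0 \<le> h D + O(h\<^sup>2)\<close> for small \<open>h\<close> of both signs, which forces \<open>D = 0\<close>.\<close>
lemma truncated_mgf_minimiser:
  assumes X [measurable]: "X \<in> borel_measurable M"
  defines "g \<equiv> \<lambda>n \<kappa>. \<integral>\<omega>. exp (\<kappa> * X \<omega>) * indicator {\<omega>\<in>space M. \<bar>X \<omega>\<bar> \<le> real n} \<omega> \<partial>M"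
  assumes K: "0 \<le> K" "\<And>\<kappa>. K < \<bar>\<kappa>\<bar> \<Longrightarrow> 1 < g n \<kappa>"
  shows "\<exists>\<kappa>\<in>{-K..K}. (\<integral>\<omega>. X \<omega> *
    (exp (\<kappa> * X \<omega>) * indicator {\<omega>\<in>space M. \<bar>X \<omega>\<bar> \<le> real n} \<omega>) \<partial>M) = 0"
proof -
  let ?I = "\<lambda>\<omega>. indicator {\<omega>\<in>space M. \<bar>X \<omega>\<bar> \<le> real n} \<omega> :: real"
  have bound: "exp (\<kappa> * X \<omega>) * ?I \<omega> \<le> exp (R * real n)" if "\<bar>\<kappa>\<bar> \<le> R" for \<kappa> R \<omega>
  proof -
    have "\<kappa> * X \<omega> \<le> R * real n" if "\<bar>X \<omega>\<bar> \<le> real n"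
    proof -
      have "\<kappa> * X \<omega> \<le> \<bar>\<kappa>\<bar> * \<bar>X \<omega>\<bar>"
        by (metis abs_ge_self abs_mult)
      also have "\<dots> \<le> R * real n"
        using that \<open>\<bar>\<kappa>\<bar> \<le> R\<close> by (intro mult_mono) auto
      finally show ?thesis .
    qed
    then show ?thesis
      by (auto simp: indicator_def)
  qed
  have int: "integrable M (\<lambda>\<omega>. exp (\<kappa> * X \<omega>) * ?I \<omega>)" for \<kappa>
    using bound[of \<kappa> "\<bar>\<kappa>\<bar>"] by (intro integrable_const_bound[where B="exp (\<bar>\<kappa>\<bar> * real n)"]) auto
  have intX: "integrable M (\<lambda>\<omega>. X \<omega> * (exp (\<kappa> * X \<omega>) * ?I \<omega>))" for \<kappa>
  proof (rule Bochner_Integration.integrable_bound)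
    show "integrable M (\<lambda>\<omega>. real n * (exp (\<kappa> * X \<omega>) * ?I \<omega>))"
      using int by simp
  qed (auto simp: indicator_def abs_mult)
  have "continuous_on {-K..K} (g n)"
  proof (intro continuous_at_imp_continuous_on ballI, unfold continuous_at_sequentially, intro allI impI)
    fix \<kappa> u assume "u \<longlonglongrightarrow> (\<kappa> :: real)"
    then obtain R where R: "\<And>i. norm (u i) \<le> R"
      using Bseq_def convergent_imp_Bseq convergentI by metis
    show "(g n \<circ> u) \<longlonglongrightarrow> g n \<kappa>"
      unfolding g_def comp_def
    proof (rule integral_dominated_convergence[where w="\<lambda>_. exp (R * real n)"])
      show "AE \<omega> in M. (\<lambda>i. exp (u i * X \<omega>) * ?I \<omega>) \<longlonglongrightarrow> exp (\<kappa> * X \<omega>) * ?I \<omega>"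
        using \<open>u \<longlonglongrightarrow> \<kappa>\<close> by (intro AE_I2 tendsto_intros)
      show "AE \<omega> in M. norm (exp (u i * X \<omega>) * ?I \<omega>) \<le> exp (R * real n)" for i
        using bound[of "u i" R] R[of i] by (intro AE_I2) (simp add: abs_mult)
    qed auto
  qed
  then obtain \<kappa> where \<kappa>: "\<kappa> \<in> {-K..K}" and min: "\<And>y. y \<in> {-K..K} \<Longrightarrow> g n \<kappa> \<le> g n y"
    using continuous_attains_inf[of "{-K..K}" "g n"] K(1) by auto
  have "g n 0 \<le> (\<integral>\<omega>. 1 \<partial>M)"
    unfolding g_def by (intro integral_mono int) (auto simp: indicator_def)
  then have "g n \<kappa> \<le> 1"
    using min[of 0] K(1) prob_space by simp
  then have gmin: "g n \<kappa> \<le> g n y" for y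
    using min[of y] K(2)[of y] by (cases "K < \<bar>y\<bar>") (auto simp: abs_le_iff not_less)
  let ?D = "\<integral>\<omega>. X \<omega> * (exp (\<kappa> * X \<omega>) * ?I \<omega>) \<partial>M"
  define c where "c = 2 * (real n)\<^sup>2 * g n \<kappa>"
  have est: "0 \<le> h * ?D + h\<^sup>2 * c" if h: "\<bar>h\<bar> * real n \<le> 1 / 2" for h
  proof -
    have "g n (\<kappa> + h) \<le> (\<integral>\<omega>. exp (\<kappa> * X \<omega>) * ?I \<omega> + h * (X \<omega> * (exp (\<kappa> * X \<omega>) * ?I \<omega>))
        + 2 * h\<^sup>2 * (real n)\<^sup>2 * (exp (\<kappa> * X \<omega>) * ?I \<omega>) \<partial>M)"
      unfolding g_def
    proof (intro integral_mono int)
      fix \<omega>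
      show "exp ((\<kappa> + h) * X \<omega>) * ?I \<omega> \<le> exp (\<kappa> * X \<omega>) * ?I \<omega> + h * (X \<omega> * (exp (\<kappa> * X \<omega>) * ?I \<omega>))
        + 2 * h\<^sup>2 * (real n)\<^sup>2 * (exp (\<kappa> * X \<omega>) * ?I \<omega>)"
      proof (cases "\<omega> \<in> space M \<and> \<bar>X \<omega>\<bar> \<le> real n")
        case True
        have "\<bar>h * X \<omega>\<bar> \<le> \<bar>h\<bar> * real n"
          using True by (simp add: abs_mult mult_left_mono)
        then have "\<bar>h * X \<omega>\<bar> \<le> 1 / 2"
          using h by simp
        then have "exp (h * X \<omega>) \<le> 1 + h * X \<omega> + 2 * (h * X \<omega>)\<^sup>2"
          by (rule exp_upper_quadratic)
        also have "\<dots> \<le> 1 + h * X \<omega> + 2 * (h\<^sup>2 * (real n)\<^sup>2)"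
          using True abs_le_square_iff[of "X \<omega>" "real n"]
          by (simp add: power_mult_distrib mult_left_mono)
        finally have "exp (\<kappa> * X \<omega>) * exp (h * X \<omega>)
            \<le> exp (\<kappa> * X \<omega>) * (1 + h * X \<omega> + 2 * (h\<^sup>2 * (real n)\<^sup>2))"
          by (intro mult_left_mono) auto
        then show ?thesis
          using True by (simp add: exp_add algebra_simps)
      qed (auto simp: indicator_def)
    qed (use int intX in auto)
    also have "\<dots> = g n \<kappa> + h * ?D + h\<^sup>2 * c"
      using int intX by (simp add: g_def c_def)
    finally show ?thesis
      using gmin[of "\<kappa> + h"] by simp
  qed
  have "\<bar>?D\<bar> \<le> h * c" if h: "0 < h" "h * real n \<le> 1 / 2" for h
  proof -
    have "0 \<le> h * (?D + h * c)" "0 \<le> h * (h * c - ?D)"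
      using est[of h] est[of "- h"] h by (auto simp: power2_eq_square algebra_simps)
    then show ?thesis
      using h(1) by (auto simp: zero_le_mult_iff)
  qed
  note small = this
  have "(\<lambda>i. 1 / real (Suc i) * c) \<longlonglongrightarrow> 0 * c"
    using lim_inverse_n' [THEN LIMSEQ_Suc] by (intro tendsto_intros) (simp add: inverse_eq_divide)
  moreover have "\<forall>\<^sub>F i in sequentially. \<bar>?D\<bar> \<le> 1 / real (Suc i) * c"
    using eventually_ge_at_top[of "2 * n"]
    by eventually_elim (intro small, auto simp: field_simps)
  ultimately have "\<bar>?D\<bar> \<le> 0 * c"
    by (rule tendsto_lowerbound) auto
  then show ?thesis
    using \<kappa> by auto
qed

text \<open>The exponents \<open>u\<close> that centre the truncations of \<open>X\<close> lie in a fixed compact interval.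
  Along a convergent subsequence, Fatou's lemma compares the full moment generating function at
  the limit \<open>\<kappa>\<close> with the truncated ones. The bound \<open>C\<close> is quantified after \<open>\<kappa>\<close>, so
  that the same \<open>\<kappa>\<close> serves every \<open>C\<close>: \<open>C = 0\<close> yields the existence of a centred
  truncation of positive mass, and a \<open>C\<close> read off from an entropy yields the comparison with it.\<close>
lemma mgf_minimiser_of_centred_truncations:
  assumes X [measurable]: "X \<in> borel_measurable M"
    and pos: "0 < prob {\<omega>\<in>space M. 0 < X \<omega>}" "0 < prob {\<omega>\<in>space M. X \<omega> < 0}"
  defines "I \<equiv> \<lambda>n \<omega>. indicator {\<omega>\<in>space M. \<bar>X \<omega>\<bar> \<le> real n} \<omega> :: real"
  shows "\<exists>\<kappa>. \<forall>C. (\<forall>n u. (\<integral>\<omega>. X \<omega> * (exp (u * X \<omega>) * I n \<omega>) \<partial>M) = 0 \<longrightarrow>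
      ennreal (\<integral>\<omega>. exp (u * X \<omega>) * I n \<omega> \<partial>M) \<le> C) \<longrightarrow>
    (\<integral>\<^sup>+\<omega>. ennreal (exp (\<kappa> * X \<omega>)) \<partial>M) \<le> C"
proof -
  obtain N1 K1 where 1: "\<And>n \<kappa>. N1 \<le> n \<Longrightarrow> K1 < \<kappa> \<Longrightarrow> 1 < (\<integral>\<omega>. exp (\<kappa> * X \<omega>) * I n \<omega> \<partial>M)"
    using truncated_mgf_unbounded[OF X pos(1)] unfolding I_def by blast
  obtain N2 K2 where 2: "\<And>n \<kappa>. N2 \<le> n \<Longrightarrow> K2 < \<kappa> \<Longrightarrow> 1 < (\<integral>\<omega>. exp (- \<kappa> * X \<omega>) * I n \<omega> \<partial>M)"
    using truncated_mgf_unbounded[of "\<lambda>\<omega>. - X \<omega>"] pos(2) unfolding I_def by auto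
  define N where "N = max N1 N2"
  define K where "K = max 0 (max K1 K2)"
  have "\<exists>\<kappa>\<in>{-K..K}. (\<integral>\<omega>. X \<omega> * (exp (\<kappa> * X \<omega>) * I (N + i) \<omega>) \<partial>M) = 0" for i
    unfolding I_def
  proof (rule truncated_mgf_minimiser[OF X])
    fix \<kappa> assume "K < \<bar>\<kappa>\<bar>"
    then show "1 < (\<integral>\<omega>. exp (\<kappa> * X \<omega>) * indicator {\<omega>\<in>space M. \<bar>X \<omega>\<bar> \<le> real (N + i)} \<omega> \<partial>M)"
      using 1[of "N + i" \<kappa>] 2[of "N + i" "- \<kappa>"] unfolding I_def K_def N_def
      by (cases "0 \<le> \<kappa>") auto
  qed (simp add: K_def)
  then obtain u where u: "\<And>i. u i \<in> {-K..K}"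
    "\<And>i. (\<integral>\<omega>. X \<omega> * (exp (u i * X \<omega>) * I (N + i) \<omega>) \<partial>M) = 0"
    by metis
  obtain \<kappa> r where r: "strict_mono r" "(u \<circ> r) \<longlonglongrightarrow> (\<kappa> :: real)"
    using seq_compactE[OF compact_imp_seq_compact[OF compact_Icc, of "-K" K], of u] u(1) by metis
  show ?thesis
  proof (intro exI[of _ \<kappa>] allI impI)
    fix C :: ennreal
    assume C: "\<forall>n u. (\<integral>\<omega>. X \<omega> * (exp (u * X \<omega>) * I n \<omega>) \<partial>M) = 0 \<longrightarrow>
      ennreal (\<integral>\<omega>. exp (u * X \<omega>) * I n \<omega> \<partial>M) \<le> C"
    show "(\<integral>\<^sup>+\<omega>. ennreal (exp (\<kappa> * X \<omega>)) \<partial>M) \<le> C"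
    proof (rule nn_integral_limit_le)
      show "(\<lambda>i. ennreal (exp (u (r i) * X \<omega>) * I (N + r i) \<omega>)) \<longlonglongrightarrow> ennreal (exp (\<kappa> * X \<omega>))"
        if \<omega>: "\<omega> \<in> space M" for \<omega>
      proof (rule tendsto_ennrealI)
        obtain m where m: "\<bar>X \<omega>\<bar> \<le> real m"
          using real_arch_simple by blast
        have "\<forall>\<^sub>F i in sequentially. exp (u (r i) * X \<omega>) = exp (u (r i) * X \<omega>) * I (N + r i) \<omega>"
          using eventually_ge_at_top[of m]
        proof eventually_elim
          case (elim i)
          then have "real m \<le> real (N + r i)"
            using seq_suble[OF r(1), of i] by linarith
          then show ?case
            using m \<omega> by (auto simp: I_def)
        qed
        moreover have "(\<lambda>i. exp (u (r i) * X \<omega>)) \<longlonglongrightarrow> exp (\<kappa> * X \<omega>)"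
          using r(2) by (intro tendsto_intros) (simp add: comp_def)
        ultimately show "(\<lambda>i. exp (u (r i) * X \<omega>) * I (N + r i) \<omega>) \<longlonglongrightarrow> exp (\<kappa> * X \<omega>)"
          by (rule Lim_transform_eventually[rotated])
      qed
    next
      fix i
      have bound: "u (r i) * X \<omega> \<le> K * real (N + r i)" if "\<bar>X \<omega>\<bar> \<le> real (N + r i)" for \<omega>
      proof -
        have "u (r i) * X \<omega> \<le> \<bar>u (r i)\<bar> * \<bar>X \<omega>\<bar>"
          by (metis abs_ge_self abs_mult)
        also have "\<dots> \<le> K * real (N + r i)"
          using that u(1)[of "r i"] by (intro mult_mono) auto
        finally show ?thesis .
      qed
      have "integrable M (\<lambda>\<omega>. exp (u (r i) * X \<omega>) * I (N + r i) \<omega>)"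
        using bound unfolding I_def
        by (intro integrable_const_bound[where B="exp (K * real (N + r i))"]) (auto simp: indicator_def)
      then have "(\<integral>\<^sup>+\<omega>. ennreal (exp (u (r i) * X \<omega>) * I (N + r i) \<omega>) \<partial>M)
          = ennreal (\<integral>\<omega>. exp (u (r i) * X \<omega>) * I (N + r i) \<omega> \<partial>M)"
        by (intro nn_integral_eq_integral) (auto simp: I_def)
      also have "\<dots> \<le> C"
        using C u(2) by blast
      finally show "(\<integral>\<^sup>+\<omega>. ennreal (exp (u (r i) * X \<omega>) * I (N + r i) \<omega>) \<partial>M) \<le> C" .
    qed (auto simp: I_def)
  qed
qed

text \<open>The difference quotients \<open>(exp (s X) - 1) / s\<close> decrease to \<open>X\<close> as \<open>s\<close> decreases
  to \<open>0\<close>, stay below \<open>exp X\<close>, and have nonnegative means. Fatou's lemma, applied to their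
  distances from \<open>exp X\<close>, bounds the mean of \<open>exp X - X\<close>.\<close>
lemma integrable_of_mgf_min_at_0:
  assumes X [measurable]: "X \<in> borel_measurable M"
    and fin: "(\<integral>\<^sup>+\<omega>. ennreal (exp (X \<omega>)) \<partial>M) < \<infinity>"
    and ge1: "\<And>s. 0 < s \<Longrightarrow> s \<le> 1 \<Longrightarrow> 1 \<le> (\<integral>\<^sup>+\<omega>. ennreal (exp (s * X \<omega>)) \<partial>M)"
  shows "integrable M X"
proof -
  have intexp: "integrable M (\<lambda>\<omega>. exp (X \<omega>))"
    using fin by (intro integrableI_bounded) auto
  have convex: "exp (s * x) \<le> 1 - s + s * exp x" if "0 < s" "s \<le> 1" for s x :: real
    using convex_onD[OF exp_convex, of s 0 x] that by simp
  have quotient: "(exp (s * x) - 1) / s \<le> exp x" if "0 < s" "s \<le> 1" for s x :: real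
    using convex[OF that, of x] that by (simp add: field_simps)
  have key: "(\<integral>\<^sup>+\<omega>. ennreal (exp (X \<omega>) - (exp (s * X \<omega>) - 1) / s) \<partial>M) \<le> (\<integral>\<^sup>+\<omega>. ennreal (exp (X \<omega>)) \<partial>M)"
    if s: "0 < s" "s \<le> 1" for s
  proof -
    have ints: "integrable M (\<lambda>\<omega>. exp (s * X \<omega>))"
    proof (rule Bochner_Integration.integrable_bound)
      show "integrable M (\<lambda>\<omega>. 1 - s + s * exp (X \<omega>))"
        using intexp by simp
      show "AE \<omega> in M. norm (exp (s * X \<omega>)) \<le> norm (1 - s + s * exp (X \<omega>))"
        using convex[OF s] by (intro AE_I2) (smt (verit) exp_gt_zero real_norm_def)
    qed auto
    have "ennreal 1 \<le> ennreal (\<integral>\<omega>. exp (s * X \<omega>) \<partial>M)"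
      using ge1[OF s] ints by (subst (asm) nn_integral_eq_integral) auto
    then have "1 \<le> (\<integral>\<omega>. exp (s * X \<omega>) \<partial>M)"
      by (subst (asm) ennreal_le_iff) auto
    then have "(\<integral>\<omega>. exp (X \<omega>) - (exp (s * X \<omega>) - 1) / s \<partial>M) \<le> (\<integral>\<omega>. exp (X \<omega>) \<partial>M)"
      using ints intexp prob_space s by simp
    moreover have "(\<integral>\<^sup>+\<omega>. ennreal (exp (X \<omega>) - (exp (s * X \<omega>) - 1) / s) \<partial>M)
        = ennreal (\<integral>\<omega>. exp (X \<omega>) - (exp (s * X \<omega>) - 1) / s \<partial>M)"
      using ints intexp quotient[OF s] by (intro nn_integral_eq_integral) auto
    moreover have "(\<integral>\<^sup>+\<omega>. ennreal (exp (X \<omega>)) \<partial>M) = ennreal (\<integral>\<omega>. exp (X \<omega>) \<partial>M)"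
      using intexp by (intro nn_integral_eq_integral) auto
    ultimately show ?thesis
      by (simp add: ennreal_leI)
  qed
  let ?s = "\<lambda>i. inverse (real (Suc i))"
  have lim: "(\<lambda>i. (exp (?s i * x) - 1) / ?s i) \<longlonglongrightarrow> x" for x :: real
  proof -
    have "((\<lambda>s. exp (s * x)) has_real_derivative x) (at 0)"
      by (auto intro!: derivative_eq_intros)
    then have "((\<lambda>h. (exp (h * x) - 1) / h) \<longlongrightarrow> x) (at 0)"
      by (simp add: DERIV_def)
    moreover have "filterlim ?s (at 0) sequentially"
      using LIMSEQ_inverse_real_of_nat by (simp add: filterlim_at)
    ultimately show ?thesis
      by (rule filterlim_compose)
  qed
  have "(\<integral>\<^sup>+\<omega>. ennreal (exp (X \<omega>) - X \<omega>) \<partial>M) \<le> (\<integral>\<^sup>+\<omega>. ennreal (exp (X \<omega>)) \<partial>M)"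
  proof (rule nn_integral_limit_le)
    show "(\<lambda>i. ennreal (exp (X \<omega>) - (exp (?s i * X \<omega>) - 1) / ?s i)) \<longlonglongrightarrow> ennreal (exp (X \<omega>) - X \<omega>)" for \<omega>
      by (intro tendsto_ennrealI tendsto_diff tendsto_const lim)
    show "(\<integral>\<^sup>+\<omega>. ennreal (exp (X \<omega>) - (exp (?s i * X \<omega>) - 1) / ?s i) \<partial>M)
        \<le> (\<integral>\<^sup>+\<omega>. ennreal (exp (X \<omega>)) \<partial>M)" for i
      by (rule key) (auto simp: field_simps)
  qed auto
  then have "(\<integral>\<^sup>+\<omega>. ennreal (exp (X \<omega>) - X \<omega>) \<partial>M) < \<infinity>"
    using fin by (rule le_less_trans)
  moreover have "0 \<le> exp (X \<omega>) - X \<omega>" for \<omega>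
    using exp_ge_add_one_self[of "X \<omega>"] by linarith
  ultimately have "integrable M (\<lambda>\<omega>. exp (X \<omega>) - X \<omega>)"
    by (intro integrableI_bounded) auto
  then have "integrable M (\<lambda>\<omega>. exp (X \<omega>) - (exp (X \<omega>) - X \<omega>))"
    using intexp by (rule Bochner_Integration.integrable_diff[rotated])
  then show ?thesis
    by simp
qed

end

section \<open>Optional sampling on a finite horizon\<close>

text \<open>Applied to the mean and to the logarithm of the moment generating function of \<open>L t\<close>.
  Both are additive in \<open>t\<close>, but their continuity in \<open>t\<close> is not evident; values at dyadic
  multiples of \<open>T\<close> turn out to be all that optional sampling asks for.\<close>
lemma additive_on_grid:
  fixes g :: "real \<Rightarrow> real"
  assumes "0 \<le> T"
    and add: "\<And>s t. 0 \<le> s \<Longrightarrow> 0 \<le> t \<Longrightarrow> s + t \<le> T \<Longrightarrow> g (s + t) = g s + g t"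
    and j: "j \<le> N" "0 < N"
  shows "g (real j * T / real N) = real j / real N * g T"
proof -
  have g0: "g 0 = 0"
    using add[of 0 0] assms(1) by simp
  have "g (real i * T / real N) = real i * g (T / real N)" if "i \<le> N" for i
    using that
  proof (induction i)
    case (Suc i)
    have "real (Suc i) * T \<le> real N * T"
      using Suc.prems assms(1) by (intro mult_right_mono) auto
    then have "real i * T / real N + T / real N \<le> T"
      using j(2) by (simp add: field_simps)
    then have "g (real i * T / real N + T / real N) = g (real i * T / real N) + g (T / real N)"
      using assms(1) by (intro add) auto
    then show ?case
      using Suc by (simp add: add_divide_distrib algebra_simps)
  qed (simp add: g0)
  from this[of j] this[of N] show ?thesis
    using j by simp
qed

text \<open>Optional sampling concerns the filtration only. It is kept apart from \<open>levy_process\<close> because it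
  is applied to several processes derived from \<open>L\<close>, under the original and under the Esscher measure.\<close>
locale horizon_filtration = prob_space M
  for M :: "'a measure" +
  fixes T :: real and F :: "real \<Rightarrow> 'a measure"
  assumes T_pos: "0 < T"
    and filtration: "filtration (space M) (\<lambda>t. F (cap T t))"
    and subalgebra: "subalgebra M (F T)"
begin

lemma space_F [simp]: "t \<in> {0..T} \<Longrightarrow> space (F t) = space M"
  using filtration T_pos by (simp add: filtration_cap_iff)

lemma sets_F_mono: "s \<in> {0..T} \<Longrightarrow> t \<in> {0..T} \<Longrightarrow> s \<le> t \<Longrightarrow> sets (F s) \<subseteq> sets (F t)"
  using filtration T_pos by (simp add: filtration_cap_iff)

lemma sets_F_le: "t \<in> {0..T} \<Longrightarrow> sets (F t) \<subseteq> sets M"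
  using sets_F_mono[of t T] subalgebra T_pos by (auto simp: subalgebra_def)

lemma subalgebra_t: "t \<in> {0..T} \<Longrightarrow> subalgebra M (F t)"
  using sets_F_le by (simp add: subalgebra_def)

lemma measurable_F_mono:
  "s \<in> {0..T} \<Longrightarrow> t \<in> {0..T} \<Longrightarrow> s \<le> t \<Longrightarrow> f \<in> measurable (F s) N \<Longrightarrow> f \<in> measurable (F t) N"
  using sets_F_mono[of s t] by (auto simp: measurable_def)

text \<open>Stopping times as real-valued functions on \<open>[0,T]\<close>: the form that an extended stopping time
  takes after capping at the horizon.\<close>
definition real_stopping_time :: "('a \<Rightarrow> real) \<Rightarrow> bool" where
  "real_stopping_time \<sigma> \<longleftrightarrow> (\<forall>\<omega>\<in>space M. \<sigma> \<omega> \<in> {0..T}) \<and> (\<forall>t\<in>{0..T}. {\<omega>\<in>space M. \<sigma> \<omega> \<le> t} \<in> sets (F t))"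

lemma real_stopping_time_cap:
  assumes "stopping_time (\<lambda>t. F (cap T t)) \<tau>"
  shows "real_stopping_time (\<lambda>\<omega>. cap T (\<tau> \<omega>))"
  unfolding real_stopping_time_def
proof (intro conjI ballI)
  fix t assume t: "t \<in> {0..T}"
  show "{\<omega>\<in>space M. cap T (\<tau> \<omega>) \<le> t} \<in> sets (F t)"
  proof (cases "t = T")
    case True
    then have "{\<omega>\<in>space M. cap T (\<tau> \<omega>) \<le> t} = space (F t)"
      using cap_in[of T] T_pos t by auto
    then show ?thesis by simp
  next
    case False
    have "cap T x \<le> t \<longleftrightarrow> x \<le> ennreal t" for x
    proof (cases x)
      case (real r)
      then have "cap T x = min r T"
        using T_pos by (auto simp: cap_def min_def ennreal_le_iff)
      then show ?thesis
        using t False real by (auto simp: ennreal_le_iff)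
    next
      case top
      then show ?thesis
        using t False T_pos by (auto simp: cap_def top_unique)
    qed
    then have "{\<omega>\<in>space M. cap T (\<tau> \<omega>) \<le> t} = {\<omega>\<in>space (F t). \<tau> \<omega> \<le> ennreal t}"
      using t by auto
    then show ?thesis
      using stopping_timeD[OF assms, of "ennreal t"] t
      by (simp add: Measurable.pred_def cap_ennreal)
  qed
qed (use cap_in[of T] T_pos in auto)

text \<open>Optional sampling at these times returns the martingale property between \<open>t\<close> and \<open>T\<close>,
  at every real \<open>t\<close>.\<close>
lemma real_stopping_time_cases:
  assumes t: "t \<in> {0..T}" and A: "A \<in> sets (F t)"
  shows "real_stopping_time (\<lambda>\<omega>. if \<omega> \<in> A then t else T)"
  unfolding real_stopping_time_def
proof (intro conjI ballI)
  fix s assume s: "s \<in> {0..T}"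
  have AM: "A \<subseteq> space M"
    using sets.sets_into_space[OF A] t by simp
  consider "s < t" | "t \<le> s" "s < T" | "s = T"
    using s by force
  then show "{\<omega>\<in>space M. (if \<omega> \<in> A then t else T) \<le> s} \<in> sets (F s)"
  proof cases
    case 1
    then have "{\<omega>\<in>space M. (if \<omega> \<in> A then t else T) \<le> s} = {}"
      using t by auto
    then show ?thesis by (simp only: sets.empty_sets)
  next
    case 2
    then have "{\<omega>\<in>space M. (if \<omega> \<in> A then t else T) \<le> s} = A"
      using AM by auto
    then show ?thesis
      using A sets_F_mono[OF t s 2(1)] by auto
  next
    case 3
    then have "{\<omega>\<in>space M. (if \<omega> \<in> A then t else T) \<le> s} = space (F s)"
      using s t by auto
    then show ?thesis by simp
  qed
qed (use t in auto)

text \<open>Rounding up rather than down: the rounded time is again a stopping time, and right continuity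
  suffices for convergence.\<close>
definition dyadic_ceiling :: "nat \<Rightarrow> real \<Rightarrow> real" where
  "dyadic_ceiling n t = real_of_int \<lceil>t * 2 ^ n / T\<rceil> * T / 2 ^ n"

lemma dyadic_ceiling_ge: "t \<le> dyadic_ceiling n t"
proof -
  have "t * 2 ^ n / T * T \<le> real_of_int \<lceil>t * 2 ^ n / T\<rceil> * T"
    using T_pos by (intro mult_right_mono) auto
  then show ?thesis
    using T_pos by (simp add: dyadic_ceiling_def field_simps)
qed

lemma dyadic_ceiling_less: "dyadic_ceiling n t < t + T / 2 ^ n"
proof -
  have "real_of_int \<lceil>t * 2 ^ n / T\<rceil> * (T / 2 ^ n) < (t * 2 ^ n / T + 1) * (T / 2 ^ n)"
    using T_pos by (intro mult_strict_right_mono) (linarith, simp)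
  also have "\<dots> = t + T / 2 ^ n"
    using T_pos by (simp add: distrib_right add_divide_distrib)
  finally show ?thesis
    by (simp add: dyadic_ceiling_def)
qed

lemma dyadic_ceiling_grid:
  assumes "t \<in> {0..T}"
  shows "\<exists>j\<le>2 ^ n. dyadic_ceiling n t = real j * T / 2 ^ n"
proof -
  have "0 \<le> t * 2 ^ n / T"
    using assms T_pos by simp
  then have "0 \<le> \<lceil>t * 2 ^ n / T\<rceil>"
    by linarith
  moreover have "t * 2 ^ n / T \<le> 2 ^ n"
    using assms T_pos by (simp add: field_simps)
  then have "\<lceil>t * 2 ^ n / T\<rceil> \<le> 2 ^ n"
    by (simp add: ceiling_le_iff)
  ultimately show ?thesis
    by (intro exI[of _ "nat \<lceil>t * 2 ^ n / T\<rceil>"]) (auto simp: dyadic_ceiling_def nat_le_iff)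
qed

lemma dyadic_ceiling_mono:
  assumes "s \<le> t"
  shows "dyadic_ceiling n s \<le> dyadic_ceiling n t"
proof -
  have "s * 2 ^ n / T \<le> t * 2 ^ n / T"
    using assms T_pos by (intro divide_right_mono mult_right_mono) auto
  then have "real_of_int \<lceil>s * 2 ^ n / T\<rceil> \<le> real_of_int \<lceil>t * 2 ^ n / T\<rceil>"
    by (simp add: ceiling_mono)
  then show ?thesis
    using T_pos unfolding dyadic_ceiling_def by (intro divide_right_mono mult_right_mono) auto
qed

lemma grid_in: "j \<le> 2 ^ n \<Longrightarrow> real j * T / 2 ^ n \<in> {0..T}"
proof -
  assume "j \<le> 2 ^ n"
  then have "real j \<le> real (2 ^ n)"
    by (rule of_nat_mono)
  then have "real j * T \<le> 2 ^ n * T"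
    using T_pos by (intro mult_right_mono) auto
  then show ?thesis
    using T_pos by (simp add: field_simps)
qed

lemma dyadic_ceiling_tendsto: "(\<lambda>n. dyadic_ceiling n t) \<longlonglongrightarrow> t"
proof (rule tendsto_sandwich[of "\<lambda>_. t" _ _ "\<lambda>n. t + T / 2 ^ n"])
  have "(\<lambda>n. t + T * inverse (2 ^ n)) \<longlonglongrightarrow> t + T * 0"
    by (intro tendsto_intros LIMSEQ_inverse_realpow_zero) auto
  then show "(\<lambda>n. t + T / 2 ^ n) \<longlonglongrightarrow> t"
    by (simp add: divide_inverse)
  show "\<forall>\<^sub>F n in sequentially. dyadic_ceiling n t \<le> t + T / 2 ^ n"
    by (intro always_eventually allI less_imp_le dyadic_ceiling_less)
qed (use dyadic_ceiling_ge in auto)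

lemma tendsto_dyadic_ceiling:
  fixes f :: "real \<Rightarrow> real"
  assumes rc: "\<And>t. t \<in> {0..<T} \<Longrightarrow> continuous (at_right t) f" and t: "t \<in> {0..T}"
  shows "(\<lambda>n. f (dyadic_ceiling n t)) \<longlonglongrightarrow> f t"
proof (cases "t = T")
  case True
  have "dyadic_ceiling n T = T" for n
  proof -
    have "T * 2 ^ n / T = real_of_int (2 ^ n)"
      using T_pos by simp
    then have "\<lceil>T * 2 ^ n / T\<rceil> = 2 ^ n"
      by (simp only: ceiling_of_int)
    then show ?thesis
      using T_pos by (simp add: dyadic_ceiling_def)
  qed
  then show ?thesis
    using True by simp
next
  case False
  then have "(f \<longlongrightarrow> f t) (at_right t)"
    using rc[of t] t by (simp add: continuous_within)
  then have "(f \<longlongrightarrow> f t) (at t within {t..})"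
    unfolding tendsto_def eventually_at_filter by (auto elim!: eventually_mono)
  then have "continuous (at t within {t..}) f"
    by (simp add: continuous_within)
  then have "(f \<circ> (\<lambda>n. dyadic_ceiling n t)) \<longlonglongrightarrow> f t"
    using dyadic_ceiling_ge dyadic_ceiling_tendsto unfolding continuous_within_sequentially
    by (elim allE[of _ "\<lambda>n. dyadic_ceiling n t"]) simp
  then show ?thesis
    by (simp add: comp_def)
qed

text \<open>Rounding up puts \<open>\<sigma>\<close> in the half-open interval left of the grid point, an event that is
  known at the grid point.\<close>
lemma dyadic_ceiling_level_sets:
  assumes \<sigma>: "real_stopping_time \<sigma>" and j: "j \<le> 2 ^ n"
  shows "{\<omega>\<in>space M. dyadic_ceiling n (\<sigma> \<omega>) = real j * T / 2 ^ n} \<in> sets (F (real j * T / 2 ^ n))"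
proof -
  let ?t = "real j * T / 2 ^ n" and ?s = "(real j - 1) * T / 2 ^ n"
  have eq: "dyadic_ceiling n x = ?t \<longleftrightarrow> ?s < x \<and> x \<le> ?t" for x
  proof -
    have "0 < T / 2 ^ n"
      using T_pos by simp
    then have "dyadic_ceiling n x = ?t \<longleftrightarrow> real_of_int \<lceil>x * 2 ^ n / T\<rceil> = real_of_int (int j)"
      unfolding dyadic_ceiling_def times_divide_eq_right[symmetric] by (subst mult_right_cancel) auto
    also have "\<dots> \<longleftrightarrow> \<lceil>x * 2 ^ n / T\<rceil> = int j"
      by (rule of_int_eq_iff)
    also have "\<dots> \<longleftrightarrow> real j - 1 < x * 2 ^ n / T \<and> x * 2 ^ n / T \<le> real j"
      by (simp add: ceiling_eq_iff)
    also have "\<dots> \<longleftrightarrow> ?s < x \<and> x \<le> ?t"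
      using T_pos by (simp only: pos_less_divide_eq pos_divide_less_eq pos_divide_le_eq pos_le_divide_eq
          zero_less_power zero_less_numeral)
    finally show ?thesis .
  qed
  have t: "?t \<in> {0..T}"
    using grid_in[OF j] .
  have le: "{\<omega>\<in>space M. \<sigma> \<omega> \<le> ?t} \<in> sets (F ?t)"
    using \<sigma> t by (simp add: real_stopping_time_def)
  show ?thesis
  proof (cases "j = 0")
    case True
    then have "?s < 0"
      using T_pos by simp
    then have "?s < \<sigma> \<omega>" if "\<omega> \<in> space M" for \<omega>
      using \<sigma> that unfolding real_stopping_time_def by (meson atLeastAtMost_iff less_le_trans)
    then have "{\<omega>\<in>space M. dyadic_ceiling n (\<sigma> \<omega>) = ?t} = {\<omega>\<in>space M. \<sigma> \<omega> \<le> ?t}"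
      by (auto simp only: eq)
    then show ?thesis
      using le by simp
  next
    case False
    then obtain i where i: "j = Suc i"
      using not0_implies_Suc by blast
    then have "?s = real i * T / 2 ^ n"
      by simp
    then have s: "?s \<in> {0..T}"
      using grid_in[of i n] j i by (simp only: Suc_le_eq less_imp_le)
    have st: "?s \<le> ?t"
      using T_pos by (intro divide_right_mono mult_right_mono) auto
    have "{\<omega>\<in>space M. \<sigma> \<omega> \<le> ?s} \<in> sets (F ?t)"
      using \<sigma> s sets_F_mono[OF s t st] by (auto simp: real_stopping_time_def)
    then have "{\<omega>\<in>space M. \<sigma> \<omega> \<le> ?t} - {\<omega>\<in>space M. \<sigma> \<omega> \<le> ?s} \<in> sets (F ?t)"
      using le by auto
    moreover have "{\<omega>\<in>space M. dyadic_ceiling n (\<sigma> \<omega>) = ?t} = {\<omega>\<in>space M. \<sigma> \<omega> \<le> ?t} - {\<omega>\<in>space M. \<sigma> \<omega> \<le> ?s}"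
      by (auto simp only: eq)
    ultimately show ?thesis by simp
  qed
qed

lemma measurable_dyadic_ceiling_stopped:
  fixes Y :: "real \<Rightarrow> 'a \<Rightarrow> real"
  assumes \<sigma>: "real_stopping_time \<sigma>" and Y: "\<And>t. t \<in> {0..T} \<Longrightarrow> Y t \<in> borel_measurable (F t)"
  shows "(\<lambda>\<omega>. Y (dyadic_ceiling n (\<sigma> \<omega>)) \<omega>) \<in> borel_measurable (F T)"
    and "\<omega> \<in> space M \<Longrightarrow> Y (dyadic_ceiling n (\<sigma> \<omega>)) \<omega> = (\<Sum>j\<le>2 ^ n. Y (real j * T / 2 ^ n) \<omega> *
      indicator {\<omega>\<in>space M. dyadic_ceiling n (\<sigma> \<omega>) = real j * T / 2 ^ n} \<omega>)"
proof -
  have eq: "Y (dyadic_ceiling n (\<sigma> \<omega>)) \<omega> = (\<Sum>j\<le>2 ^ n. Y (real j * T / 2 ^ n) \<omega> *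
      indicator {\<omega>\<in>space M. dyadic_ceiling n (\<sigma> \<omega>) = real j * T / 2 ^ n} \<omega>)" if \<omega>: "\<omega> \<in> space M" for \<omega>
  proof -
    obtain i where i: "i \<le> 2 ^ n" "dyadic_ceiling n (\<sigma> \<omega>) = real i * T / 2 ^ n"
      using dyadic_ceiling_grid[of "\<sigma> \<omega>" n] \<sigma> \<omega> by (auto simp: real_stopping_time_def)
    have "(\<Sum>j\<le>2 ^ n. Y (real j * T / 2 ^ n) \<omega> *
        indicator {\<omega>\<in>space M. dyadic_ceiling n (\<sigma> \<omega>) = real j * T / 2 ^ n} \<omega>)
      = (\<Sum>j\<le>2 ^ n. if j = i then Y (real i * T / 2 ^ n) \<omega> else 0)"
      using \<omega> i(2) T_pos by (intro sum.cong) auto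
    then show ?thesis
      using i by simp
  qed
  then show "\<omega> \<in> space M \<Longrightarrow> Y (dyadic_ceiling n (\<sigma> \<omega>)) \<omega> = (\<Sum>j\<le>2 ^ n. Y (real j * T / 2 ^ n) \<omega> *
      indicator {\<omega>\<in>space M. dyadic_ceiling n (\<sigma> \<omega>) = real j * T / 2 ^ n} \<omega>)" .
  have "(\<lambda>\<omega>. \<Sum>j\<le>2 ^ n. Y (real j * T / 2 ^ n) \<omega> *
      indicator {\<omega>\<in>space M. dyadic_ceiling n (\<sigma> \<omega>) = real j * T / 2 ^ n} \<omega>) \<in> borel_measurable (F T)"
  proof (intro borel_measurable_sum borel_measurable_times borel_measurable_indicator)
    fix j :: nat assume "j \<in> {..2 ^ n}"
    then have j: "j \<le> 2 ^ n" by simp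
    have TT: "T \<in> {0..T}" "real j * T / 2 ^ n \<le> T"
      using T_pos grid_in[OF j] by auto
    show "Y (real j * T / 2 ^ n) \<in> borel_measurable (F T)"
      by (rule measurable_F_mono[OF grid_in[OF j] TT Y[OF grid_in[OF j]]])
    show "{\<omega>\<in>space M. dyadic_ceiling n (\<sigma> \<omega>) = real j * T / 2 ^ n} \<in> sets (F T)"
      using dyadic_ceiling_level_sets[OF \<sigma> j] sets_F_mono[OF grid_in[OF j] TT] by auto
  qed
  moreover have "space (F T) = space M"
    using T_pos by simp
  ultimately show "(\<lambda>\<omega>. Y (dyadic_ceiling n (\<sigma> \<omega>)) \<omega>) \<in> borel_measurable (F T)"
    using eq by (subst measurable_cong) auto
qed

lemma measurable_stopped:
  fixes Y :: "real \<Rightarrow> 'a \<Rightarrow> real"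
  assumes \<sigma>: "real_stopping_time \<sigma>" and Y: "\<And>t. t \<in> {0..T} \<Longrightarrow> Y t \<in> borel_measurable (F t)"
    and rc: "\<And>t \<omega>. t \<in> {0..<T} \<Longrightarrow> \<omega> \<in> space M \<Longrightarrow> continuous (at_right t) (\<lambda>t. Y t \<omega>)"
  shows "(\<lambda>\<omega>. Y (\<sigma> \<omega>) \<omega>) \<in> borel_measurable (F T)"
proof (rule borel_measurable_LIMSEQ_real)
  show "(\<lambda>n. Y (dyadic_ceiling n (\<sigma> \<omega>)) \<omega>) \<longlonglongrightarrow> Y (\<sigma> \<omega>) \<omega>" if "\<omega> \<in> space (F T)" for \<omega>
    using rc that \<sigma> T_pos by (intro tendsto_dyadic_ceiling) (auto simp: real_stopping_time_def)
qed (intro measurable_dyadic_ceiling_stopped \<sigma> Y)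

text \<open>Rounded up to a dyadic grid, \<open>\<sigma>\<close> takes finitely many values and the inequality follows
  by summing over its level sets. As the grid is refined, the rounded times decrease to \<open>\<sigma>\<close>,
  the values of \<open>Y\<close> converge by right continuity, and Fatou's lemma applies since
  \<open>Y \<ge> 0\<close>. Only grid times enter the submartingale hypothesis.\<close>
lemma optional_sampling_le:
  fixes Y :: "real \<Rightarrow> 'a \<Rightarrow> real"
  assumes \<sigma>: "real_stopping_time \<sigma>" and Y: "\<And>t. t \<in> {0..T} \<Longrightarrow> Y t \<in> borel_measurable (F t)"
    and Y0: "\<And>t \<omega>. 0 \<le> Y t \<omega>"
    and rc: "\<And>t \<omega>. t \<in> {0..<T} \<Longrightarrow> \<omega> \<in> space M \<Longrightarrow> continuous (at_right t) (\<lambda>t. Y t \<omega>)"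
    and sub: "\<And>j n A. j \<le> 2 ^ n \<Longrightarrow> A \<in> sets (F (real j * T / 2 ^ n)) \<Longrightarrow>
      (\<integral>\<^sup>+\<omega>. ennreal (Y (real j * T / 2 ^ n) \<omega>) * indicator A \<omega> \<partial>M)
        \<le> (\<integral>\<^sup>+\<omega>. ennreal (Y T \<omega>) * indicator A \<omega> \<partial>M)"
  shows "(\<integral>\<^sup>+\<omega>. ennreal (Y (\<sigma> \<omega>) \<omega>) \<partial>M) \<le> (\<integral>\<^sup>+\<omega>. ennreal (Y T \<omega>) \<partial>M)"
proof (rule nn_integral_limit_le)
  show "(\<lambda>n. ennreal (Y (dyadic_ceiling n (\<sigma> \<omega>)) \<omega>)) \<longlonglongrightarrow> ennreal (Y (\<sigma> \<omega>) \<omega>)" if "\<omega> \<in> space M" for \<omega>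
    using rc that \<sigma> by (intro tendsto_ennrealI tendsto_dyadic_ceiling) (auto simp: real_stopping_time_def)
  show "(\<lambda>\<omega>. ennreal (Y (dyadic_ceiling n (\<sigma> \<omega>)) \<omega>)) \<in> borel_measurable M" for n
    using measurable_from_subalg[OF subalgebra measurable_dyadic_ceiling_stopped(1)[where Y=Y, OF \<sigma> Y]] by simp
  fix n
  let ?t = "\<lambda>j. real j * T / 2 ^ n"
  let ?A = "\<lambda>j. {\<omega>\<in>space M. dyadic_ceiling n (\<sigma> \<omega>) = ?t j}"
  have A: "?A j \<in> sets (F (?t j))" "?A j \<in> events" if "j \<le> 2 ^ n" for j
    using dyadic_ceiling_level_sets[OF \<sigma> that] sets_F_le[OF grid_in[OF that]] by auto
  have YM: "Y t \<in> borel_measurable M" if "t \<in> {0..T}" for t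
    using measurable_from_subalg[OF subalgebra_t Y] that by blast
  have split: "ennreal (\<Sum>j\<le>2 ^ n. f j * indicator (?A j) \<omega>) = (\<Sum>j\<le>2 ^ n. ennreal (f j) * indicator (?A j) \<omega>)"
    if "\<And>j. 0 \<le> f j" for f \<omega>
    using that by (subst sum_ennreal[symmetric])
      (auto simp: indicator_def intro!: sum.cong)
  have "(\<integral>\<^sup>+\<omega>. ennreal (Y (dyadic_ceiling n (\<sigma> \<omega>)) \<omega>) \<partial>M)
      = (\<integral>\<^sup>+\<omega>. (\<Sum>j\<le>2 ^ n. ennreal (Y (?t j) \<omega>) * indicator (?A j) \<omega>) \<partial>M)"
    by (intro nn_integral_cong) (simp only: measurable_dyadic_ceiling_stopped(2)[where Y=Y, OF \<sigma> Y] split Y0)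
  also have "\<dots> = (\<Sum>j\<le>2 ^ n. (\<integral>\<^sup>+\<omega>. ennreal (Y (?t j) \<omega>) * indicator (?A j) \<omega> \<partial>M))"
    using A YM grid_in by (intro nn_integral_sum borel_measurable_times measurable_compose[OF _ measurable_ennreal]
        borel_measurable_indicator) auto
  also have "\<dots> \<le> (\<Sum>j\<le>2 ^ n. (\<integral>\<^sup>+\<omega>. ennreal (Y T \<omega>) * indicator (?A j) \<omega> \<partial>M))"
    using A by (intro sum_mono sub) auto
  also have "\<dots> = (\<integral>\<^sup>+\<omega>. (\<Sum>j\<le>2 ^ n. ennreal (Y T \<omega>) * indicator (?A j) \<omega>) \<partial>M)"
    using A YM T_pos by (intro nn_integral_sum[symmetric] borel_measurable_times
        measurable_compose[OF _ measurable_ennreal] borel_measurable_indicator) auto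
  also have "\<dots> = (\<integral>\<^sup>+\<omega>. ennreal (Y T \<omega>) \<partial>M)"
  proof (intro nn_integral_cong)
    fix \<omega> assume \<omega>: "\<omega> \<in> space M"
    have "Y T \<omega> = (\<Sum>j\<le>2 ^ n. Y T \<omega> * indicator (?A j) \<omega>)"
    proof -
      obtain i where i: "i \<le> 2 ^ n" "dyadic_ceiling n (\<sigma> \<omega>) = ?t i"
        using dyadic_ceiling_grid[of "\<sigma> \<omega>" n] \<sigma> \<omega> by (auto simp: real_stopping_time_def)
      have "(\<Sum>j\<le>2 ^ n. Y T \<omega> * indicator (?A j) \<omega>) = (\<Sum>j\<le>2 ^ n. if j = i then Y T \<omega> else 0)"
        using \<omega> i(2) T_pos by (intro sum.cong) auto
      then show ?thesis
        using i by simp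
    qed
    then show "(\<Sum>j\<le>2 ^ n. ennreal (Y T \<omega>) * indicator (?A j) \<omega>) = ennreal (Y T \<omega>)"
      unfolding split[of "\<lambda>_. Y T \<omega>" \<omega>, OF Y0, symmetric] by (rule arg_cong[OF sym])
  qed
  finally show "(\<integral>\<^sup>+\<omega>. ennreal (Y (dyadic_ceiling n (\<sigma> \<omega>)) \<omega>) \<partial>M) \<le> (\<integral>\<^sup>+\<omega>. ennreal (Y T \<omega>) \<partial>M)" .
qed

text \<open>The positive part of \<open>N - a\<close> is a submartingale: on the event \<open>N t > a\<close>, which belongs
  to \<open>F t\<close>, the martingale identity applies, and off it the left side is zero.\<close>
lemma optional_sampling_excess:
  fixes N :: "real \<Rightarrow> 'a \<Rightarrow> real"
  assumes \<sigma>: "real_stopping_time \<sigma>" and N: "\<And>t. t \<in> {0..T} \<Longrightarrow> N t \<in> borel_measurable (F t)"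
    and rc: "\<And>t \<omega>. t \<in> {0..<T} \<Longrightarrow> \<omega> \<in> space M \<Longrightarrow> continuous (at_right t) (\<lambda>t. N t \<omega>)"
    and int: "\<And>j n. j \<le> 2 ^ n \<Longrightarrow> integrable M (N (real j * T / 2 ^ n))"
    and mart: "\<And>j n A. j \<le> 2 ^ n \<Longrightarrow> A \<in> sets (F (real j * T / 2 ^ n)) \<Longrightarrow>
      (\<integral>\<omega>. N (real j * T / 2 ^ n) \<omega> * indicator A \<omega> \<partial>M) = (\<integral>\<omega>. N T \<omega> * indicator A \<omega> \<partial>M)"
  shows "(\<integral>\<^sup>+\<omega>. ennreal (max (N (\<sigma> \<omega>) \<omega> - a) 0) \<partial>M) \<le> (\<integral>\<^sup>+\<omega>. ennreal (max (N T \<omega> - a) 0) \<partial>M)"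
proof (rule optional_sampling_le[where Y="\<lambda>t \<omega>. max (N t \<omega> - a) 0", OF \<sigma>])
  show "continuous (at_right t) (\<lambda>t. max (N t \<omega> - a) 0)" if "t \<in> {0..<T}" "\<omega> \<in> space M" for t \<omega>
    using rc[OF that] by (intro continuous_intros)
  fix j n A assume j: "j \<le> (2 :: nat) ^ n" and A: "A \<in> sets (F (real j * T / 2 ^ n))"
  let ?t = "real j * T / 2 ^ n"
  let ?B = "A \<inter> {\<omega>\<in>space (F ?t). a < N ?t \<omega>}"
  note t = grid_in[OF j]
  have B: "?B \<in> sets (F ?t)"
    using N[OF t] A by (intro sets.Int) simp_all
  then have BM [measurable]: "?B \<in> events"
    using sets_F_le[OF t] by auto
  have AM: "A \<in> events"
    using A sets_F_le[OF t] by auto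
  have intT: "integrable M (N T)"
    using int[of 1 0] by simp
  have intM: "integrable M (\<lambda>\<omega>. max (N T \<omega> - a) 0 * indicator A \<omega>)"
    using intT by (intro integrable_real_mult_indicator AM integrable_max) auto
  have intB: "integrable M (\<lambda>\<omega>. f \<omega> * indicator ?B \<omega>)" if "integrable M f" for f :: "'a \<Rightarrow> real"
    using that by (rule integrable_real_mult_indicator[OF BM])
  have ia: "integrable M (\<lambda>\<omega>. a * indicator ?B \<omega>)"
    by (rule intB) simp
  have "(\<integral>\<omega>. N ?t \<omega> * indicator ?B \<omega> - a * indicator ?B \<omega> \<partial>M)
      = (\<integral>\<omega>. N T \<omega> * indicator ?B \<omega> - a * indicator ?B \<omega> \<partial>M)"
    unfolding Bochner_Integration.integral_diff[OF intB[OF int[OF j]] ia]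
      Bochner_Integration.integral_diff[OF intB[OF intT] ia] mart[OF j B] ..
  also have "\<dots> \<le> (\<integral>\<omega>. max (N T \<omega> - a) 0 * indicator A \<omega> \<partial>M)"
  proof (rule integral_mono[OF _ intM])
    show "integrable M (\<lambda>\<omega>. N T \<omega> * indicator ?B \<omega> - a * indicator ?B \<omega>)"
      by (intro Bochner_Integration.integrable_diff intB[OF intT] ia)
  qed (simp split: split_indicator)
  finally have le: "(\<integral>\<omega>. N ?t \<omega> * indicator ?B \<omega> - a * indicator ?B \<omega> \<partial>M)
      \<le> (\<integral>\<omega>. max (N T \<omega> - a) 0 * indicator A \<omega> \<partial>M)" .
  have "(\<integral>\<^sup>+\<omega>. ennreal (max (N ?t \<omega> - a) 0) * indicator A \<omega> \<partial>M)
      = (\<integral>\<^sup>+\<omega>. ennreal (N ?t \<omega> * indicator ?B \<omega> - a * indicator ?B \<omega>) \<partial>M)"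
    using t by (intro nn_integral_cong) (simp add: max_def split: split_indicator)
  also have "\<dots> = ennreal (\<integral>\<omega>. N ?t \<omega> * indicator ?B \<omega> - a * indicator ?B \<omega> \<partial>M)"
    by (intro nn_integral_eq_integral Bochner_Integration.integrable_diff intB[OF int[OF j]] ia)
      (auto split: split_indicator)
  also have "\<dots> \<le> ennreal (\<integral>\<omega>. max (N T \<omega> - a) 0 * indicator A \<omega> \<partial>M)"
    by (rule ennreal_leI[OF le])
  also have "\<dots> = (\<integral>\<^sup>+\<omega>. ennreal (max (N T \<omega> - a) 0 * indicator A \<omega>) \<partial>M)"
    by (rule nn_integral_eq_integral[OF intM, symmetric]) simp
  also have "\<dots> = (\<integral>\<^sup>+\<omega>. ennreal (max (N T \<omega> - a) 0) * indicator A \<omega> \<partial>M)"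
    by (intro nn_integral_cong) (simp split: split_indicator)
  finally show "(\<integral>\<^sup>+\<omega>. ennreal (max (N ?t \<omega> - a) 0) * indicator A \<omega> \<partial>M)
      \<le> (\<integral>\<^sup>+\<omega>. ennreal (max (N T \<omega> - a) 0) * indicator A \<omega> \<partial>M)" .
next
  show "(\<lambda>\<omega>. max (N t \<omega> - a) 0) \<in> borel_measurable (F t)" if "t \<in> {0..T}" for t
    using N[OF that] by simp
qed simp

text \<open>Since \<open>x + k \<le> max (x + k) 0 = x + k + max (- x - k) 0\<close>, the hypothesis at
  \<open>a = -k\<close> gives the conclusion up to the mean of \<open>max (- Y - k) 0\<close>, which vanishes as
  \<open>k\<close> grows.\<close>
lemma integral_le_of_excess_le:
  assumes X: "integrable M X" and Y: "integrable M Y"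
    and le: "\<And>a. (\<integral>\<^sup>+\<omega>. ennreal (max (X \<omega> - a) 0) \<partial>M) \<le> (\<integral>\<^sup>+\<omega>. ennreal (max (Y \<omega> - a) 0) \<partial>M)"
  shows "(\<integral>\<omega>. X \<omega> \<partial>M) \<le> (\<integral>\<omega>. Y \<omega> \<partial>M)"
proof -
  have [measurable]: "X \<in> borel_measurable M" "Y \<in> borel_measurable M"
    using X Y by auto
  have bound: "(\<integral>\<omega>. X \<omega> \<partial>M) \<le> (\<integral>\<omega>. Y \<omega> \<partial>M) + (\<integral>\<omega>. max (- Y \<omega> - real k) 0 \<partial>M)" for k
  proof -
    have ints: "integrable M (\<lambda>\<omega>. max (X \<omega> - (- real k)) 0)" "integrable M (\<lambda>\<omega>. max (Y \<omega> - (- real k)) 0)"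
      "integrable M (\<lambda>\<omega>. max (- Y \<omega> - real k) 0)"
      using X Y by (auto intro!: integrable_max)
    have "(\<integral>\<omega>. X \<omega> \<partial>M) + real k = (\<integral>\<omega>. X \<omega> + real k \<partial>M)"
      using X prob_space by simp
    also have "\<dots> \<le> (\<integral>\<omega>. max (X \<omega> - (- real k)) 0 \<partial>M)"
      using X ints by (intro integral_mono) auto
    also have "\<dots> \<le> (\<integral>\<omega>. max (Y \<omega> - (- real k)) 0 \<partial>M)"
      using le[of "- real k"] ints
      by (subst (asm) (1 2) nn_integral_eq_integral) (auto simp: ennreal_le_iff)
    also have "\<dots> = (\<integral>\<omega>. Y \<omega> + real k + max (- Y \<omega> - real k) 0 \<partial>M)"
      by (intro Bochner_Integration.integral_cong) (auto simp: max_def)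
    also have "\<dots> = (\<integral>\<omega>. Y \<omega> \<partial>M) + real k + (\<integral>\<omega>. max (- Y \<omega> - real k) 0 \<partial>M)"
      using Y ints prob_space by simp
    finally show ?thesis by simp
  qed
  have "(\<lambda>k. \<integral>\<omega>. max (- Y \<omega> - real k) 0 \<partial>M) \<longlonglongrightarrow> (\<integral>\<omega>. 0 \<partial>M)"
  proof (rule integral_dominated_convergence[where w="\<lambda>\<omega>. \<bar>Y \<omega>\<bar>"])
    show "AE \<omega> in M. (\<lambda>k. max (- Y \<omega> - real k) 0) \<longlonglongrightarrow> 0"
    proof (intro AE_I2 tendsto_eventually)
      fix \<omega>
      obtain m where "\<bar>Y \<omega>\<bar> \<le> real m"
        using real_arch_simple by blast
      then show "\<forall>\<^sub>F k in sequentially. max (- Y \<omega> - real k) 0 = 0"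
        by (intro eventually_sequentiallyI[of m]) (auto simp: max_def)
    qed
  qed (use Y in auto)
  then have "(\<lambda>k. (\<integral>\<omega>. Y \<omega> \<partial>M) + (\<integral>\<omega>. max (- Y \<omega> - real k) 0 \<partial>M)) \<longlonglongrightarrow> (\<integral>\<omega>. Y \<omega> \<partial>M) + 0"
    by (intro tendsto_intros) simp
  then show ?thesis
    using bound by (intro LIMSEQ_le_const[where X="\<lambda>k. (\<integral>\<omega>. Y \<omega> \<partial>M) + (\<integral>\<omega>. max (- Y \<omega> - real k) 0 \<partial>M)"]) auto
qed

text \<open>Bounds on all excesses of \<open>N\<close> and of \<open>- N\<close> replace uniform integrability: at
  \<open>a = 0\<close> they make the stopped value integrable, and together they give both inequalities
  between the means.\<close>
lemma optional_sampling:
  fixes N :: "real \<Rightarrow> 'a \<Rightarrow> real"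
  assumes \<sigma>: "real_stopping_time \<sigma>" and N: "\<And>t. t \<in> {0..T} \<Longrightarrow> N t \<in> borel_measurable (F t)"
    and rc: "\<And>t \<omega>. t \<in> {0..<T} \<Longrightarrow> \<omega> \<in> space M \<Longrightarrow> continuous (at_right t) (\<lambda>t. N t \<omega>)"
    and int: "\<And>j n. j \<le> 2 ^ n \<Longrightarrow> integrable M (N (real j * T / 2 ^ n))"
    and mart: "\<And>j n A. j \<le> 2 ^ n \<Longrightarrow> A \<in> sets (F (real j * T / 2 ^ n)) \<Longrightarrow>
      (\<integral>\<omega>. N (real j * T / 2 ^ n) \<omega> * indicator A \<omega> \<partial>M) = (\<integral>\<omega>. N T \<omega> * indicator A \<omega> \<partial>M)"
  shows "integrable M (\<lambda>\<omega>. N (\<sigma> \<omega>) \<omega>)" "(\<integral>\<omega>. N (\<sigma> \<omega>) \<omega> \<partial>M) = (\<integral>\<omega>. N T \<omega> \<partial>M)"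
proof -
  have intT: "integrable M (N T)"
    using int[of 1 0] by simp
  have excess: "(\<integral>\<^sup>+\<omega>. ennreal (max (N (\<sigma> \<omega>) \<omega> - a) 0) \<partial>M) \<le> (\<integral>\<^sup>+\<omega>. ennreal (max (N T \<omega> - a) 0) \<partial>M)" for a
    using assms by (rule optional_sampling_excess)
  have deficit: "(\<integral>\<^sup>+\<omega>. ennreal (max (- N (\<sigma> \<omega>) \<omega> - a) 0) \<partial>M) \<le> (\<integral>\<^sup>+\<omega>. ennreal (max (- N T \<omega> - a) 0) \<partial>M)" for a
    using N rc int mart
    by (intro optional_sampling_excess[where N="\<lambda>t \<omega>. - N t \<omega>", OF \<sigma>]) (auto intro!: continuous_intros)
  have [measurable]: "(\<lambda>\<omega>. N (\<sigma> \<omega>) \<omega>) \<in> borel_measurable M"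
    using N rc by (intro measurable_from_subalg[OF subalgebra measurable_stopped[OF \<sigma>]])
  have [measurable]: "N T \<in> borel_measurable M"
    using intT by auto
  have "(\<integral>\<^sup>+\<omega>. ennreal (norm (N (\<sigma> \<omega>) \<omega>)) \<partial>M)
      = (\<integral>\<^sup>+\<omega>. ennreal (max (N (\<sigma> \<omega>) \<omega> - 0) 0) + ennreal (max (- N (\<sigma> \<omega>) \<omega> - 0) 0) \<partial>M)"
    by (intro nn_integral_cong) (auto simp: max_def)
  also have "\<dots> = (\<integral>\<^sup>+\<omega>. ennreal (max (N (\<sigma> \<omega>) \<omega> - 0) 0) \<partial>M) + (\<integral>\<^sup>+\<omega>. ennreal (max (- N (\<sigma> \<omega>) \<omega> - 0) 0) \<partial>M)"
    by (intro nn_integral_add) auto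
  also have "\<dots> \<le> (\<integral>\<^sup>+\<omega>. ennreal (max (N T \<omega> - 0) 0) \<partial>M) + (\<integral>\<^sup>+\<omega>. ennreal (max (- N T \<omega> - 0) 0) \<partial>M)"
    by (intro add_mono excess deficit)
  also have "\<dots> < \<infinity>"
    using intT by (subst (1 2) nn_integral_eq_integral) (auto intro!: integrable_max)
  finally show int\<sigma>: "integrable M (\<lambda>\<omega>. N (\<sigma> \<omega>) \<omega>)"
    by (intro integrableI_bounded) auto
  have "(\<integral>\<omega>. - N (\<sigma> \<omega>) \<omega> \<partial>M) \<le> (\<integral>\<omega>. - N T \<omega> \<partial>M)"
    using int\<sigma> intT deficit by (intro integral_le_of_excess_le) auto
  moreover have "(\<integral>\<omega>. N (\<sigma> \<omega>) \<omega> \<partial>M) \<le> (\<integral>\<omega>. N T \<omega> \<partial>M)"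
    using int\<sigma> intT excess by (intro integral_le_of_excess_le) auto
  ultimately show "(\<integral>\<omega>. N (\<sigma> \<omega>) \<omega> \<partial>M) = (\<integral>\<omega>. N T \<omega> \<partial>M)"
    by simp
qed

end

section \<open>Increments, means and stopping for Levy processes\<close>

lemma right_continuous_of_cadlag:
  "cadlag_on T f \<Longrightarrow> t \<in> {0..<T} \<Longrightarrow> continuous (at_right t) f"
  by (simp add: cadlag_on_def)

context levy_process
begin

sublocale horizon_filtration M T F
  by (intro horizon_filtration.intro horizon_filtration_axioms.intro prob_space_axioms
      horizon_pos filtration_F subalgebra_F)

lemma right_continuous: "\<omega> \<in> space M \<Longrightarrow> t \<in> {0..<T} \<Longrightarrow> continuous (at_right t) (\<lambda>t. L t \<omega>)"
  using cadlag right_continuous_of_cadlag by blast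

lemma measurable_L: "t \<in> {0..T} \<Longrightarrow> L t \<in> borel_measurable M"
  using measurable_from_subalg[OF subalgebra_t adapted] by blast

lemma measurable_L_T [measurable]: "L T \<in> borel_measurable M"
  using measurable_L horizon_pos by simp

lemma measurable_increment:
  "s \<in> {0..T} \<Longrightarrow> t \<in> {0..T} \<Longrightarrow> (\<lambda>\<omega>. L t \<omega> - L s \<omega>) \<in> borel_measurable M"
  using measurable_L by (intro borel_measurable_diff) auto

lemma distr_increment:
  assumes "0 \<le> s" "s \<le> t" "t \<le> T"
  shows "distr M borel (\<lambda>\<omega>. L t \<omega> - L s \<omega>) = distr M borel (L (t - s))"
proof -
  have "distr M borel (\<lambda>\<omega>. L t \<omega> - L s \<omega>) = distr M borel (\<lambda>\<omega>. L (t - s) \<omega> - L 0 \<omega>)"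
    using stationary_increments[of 0 "t - s" s] assms by simp
  also have "\<dots> = distr M borel (L (t - s))"
    by (intro distr_cong) (auto simp: starts_at_0)
  finally show ?thesis .
qed

lemma indep_past_increment:
  assumes st: "0 \<le> s" "s \<le> t" "t \<le> T"
    and U: "U \<in> measurable (F s) N" and f: "f \<in> measurable borel N'"
  shows "indep_var N U N' (\<lambda>\<omega>. f (L t \<omega> - L s \<omega>))"
  unfolding indep_var_eq
proof (intro conjI indep_set_sigma_sets)
  let ?V = "\<lambda>\<omega>. L t \<omega> - L s \<omega>"
  have s: "s \<in> {0..T}" and t: "t \<in> {0..T}"
    using st by auto
  show U': "U \<in> measurable M N"
    using measurable_from_subalg[OF subalgebra_t[OF s] U] .
  show V': "(\<lambda>\<omega>. f (?V \<omega>)) \<in> measurable M N'"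
    using measurable_compose[OF measurable_increment[OF s t] f] .
  have stable: "Int_stable {X -` A \<inter> space M | A. A \<in> sets K}" for X :: "'a \<Rightarrow> 'b" and K
  proof (safe intro!: Int_stableI)
    fix A B assume "A \<in> sets K" "B \<in> sets K"
    then show "\<exists>C. (X -` A \<inter> space M) \<inter> (X -` B \<inter> space M) = X -` C \<inter> space M \<and> C \<in> sets K"
      by (intro exI[of _ "A \<inter> B"]) auto
  qed
  show "Int_stable {U -` A \<inter> space M | A. A \<in> sets N}"
    "Int_stable {(\<lambda>\<omega>. f (?V \<omega>)) -` A \<inter> space M | A. A \<in> sets N'}"
    by (rule stable)+
  show "indep_set {U -` A \<inter> space M | A. A \<in> sets N} {(\<lambda>\<omega>. f (?V \<omega>)) -` A \<inter> space M | A. A \<in> sets N'}"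
  proof (rule indep_setI)
    show "{U -` A \<inter> space M | A. A \<in> sets N} \<subseteq> events"
      using measurable_sets[OF U'] by auto
    show "{(\<lambda>\<omega>. f (?V \<omega>)) -` A \<inter> space M | A. A \<in> sets N'} \<subseteq> events"
      using measurable_sets[OF V'] by auto
    fix a b assume "a \<in> {U -` A \<inter> space M | A. A \<in> sets N}"
      "b \<in> {(\<lambda>\<omega>. f (?V \<omega>)) -` A \<inter> space M | A. A \<in> sets N'}"
    then obtain A B where a: "a = U -` A \<inter> space M" "A \<in> sets N"
      and b: "b = (\<lambda>\<omega>. f (?V \<omega>)) -` B \<inter> space M" "B \<in> sets N'"
      by blast
    have "a \<in> sets (F s)"
      using measurable_sets[OF U a(2)] a(1) s by simp
    moreover have "b \<in> {?V -` B \<inter> space M | B. B \<in> sets borel}"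
      using measurable_sets[OF f b(2)] b(1) by (intro CollectI exI[of _ "f -` B"]) auto
    ultimately show "prob (a \<inter> b) = prob a * prob b"
      using indep_setD[OF independent_increments[OF st]] by blast
  qed
qed

text \<open>Independence and stationarity of the increments in the one form in which they are used.\<close>
lemma nn_integral_past_times_increment:
  assumes st: "0 \<le> s" "s \<le> t" "t \<le> T"
    and U: "U \<in> borel_measurable (F s)" and f [measurable]: "f \<in> borel_measurable borel"
  shows "(\<integral>\<^sup>+\<omega>. U \<omega> * f (L t \<omega> - L s \<omega>) \<partial>M) = (\<integral>\<^sup>+\<omega>. U \<omega> \<partial>M) * (\<integral>\<^sup>+\<omega>. f (L (t - s) \<omega>) \<partial>M)"
proof -
  have s: "s \<in> {0..T}" "t \<in> {0..T}" "t - s \<in> {0..T}"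
    using st by auto
  let ?V = "\<lambda>\<omega>. L t \<omega> - L s \<omega>"
  have U' [measurable]: "U \<in> borel_measurable M"
    using measurable_from_subalg[OF subalgebra_t[OF s(1)] U] .
  have V [measurable]: "?V \<in> borel_measurable M"
    using s by (intro measurable_increment)
  have ind: "distr M borel U \<Otimes>\<^sub>M distr M borel (\<lambda>\<omega>. f (?V \<omega>))
      = distr M (borel \<Otimes>\<^sub>M borel) (\<lambda>\<omega>. (U \<omega>, f (?V \<omega>)))"
    using indep_past_increment[OF st U f] unfolding indep_var_distribution_eq by simp
  interpret D: prob_space "distr M borel U"
    by (rule prob_space_distr) simp
  interpret E: prob_space "distr M borel (\<lambda>\<omega>. f (?V \<omega>))"
    by (rule prob_space_distr) simp
  have "(\<integral>\<^sup>+\<omega>. U \<omega> * f (?V \<omega>) \<partial>M)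
      = (\<integral>\<^sup>+p. fst p * snd p \<partial>distr M (borel \<Otimes>\<^sub>M borel) (\<lambda>\<omega>. (U \<omega>, f (?V \<omega>))))"
    by (subst nn_integral_distr) auto
  also have "\<dots> = (\<integral>\<^sup>+x. (\<integral>\<^sup>+y. x * y \<partial>distr M borel (\<lambda>\<omega>. f (?V \<omega>))) \<partial>distr M borel U)"
    unfolding ind[symmetric] by (subst E.nn_integral_fst[symmetric]) auto
  also have "\<dots> = (\<integral>\<^sup>+x. x * (\<integral>\<^sup>+y. y \<partial>distr M borel (\<lambda>\<omega>. f (?V \<omega>))) \<partial>distr M borel U)"
    by (intro nn_integral_cong nn_integral_cmult) auto
  also have "\<dots> = (\<integral>\<^sup>+x. x \<partial>distr M borel U) * (\<integral>\<^sup>+y. y \<partial>distr M borel (\<lambda>\<omega>. f (?V \<omega>)))"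
    by (intro nn_integral_multc) auto
  also have "\<dots> = (\<integral>\<^sup>+\<omega>. U \<omega> \<partial>M) * (\<integral>\<^sup>+\<omega>. f (?V \<omega>) \<partial>M)"
    by (simp add: nn_integral_distr)
  also have "(\<integral>\<^sup>+\<omega>. f (?V \<omega>) \<partial>M) = (\<integral>\<^sup>+y. f y \<partial>distr M borel ?V)"
    by (simp add: nn_integral_distr)
  also have "\<dots> = (\<integral>\<^sup>+\<omega>. f (L (t - s) \<omega>) \<partial>M)"
    using measurable_L[OF s(3)] by (simp add: distr_increment[OF st] nn_integral_distr)
  finally show ?thesis .
qed

text \<open>If \<open>L T - L t\<close> is at most \<open>k\<close> in absolute value with positive probability, then on this
  event \<open>\<bar>L t\<bar> \<le> \<bar>L T\<bar> + k\<close>, and by independence the mean of \<open>\<bar>L t\<bar>\<close>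
  over the event is a positive multiple of its full mean.\<close>
lemma integrable_L:
  assumes int: "integrable M (L T)" and t: "t \<in> {0..T}"
  shows "integrable M (L t)"
proof -
  have st: "0 \<le> t" "t \<le> T" "T \<le> T" and T: "T \<in> {0..T}" "T - t \<in> {0..T}"
    using t by auto
  have [measurable]: "L t \<in> borel_measurable M" "L (T - t) \<in> borel_measurable M"
    using measurable_L t T by auto
  have "\<exists>k. emeasure M {\<omega>\<in>space M. \<bar>L (T - t) \<omega>\<bar> \<le> real k} \<noteq> 0"
  proof (rule ccontr)
    assume "\<not> ?thesis"
    then have "emeasure M (\<Union>k. {\<omega>\<in>space M. \<bar>L (T - t) \<omega>\<bar> \<le> real k}) = 0"
      by (intro emeasure_UN_eq_0) auto
    moreover have "(\<Union>k. {\<omega>\<in>space M. \<bar>L (T - t) \<omega>\<bar> \<le> real k}) = space M"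
      using real_arch_simple by blast
    ultimately show False
      by (simp add: emeasure_space_1)
  qed
  then obtain k where k: "emeasure M {\<omega>\<in>space M. \<bar>L (T - t) \<omega>\<bar> \<le> real k} \<noteq> 0"
    by blast
  let ?p = "\<integral>\<^sup>+\<omega>. indicator {x. \<bar>x\<bar> \<le> real k} (L (T - t) \<omega>) \<partial>M"
  have "?p = (\<integral>\<^sup>+\<omega>. indicator {\<omega>\<in>space M. \<bar>L (T - t) \<omega>\<bar> \<le> real k} \<omega> \<partial>M)"
    by (intro nn_integral_cong) (auto simp: indicator_def)
  then have p: "?p \<noteq> 0"
    using k by simp
  have "(\<integral>\<^sup>+\<omega>. ennreal \<bar>L t \<omega>\<bar> \<partial>M) * ?p
      = (\<integral>\<^sup>+\<omega>. ennreal \<bar>L t \<omega>\<bar> * indicator {x. \<bar>x\<bar> \<le> real k} (L T \<omega> - L t \<omega>) \<partial>M)"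
    using adapted[OF t] by (intro nn_integral_past_times_increment[OF st, symmetric]) auto
  also have "\<dots> \<le> (\<integral>\<^sup>+\<omega>. ennreal (\<bar>L T \<omega>\<bar> + real k) \<partial>M)"
    by (intro nn_integral_mono) (auto split: split_indicator simp del: ennreal_plus intro!: ennreal_leI)
  also have "\<dots> = ennreal (\<integral>\<omega>. \<bar>L T \<omega>\<bar> + real k \<partial>M)"
    using int by (intro nn_integral_eq_integral) auto
  also have "\<dots> < \<infinity>"
    by simp
  finally have "(\<integral>\<^sup>+\<omega>. ennreal \<bar>L t \<omega>\<bar> \<partial>M) < \<infinity>"
    using p by (auto simp: less_top[symmetric] ennreal_mult_eq_top_iff)
  then show ?thesis
    by (intro integrableI_bounded) auto
qed

lemma expectation_increment:
  assumes int: "integrable M (L T)" and st: "0 \<le> s" "s \<le> t" "t \<le> T" and A: "A \<in> sets (F s)"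
  shows "(\<integral>\<omega>. (L t \<omega> - L s \<omega>) * indicator A \<omega> \<partial>M) = expectation (L (t - s)) * prob A"
proof -
  have s: "s \<in> {0..T}" "t \<in> {0..T}" "t - s \<in> {0..T}"
    using st by auto
  let ?V = "\<lambda>\<omega>. L t \<omega> - L s \<omega>"
  have V: "?V \<in> borel_measurable M"
    using s by (intro measurable_increment)
  have AM: "A \<in> events"
    using A sets_F_le[OF s(1)] by auto
  have U: "(indicator A :: 'a \<Rightarrow> real) \<in> borel_measurable (F s)"
    using A by simp
  have "indep_var borel (indicator A :: 'a \<Rightarrow> real) borel ?V"
    by (rule indep_past_increment[OF st U]) simp
  then have "(\<integral>\<omega>. indicator A \<omega> * ?V \<omega> \<partial>M) = (\<integral>\<omega>. indicator A \<omega> \<partial>M) * (\<integral>\<omega>. ?V \<omega> \<partial>M)"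
    using integrable_L[OF int] s AM
    by (intro indep_var_lebesgue_integral) (auto simp: emeasure_eq_measure)
  moreover have "(\<integral>\<omega>. ?V \<omega> \<partial>M) = (\<integral>x. x \<partial>distr M borel ?V)"
    using V by (simp add: integral_distr)
  moreover have "\<dots> = expectation (L (t - s))"
    using measurable_L[OF s(3)] by (simp add: distr_increment[OF st] integral_distr)
  ultimately show ?thesis
    using AM by (simp add: mult.commute)
qed

lemma expectation_on_grid:
  assumes int: "integrable M (L T)" and j: "j \<le> 2 ^ n"
  shows "expectation (L (real j * T / 2 ^ n)) = real j * T / 2 ^ n * (expectation (L T) / T)"
proof -
  have "expectation (L (real j * T / real (2 ^ n))) = real j / real (2 ^ n) * expectation (L T)"
  proof (rule additive_on_grid[where g="\<lambda>t. expectation (L t)" and T=T])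
    fix s t assume st: "0 \<le> s" "0 \<le> t" "s + t \<le> T"
    have "space M \<in> sets (F s)"
      using sets.top[of "F s"] st by simp
    then have "(\<integral>\<omega>. (L (s + t) \<omega> - L s \<omega>) * indicator (space M) \<omega> \<partial>M)
        = expectation (L t) * prob (space M)"
      using expectation_increment[OF int, of s "s + t" "space M"] st by simp
    moreover have "(\<integral>\<omega>. (L (s + t) \<omega> - L s \<omega>) * indicator (space M) \<omega> \<partial>M)
        = (\<integral>\<omega>. L (s + t) \<omega> - L s \<omega> \<partial>M)"
      by (intro Bochner_Integration.integral_cong) auto
    ultimately show "expectation (L (s + t)) = expectation (L s) + expectation (L t)"
      using integrable_L[OF int] st prob_space by simp
  qed (use j T_pos in auto)
  then show ?thesis
    using T_pos by simp
qed

text \<open>Wald's identity: with \<open>\<mu>\<close> the mean of \<open>L T\<close> divided by \<open>T\<close>, the process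
  \<open>L t - t \<mu>\<close> is a martingale along the grid.\<close>
lemma optional_sampling_L:
  assumes int: "integrable M (L T)" and \<sigma>: "real_stopping_time \<sigma>"
  shows "integrable M (\<lambda>\<omega>. L (\<sigma> \<omega>) \<omega>)"
    and "(\<integral>\<omega>. L (\<sigma> \<omega>) \<omega> \<partial>M) = expectation (L T) / T * (\<integral>\<omega>. \<sigma> \<omega> \<partial>M)"
proof -
  define \<mu> where "\<mu> = expectation (L T) / T"
  let ?N = "\<lambda>t \<omega>. L t \<omega> - t * \<mu>"
  have intN: "integrable M (?N (real j * T / 2 ^ n))" if "j \<le> 2 ^ n" for j n
    using integrable_L[OF int grid_in[OF that]] by simp
  have mart: "(\<integral>\<omega>. ?N (real j * T / 2 ^ n) \<omega> * indicator A \<omega> \<partial>M) = (\<integral>\<omega>. ?N T \<omega> * indicator A \<omega> \<partial>M)"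
    if j: "j \<le> 2 ^ n" and A: "A \<in> sets (F (real j * T / 2 ^ n))" for j n A
  proof -
    let ?t = "real j * T / 2 ^ n"
    have t: "0 \<le> ?t" "?t \<le> T"
      using grid_in[OF j] by auto
    have AM: "A \<in> events"
      using A sets_F_le[OF grid_in[OF j]] by auto
    have Tt: "T - ?t = real (2 ^ n - j) * T / 2 ^ n"
      using j by (simp add: of_nat_diff field_simps)
    have "expectation (L (T - ?t)) = (T - ?t) * \<mu>"
      unfolding Tt \<mu>_def by (rule expectation_on_grid[OF int]) simp
    then have "(\<integral>\<omega>. (L T \<omega> - L ?t \<omega>) * indicator A \<omega> \<partial>M) = (T - ?t) * \<mu> * prob A"
      using expectation_increment[OF int t _ A] by simp
    moreover have "(\<integral>\<omega>. (L T \<omega> - L ?t \<omega>) * indicator A \<omega> \<partial>M)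
        = (\<integral>\<omega>. L T \<omega> * indicator A \<omega> \<partial>M) - (\<integral>\<omega>. L ?t \<omega> * indicator A \<omega> \<partial>M)"
      using integrable_real_mult_indicator[OF AM int] integrable_real_mult_indicator[OF AM integrable_L[OF int grid_in[OF j]]]
      by (simp add: left_diff_distrib)
    ultimately show ?thesis
      using integrable_real_mult_indicator[OF AM int] integrable_real_mult_indicator[OF AM integrable_L[OF int grid_in[OF j]]] AM
      by (simp add: left_diff_distrib emeasure_eq_measure)
  qed
  have rc: "continuous (at_right t) (\<lambda>t. ?N t \<omega>)" if "t \<in> {0..<T}" "\<omega> \<in> space M" for t \<omega>
    using right_continuous[OF that(2,1)] by (intro continuous_intros)
  have ad: "?N t \<in> borel_measurable (F t)" if "t \<in> {0..T}" for t
    using adapted[OF that] by simp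
  note os = optional_sampling[where N="?N", OF \<sigma> ad rc intN mart]
  have m\<sigma>: "\<sigma> \<in> borel_measurable M"
    using measurable_from_subalg[OF subalgebra measurable_stopped[where Y="\<lambda>t \<omega>. t", OF \<sigma>]] by simp
  have int\<sigma>: "integrable M \<sigma>"
    using \<sigma> m\<sigma> by (intro integrable_const_bound[where B=T]) (auto simp: real_stopping_time_def intro!: AE_I2)
  have "integrable M (\<lambda>\<omega>. ?N (\<sigma> \<omega>) \<omega> + \<sigma> \<omega> * \<mu>)"
    by (intro Bochner_Integration.integrable_add os(1) integrable_mult_left int\<sigma>)
  then show i: "integrable M (\<lambda>\<omega>. L (\<sigma> \<omega>) \<omega>)"
    by simp
  have "(\<integral>\<omega>. L (\<sigma> \<omega>) \<omega> \<partial>M) - (\<integral>\<omega>. \<sigma> \<omega> \<partial>M) * \<mu> = expectation (L T) - T * \<mu>"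
  proof -
    have "(\<integral>\<omega>. L (\<sigma> \<omega>) \<omega> \<partial>M) - (\<integral>\<omega>. \<sigma> \<omega> \<partial>M) * \<mu> = (\<integral>\<omega>. ?N (\<sigma> \<omega>) \<omega> \<partial>M)"
      by (subst Bochner_Integration.integral_diff[OF i integrable_mult_left[OF int\<sigma>]]) simp
    also have "\<dots> = (\<integral>\<omega>. ?N T \<omega> \<partial>M)"
      by (rule os(2))
    also have "\<dots> = expectation (L T) - T * \<mu>"
      by (subst Bochner_Integration.integral_diff[OF int]) (simp_all add: prob_space)
    finally show ?thesis .
  qed
  then show "(\<integral>\<omega>. L (\<sigma> \<omega>) \<omega> \<partial>M) = expectation (L T) / T * (\<integral>\<omega>. \<sigma> \<omega> \<partial>M)"
    using T_pos by (simp add: \<mu>_def mult.commute)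
qed

lemma martingale_of_centred:
  assumes int: "integrable M (L T)" and centred: "expectation (L T) = 0"
  shows "martingale M T F L"
  unfolding martingale_def
proof (intro conjI ballI)
  have eq: "(\<integral>\<omega>. L t \<omega> * indicator A \<omega> \<partial>M) = (\<integral>\<omega>. L T \<omega> * indicator A \<omega> \<partial>M)"
    if t: "t \<in> {0..T}" and A: "A \<in> sets (F t)" for t A
  proof -
    have AM: "A \<in> events"
      using A sets_F_le[OF t] by auto
    let ?\<sigma> = "\<lambda>\<omega>. if \<omega> \<in> A then t else T"
    have "(\<integral>\<omega>. L (?\<sigma> \<omega>) \<omega> \<partial>M) = 0"
      using optional_sampling_L(2)[OF int real_stopping_time_cases[OF t A]] centred by simp
    moreover have "(\<integral>\<omega>. L (?\<sigma> \<omega>) \<omega> \<partial>M)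
        = (\<integral>\<omega>. L t \<omega> * indicator A \<omega> + (L T \<omega> - L T \<omega> * indicator A \<omega>) \<partial>M)"
      by (intro Bochner_Integration.integral_cong) (auto simp: indicator_def)
    moreover have "\<dots> = (\<integral>\<omega>. L t \<omega> * indicator A \<omega> \<partial>M) + (expectation (L T) - (\<integral>\<omega>. L T \<omega> * indicator A \<omega> \<partial>M))"
      using integrable_real_mult_indicator[OF AM int] integrable_real_mult_indicator[OF AM integrable_L[OF int t]] int
      by simp
    ultimately show ?thesis
      using centred by simp
  qed
  fix s t assume s: "s \<in> {0..T}" and t: "t \<in> {s..T}"
  then have t': "t \<in> {0..T}" by auto
  interpret sigma_finite_subalgebra M "F s"
    using subalgebra_t[OF s] by (intro finite_measure_subalgebra_is_sigma_finite
      finite_measure_subalgebra.intro finite_measure_axioms finite_measure_subalgebra_axioms.intro)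
  show "AE \<omega> in M. real_cond_exp M (F s) (L t) \<omega> = L s \<omega>"
  proof (rule real_cond_exp_charact)
    fix A assume A: "A \<in> sets (F s)"
    then have At: "A \<in> sets (F t)"
      using sets_F_mono[OF s t'] t by auto
    show "(\<integral>\<omega>\<in>A. L t \<omega> \<partial>M) = (\<integral>\<omega>\<in>A. L s \<omega> \<partial>M)"
      unfolding set_lebesgue_integral_def real_scaleR_def
      using eq[OF s A] eq[OF t' At] by (simp only: mult.commute[of "indicator A _"])
  qed (fact integrable_L[OF int t'] integrable_L[OF int s] adapted[OF s])+
qed (fact integrable_L[OF int] adapted)+

end

section \<open>The exponential martingale and the Esscher measure\<close>

context levy_process
begin

abbreviation mgf :: "real \<Rightarrow> real \<Rightarrow> ennreal" where
  "mgf \<kappa> t \<equiv> \<integral>\<^sup>+\<omega>. ennreal (exp (\<kappa> * L t \<omega>)) \<partial>M"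

lemma mgf_pos:
  assumes "t \<in> {0..T}"
  shows "0 < mgf \<kappa> t"
proof (rule ccontr)
  have [measurable]: "L t \<in> borel_measurable M"
    using measurable_L[OF assms] .
  assume "\<not> 0 < mgf \<kappa> t"
  then have "AE \<omega> in M. ennreal (exp (\<kappa> * L t \<omega>)) = 0"
    by (subst (asm) not_gr_zero, subst (asm) nn_integral_0_iff_AE) auto
  then have "AE \<omega> in M. False"
    by eventually_elim simp
  then show False
    by simp
qed

lemma mgf_add:
  assumes "0 \<le> s" "0 \<le> t" "s + t \<le> T"
  shows "mgf \<kappa> (s + t) = mgf \<kappa> s * mgf \<kappa> t"
proof -
  have "(\<integral>\<^sup>+\<omega>. ennreal (exp (\<kappa> * L s \<omega>)) * ennreal (exp (\<kappa> * (L (s + t) \<omega> - L s \<omega>))) \<partial>M)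
      = mgf \<kappa> s * mgf \<kappa> (s + t - s)"
    using assms adapted[of s]
    by (intro nn_integral_past_times_increment[where f="\<lambda>x. ennreal (exp (\<kappa> * x))"]) auto
  then show ?thesis
    by (simp add: ennreal_mult[symmetric] exp_add[symmetric] algebra_simps)
qed

lemma mgf_finite:
  assumes fin: "mgf \<kappa> T < \<infinity>" and t: "t \<in> {0..T}"
  shows "mgf \<kappa> t < \<infinity>"
proof -
  have "mgf \<kappa> T = mgf \<kappa> t * mgf \<kappa> (T - t)"
    using mgf_add[of t "T - t" \<kappa>] t by simp
  moreover have "0 < mgf \<kappa> (T - t)"
    using t by (intro mgf_pos) auto
  ultimately show ?thesis
    using fin by (auto simp: less_top[symmetric] ennreal_mult_eq_top_iff)
qed

text \<open>The cumulant generating function of \<open>L T\<close>, meaningful where \<open>mgf \<kappa> T\<close> is finite.\<close>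
definition cgf :: "real \<Rightarrow> real" where
  "cgf \<kappa> = ln (enn2real (mgf \<kappa> T))"

lemma exp_ln_mgf:
  assumes fin: "mgf \<kappa> T < \<infinity>" and t: "t \<in> {0..T}"
  shows "ennreal (exp (ln (enn2real (mgf \<kappa> t)))) = mgf \<kappa> t"
proof -
  have "0 < enn2real (mgf \<kappa> t)"
    using mgf_finite[OF assms] mgf_pos[OF t, of \<kappa>] by (simp add: enn2real_positive_iff)
  then show ?thesis
    using mgf_finite[OF assms] by (simp add: ennreal_enn2real_if less_top[symmetric])
qed

lemma exp_cgf: "mgf \<kappa> T < \<infinity> \<Longrightarrow> ennreal (exp (cgf \<kappa>)) = mgf \<kappa> T"
  unfolding cgf_def using T_pos by (intro exp_ln_mgf) auto

text \<open>The moment generating function is multiplicative in \<open>t\<close>, so its logarithm is additive.\<close>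
lemma mgf_on_grid:
  assumes fin: "mgf \<kappa> T < \<infinity>" and j: "j \<le> 2 ^ n"
  shows "mgf \<kappa> (real j * T / 2 ^ n) = ennreal (exp (cgf \<kappa> * (real j * T / 2 ^ n) / T))"
proof -
  let ?g = "\<lambda>t. ln (enn2real (mgf \<kappa> t))"
  have "?g (real j * T / real (2 ^ n)) = real j / real (2 ^ n) * ?g T"
  proof (rule additive_on_grid[where g="?g" and T=T])
    fix s t assume st: "0 \<le> s" "0 \<le> t" "s + t \<le> T"
    have "0 < enn2real (mgf \<kappa> u)" if "u \<in> {0..T}" for u
      using mgf_finite[OF fin that] mgf_pos[OF that, of \<kappa>] by (simp add: enn2real_positive_iff)
    then have "0 < enn2real (mgf \<kappa> s)" "0 < enn2real (mgf \<kappa> t)"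
      using st by auto
    then show "?g (s + t) = ?g s + ?g t"
      using mgf_add[OF st, of \<kappa>] by (simp add: enn2real_mult ln_mult)
  qed (use j T_pos in auto)
  then have "?g (real j * T / 2 ^ n) = cgf \<kappa> * (real j * T / 2 ^ n) / T"
    using T_pos by (simp add: cgf_def)
  then show ?thesis
    using exp_ln_mgf[OF fin grid_in[OF j]] by simp
qed

text \<open>The exponential martingale \<open>exp (\<kappa> L t - cgf \<kappa> t / T)\<close>: the remaining factor at time
  \<open>T\<close> is independent of the past and has mean one.\<close>
lemma exponential_martingale_on_grid:
  assumes fin: "mgf \<kappa> T < \<infinity>" and j: "j \<le> 2 ^ n" and A: "A \<in> sets (F (real j * T / 2 ^ n))"
  defines "t \<equiv> real j * T / 2 ^ n"
  shows "(\<integral>\<^sup>+\<omega>. ennreal (exp (\<kappa> * L t \<omega> - cgf \<kappa> * t / T)) * indicator A \<omega> \<partial>M)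
    = (\<integral>\<^sup>+\<omega>. ennreal (exp (\<kappa> * L T \<omega> - cgf \<kappa> * T / T)) * indicator A \<omega> \<partial>M)"
proof -
  have t: "t \<in> {0..T}"
    unfolding t_def by (rule grid_in[OF j])
  let ?U = "\<lambda>\<omega>. ennreal (exp (\<kappa> * L t \<omega> - cgf \<kappa> * t / T)) * indicator A \<omega>"
  let ?c = "cgf \<kappa> * (T - t) / T"
  have U: "?U \<in> borel_measurable (F t)"
    using adapted[OF t] A unfolding t_def[symmetric] by simp
  have "?U \<omega> * ennreal (exp (\<kappa> * (L T \<omega> - L t \<omega>) - ?c))
      = ennreal (exp (\<kappa> * L T \<omega> - cgf \<kappa> * T / T)) * indicator A \<omega>" for \<omega>
  proof -
    have "exp (\<kappa> * L t \<omega> - cgf \<kappa> * t / T) * exp (\<kappa> * (L T \<omega> - L t \<omega>) - ?c) = exp (\<kappa> * L T \<omega> - cgf \<kappa> * T / T)"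
      unfolding exp_add[symmetric] by (simp add: algebra_simps diff_divide_distrib)
    then show ?thesis
      using T_pos by (auto simp: ennreal_mult[symmetric] split: split_indicator)
  qed
  then have "(\<integral>\<^sup>+\<omega>. ennreal (exp (\<kappa> * L T \<omega> - cgf \<kappa> * T / T)) * indicator A \<omega> \<partial>M)
      = (\<integral>\<^sup>+\<omega>. ?U \<omega> * ennreal (exp (\<kappa> * (L T \<omega> - L t \<omega>) - ?c)) \<partial>M)"
    by simp
  also have "\<dots> = (\<integral>\<^sup>+\<omega>. ?U \<omega> \<partial>M) * (\<integral>\<^sup>+\<omega>. ennreal (exp (\<kappa> * L (T - t) \<omega> - ?c)) \<partial>M)"
    using t by (intro nn_integral_past_times_increment[where f="\<lambda>x. ennreal (exp (\<kappa> * x - ?c))"] U) auto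
  also have "(\<integral>\<^sup>+\<omega>. ennreal (exp (\<kappa> * L (T - t) \<omega> - ?c)) \<partial>M) = 1"
  proof -
    have [measurable]: "L (T - t) \<in> borel_measurable M"
      using t by (intro measurable_L) auto
    have Tt: "T - t = real (2 ^ n - j) * T / 2 ^ n"
      using j by (simp add: t_def of_nat_diff field_simps)
    have m: "mgf \<kappa> (T - t) = ennreal (exp ?c)"
      unfolding Tt by (rule mgf_on_grid[OF fin]) simp
    have "(\<integral>\<^sup>+\<omega>. ennreal (exp (\<kappa> * L (T - t) \<omega> - ?c)) \<partial>M)
        = (\<integral>\<^sup>+\<omega>. ennreal (exp (- ?c)) * ennreal (exp (\<kappa> * L (T - t) \<omega>)) \<partial>M)"
      by (intro nn_integral_cong) (simp add: ennreal_mult[symmetric] exp_add[symmetric])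
    also have "\<dots> = ennreal (exp (- ?c)) * ennreal (exp ?c)"
      unfolding m[symmetric] by (intro nn_integral_cmult) simp
    also have "\<dots> = 1"
      by (simp add: ennreal_mult[symmetric] exp_add[symmetric])
    finally show ?thesis .
  qed
  finally show ?thesis
    by simp
qed

lemma nn_integral_exponential: 
  assumes fin: "mgf \<kappa> T < \<infinity>"
  shows "(\<integral>\<^sup>+\<omega>. ennreal (exp (\<kappa> * L T \<omega> - cgf \<kappa>)) \<partial>M) = 1"
proof -
  have "(\<integral>\<^sup>+\<omega>. ennreal (exp (\<kappa> * L T \<omega> - cgf \<kappa>)) \<partial>M)
      = (\<integral>\<^sup>+\<omega>. ennreal (exp (- cgf \<kappa>)) * ennreal (exp (\<kappa> * L T \<omega>)) \<partial>M)"
    by (intro nn_integral_cong) (simp add: ennreal_mult[symmetric] exp_add[symmetric])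
  also have "\<dots> = ennreal (exp (- cgf \<kappa>)) * ennreal (exp (cgf \<kappa>))"
    unfolding exp_cgf[OF fin] by (intro nn_integral_cmult) simp
  also have "\<dots> = 1"
    by (simp add: ennreal_mult[symmetric] exp_add[symmetric])
  finally show ?thesis .
qed

lemma exponential_stopped_le:
  assumes fin: "mgf \<kappa> T < \<infinity>" and \<sigma>: "real_stopping_time \<sigma>"
  shows "(\<integral>\<^sup>+\<omega>. ennreal (exp (\<kappa> * L (\<sigma> \<omega>) \<omega> - cgf \<kappa> * \<sigma> \<omega> / T)) \<partial>M) \<le> 1"
proof -
  have "(\<integral>\<^sup>+\<omega>. ennreal (exp (\<kappa> * L (\<sigma> \<omega>) \<omega> - cgf \<kappa> * \<sigma> \<omega> / T)) \<partial>M)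
      \<le> (\<integral>\<^sup>+\<omega>. ennreal (exp (\<kappa> * L T \<omega> - cgf \<kappa> * T / T)) \<partial>M)"
  proof (rule optional_sampling_le[where Y="\<lambda>t \<omega>. exp (\<kappa> * L t \<omega> - cgf \<kappa> * t / T)", OF \<sigma>])
    show "(\<lambda>\<omega>. exp (\<kappa> * L t \<omega> - cgf \<kappa> * t / T)) \<in> borel_measurable (F t)" if "t \<in> {0..T}" for t
      using adapted[OF that] by simp
    show "continuous (at_right t) (\<lambda>t. exp (\<kappa> * L t \<omega> - cgf \<kappa> * t / T))"
      if "t \<in> {0..<T}" "\<omega> \<in> space M" for t \<omega>
      using right_continuous[OF that(2,1)] T_pos by (intro continuous_intros) auto
    show "(\<integral>\<^sup>+\<omega>. ennreal (exp (\<kappa> * L (real j * T / 2 ^ n) \<omega> - cgf \<kappa> * (real j * T / 2 ^ n) / T)) * indicator A \<omega> \<partial>M)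
        \<le> (\<integral>\<^sup>+\<omega>. ennreal (exp (\<kappa> * L T \<omega> - cgf \<kappa> * T / T)) * indicator A \<omega> \<partial>M)"
      if "j \<le> 2 ^ n" "A \<in> sets (F (real j * T / 2 ^ n))" for j n A
      using exponential_martingale_on_grid[OF fin that] by (rule eq_refl)
  qed simp
  then show ?thesis
    using nn_integral_exponential[OF fin] T_pos by simp
qed

lemma esscher_measure_eq:
  assumes fin: "mgf \<kappa> T < \<infinity>"
  shows "esscher_measure M T F L \<kappa>
    = density (restr_to_subalg M (F T)) (\<lambda>\<omega>. ennreal (exp (\<kappa> * L T \<omega> - cgf \<kappa>)))"
  unfolding esscher_measure_def phi_def exp_cgf[OF fin, symmetric]
  by (simp add: divide_ennreal exp_diff)

lemma sets_esscher [simp]: "sets (esscher_measure M T F L \<kappa>) = sets (F T)"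
  by (simp add: esscher_measure_def sets_restr_to_subalg[OF subalgebra])

lemma space_esscher [simp]: "space (esscher_measure M T F L \<kappa>) = space M"
  by (simp add: esscher_measure_def space_restr_to_subalg)

lemma nn_integral_esscher:
  assumes fin: "mgf \<kappa> T < \<infinity>" and f: "f \<in> borel_measurable (F T)"
  shows "(\<integral>\<^sup>+\<omega>. f \<omega> \<partial>esscher_measure M T F L \<kappa>)
    = (\<integral>\<^sup>+\<omega>. ennreal (exp (\<kappa> * L T \<omega> - cgf \<kappa>)) * f \<omega> \<partial>M)"
proof -
  have LT: "L T \<in> borel_measurable (F T)"
    using adapted T_pos by simp
  have "(\<integral>\<^sup>+\<omega>. f \<omega> \<partial>esscher_measure M T F L \<kappa>)
      = (\<integral>\<^sup>+\<omega>. ennreal (exp (\<kappa> * L T \<omega> - cgf \<kappa>)) * f \<omega> \<partial>restr_to_subalg M (F T))"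
    unfolding esscher_measure_eq[OF fin] using LT
    by (intro nn_integral_density measurable_in_subalg[OF subalgebra] f) simp
  also have "\<dots> = (\<integral>\<^sup>+\<omega>. ennreal (exp (\<kappa> * L T \<omega> - cgf \<kappa>)) * f \<omega> \<partial>M)"
    using f LT by (intro nn_integral_subalgebra2[OF subalgebra]) simp
  finally show ?thesis .
qed

lemma prob_space_esscher:
  assumes fin: "mgf \<kappa> T < \<infinity>"
  shows "prob_space (esscher_measure M T F L \<kappa>)"
proof (rule prob_spaceI)
  have "emeasure (esscher_measure M T F L \<kappa>) (space (esscher_measure M T F L \<kappa>))
      = (\<integral>\<^sup>+\<omega>. 1 \<partial>esscher_measure M T F L \<kappa>)"
    by simp
  also have "\<dots> = 1"
    using nn_integral_esscher[OF fin, of "\<lambda>_. 1"] nn_integral_exponential[OF fin] by simp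
  finally show "emeasure (esscher_measure M T F L \<kappa>) (space (esscher_measure M T F L \<kappa>)) = 1" .
qed

lemma absolutely_continuous_esscher:
  assumes fin: "mgf \<kappa> T < \<infinity>"
  shows "absolutely_continuous (restr_to_subalg M (F T)) (esscher_measure M T F L \<kappa>)"
  unfolding esscher_measure_eq[OF fin] using adapted[of T] T_pos
  by (intro absolutely_continuousI_density measurable_in_subalg[OF subalgebra]) simp

text \<open>The density \<open>exp (\<kappa> L T - cgf \<kappa>)\<close> splits into factors for the past of \<open>s\<close>, the
  increment from \<open>s\<close> to \<open>t\<close>, and the increment from \<open>t\<close> to \<open>T\<close>. This factorisation is
  the reason why \<open>L\<close> remains a Levy process under the Esscher measure.\<close>
lemma nn_integral_esscher_past_increment:
  assumes fin: "mgf \<kappa> T < \<infinity>" and st: "0 \<le> s" "s \<le> t" "t \<le> T"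
    and U: "U \<in> borel_measurable (F s)" and f [measurable]: "f \<in> borel_measurable borel"
  shows "(\<integral>\<^sup>+\<omega>. U \<omega> * f (L t \<omega> - L s \<omega>) \<partial>esscher_measure M T F L \<kappa>)
    = (\<integral>\<^sup>+\<omega>. U \<omega> * ennreal (exp (\<kappa> * L s \<omega>)) \<partial>M)
      * (\<integral>\<^sup>+\<omega>. f (L (t - s) \<omega>) * ennreal (exp (\<kappa> * L (t - s) \<omega>)) \<partial>M)
      * (mgf \<kappa> (T - t) * ennreal (exp (- cgf \<kappa>)))"
proof -
  have I: "s \<in> {0..T}" "t \<in> {0..T}" "T \<in> {0..T}"
    using st by auto
  have Ut: "U \<in> borel_measurable (F t)" "U \<in> borel_measurable (F T)"
    using measurable_F_mono[OF _ _ _ U] st I by auto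
  have Ls: "L s \<in> borel_measurable (F t)" "L s \<in> borel_measurable (F T)"
    using measurable_F_mono[OF _ _ _ adapted[OF I(1)]] st I by auto
  have Lt: "L t \<in> borel_measurable (F T)"
    using measurable_F_mono[OF _ _ _ adapted[OF I(2)]] st I by auto
  let ?e = "\<lambda>x. ennreal (exp (\<kappa> * x))"
  let ?V = "\<lambda>\<omega>. U \<omega> * ?e (L s \<omega>)"
  let ?h = "\<lambda>x. f x * ?e x"
  have h: "?h \<in> borel_measurable borel"
    by measurable
  have V: "?V \<in> borel_measurable (F s)"
    using U adapted[OF I(1)] by simp
  have W: "(\<lambda>\<omega>. ?V \<omega> * ?h (L t \<omega> - L s \<omega>)) \<in> borel_measurable (F t)"
    using Ut(1) Ls(1) adapted[OF I(2)] by measurable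
  have m: "(\<lambda>\<omega>. U \<omega> * f (L t \<omega> - L s \<omega>)) \<in> borel_measurable (F T)"
    using Ut(2) Ls(2) Lt by measurable
  have "ennreal (exp (\<kappa> * L T \<omega> - cgf \<kappa>)) * (U \<omega> * f (L t \<omega> - L s \<omega>))
      = ?V \<omega> * ?h (L t \<omega> - L s \<omega>) * (?e (L T \<omega> - L t \<omega>) * ennreal (exp (- cgf \<kappa>)))" for \<omega>
  proof -
    have "exp (\<kappa> * L T \<omega> - cgf \<kappa>)
        = exp (\<kappa> * L s \<omega>) * exp (\<kappa> * (L t \<omega> - L s \<omega>)) * exp (\<kappa> * (L T \<omega> - L t \<omega>)) * exp (- cgf \<kappa>)"
      unfolding exp_add[symmetric] by (simp add: algebra_simps)
    then have "ennreal (exp (\<kappa> * L T \<omega> - cgf \<kappa>))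
        = ?e (L s \<omega>) * ?e (L t \<omega> - L s \<omega>) * ?e (L T \<omega> - L t \<omega>) * ennreal (exp (- cgf \<kappa>))"
      by (simp add: ennreal_mult)
    then show ?thesis
      by (simp only: ac_simps)
  qed
  then have "(\<integral>\<^sup>+\<omega>. U \<omega> * f (L t \<omega> - L s \<omega>) \<partial>esscher_measure M T F L \<kappa>)
      = (\<integral>\<^sup>+\<omega>. ?V \<omega> * ?h (L t \<omega> - L s \<omega>) * (?e (L T \<omega> - L t \<omega>) * ennreal (exp (- cgf \<kappa>))) \<partial>M)"
    unfolding nn_integral_esscher[OF fin m] by simp
  also have "\<dots> = (\<integral>\<^sup>+\<omega>. ?V \<omega> * ?h (L t \<omega> - L s \<omega>) \<partial>M)
      * (\<integral>\<^sup>+\<omega>. ?e (L (T - t) \<omega>) * ennreal (exp (- cgf \<kappa>)) \<partial>M)"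
    using st by (intro nn_integral_past_times_increment[where f="\<lambda>x. ?e x * ennreal (exp (- cgf \<kappa>))"] W) auto
  also have "(\<integral>\<^sup>+\<omega>. ?V \<omega> * ?h (L t \<omega> - L s \<omega>) \<partial>M)
      = (\<integral>\<^sup>+\<omega>. ?V \<omega> \<partial>M) * (\<integral>\<^sup>+\<omega>. ?h (L (t - s) \<omega>) \<partial>M)"
    by (rule nn_integral_past_times_increment[OF st V h])
  also have "(\<integral>\<^sup>+\<omega>. ?e (L (T - t) \<omega>) * ennreal (exp (- cgf \<kappa>)) \<partial>M)
      = mgf \<kappa> (T - t) * ennreal (exp (- cgf \<kappa>))"
    using measurable_L[of "T - t"] st by (intro nn_integral_multc) auto
  finally show ?thesis .
qed

text \<open>Independence and stationarity under the Esscher measure are read off from the factorisation of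
  the joint law; the factors that do not involve the increment cancel because \<open>mgf\<close> is
  multiplicative in time.\<close>
lemma levy_process_esscher:
  assumes fin: "mgf \<kappa> T < \<infinity>"
  shows "levy_process (esscher_measure M T F L \<kappa>) T F L"
proof -
  let ?Q = "esscher_measure M T F L \<kappa>"
  interpret Q: prob_space ?Q
    by (rule prob_space_esscher[OF fin])
  let ?c = "ennreal (exp (- cgf \<kappa>))"
  have one: "mgf \<kappa> s * mgf \<kappa> (T - s) * ?c = 1" if "s \<in> {0..T}" for s
  proof -
    have "mgf \<kappa> s * mgf \<kappa> (T - s) = ennreal (exp (cgf \<kappa>))"
      using mgf_add[of s "T - s" \<kappa>] that exp_cgf[OF fin] by simp
    then show ?thesis
      by (simp add: ennreal_mult[symmetric] exp_add[symmetric])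
  qed
  have V: "(\<lambda>\<omega>. L t \<omega> - L s \<omega>) \<in> borel_measurable (F T)" if "0 \<le> s" "s \<le> t" "t \<le> T" for s t
    using measurable_F_mono[OF _ _ _ adapted[of s]] measurable_F_mono[OF _ _ _ adapted[of t]] that T_pos
    by (intro borel_measurable_diff) auto
  have joint: "emeasure ?Q (A \<inter> ((\<lambda>\<omega>. L t \<omega> - L s \<omega>) -` B \<inter> space M))
      = (\<integral>\<^sup>+\<omega>. indicator A \<omega> * ennreal (exp (\<kappa> * L s \<omega>)) \<partial>M)
        * (\<integral>\<^sup>+\<omega>. indicator B (L (t - s) \<omega>) * ennreal (exp (\<kappa> * L (t - s) \<omega>)) \<partial>M)
        * (mgf \<kappa> (T - t) * ?c)"
    if st: "0 \<le> s" "s \<le> t" "t \<le> T" and A: "A \<in> sets (F s)" and B: "B \<in> sets borel" for s t A B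
  proof -
    have "A \<in> sets (F T)"
      using sets_F_mono[of s T] A st by auto
    moreover have "(\<lambda>\<omega>. L t \<omega> - L s \<omega>) -` B \<inter> space M \<in> sets (F T)"
      using measurable_sets[OF V[OF st] B] T_pos by simp
    ultimately have "emeasure ?Q (A \<inter> ((\<lambda>\<omega>. L t \<omega> - L s \<omega>) -` B \<inter> space M))
        = (\<integral>\<^sup>+\<omega>. indicator (A \<inter> ((\<lambda>\<omega>. L t \<omega> - L s \<omega>) -` B \<inter> space M)) \<omega> \<partial>?Q)"
      by (intro nn_integral_indicator[symmetric]) auto
    also have "\<dots> = (\<integral>\<^sup>+\<omega>. indicator A \<omega> * indicator B (L t \<omega> - L s \<omega>) \<partial>?Q)"
      by (intro nn_integral_cong) (simp split: split_indicator)
    also have "\<dots> = (\<integral>\<^sup>+\<omega>. indicator A \<omega> * ennreal (exp (\<kappa> * L s \<omega>)) \<partial>M)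
        * (\<integral>\<^sup>+\<omega>. indicator B (L (t - s) \<omega>) * ennreal (exp (\<kappa> * L (t - s) \<omega>)) \<partial>M)
        * (mgf \<kappa> (T - t) * ?c)"
      using A B by (intro nn_integral_esscher_past_increment[OF fin st]) auto
    finally show ?thesis .
  qed
  let ?psi = "\<lambda>B u. \<integral>\<^sup>+\<omega>. indicator B (L u \<omega>) * ennreal (exp (\<kappa> * L u \<omega>)) \<partial>M"
  have space_sets: "space M \<in> sets (F s)" if "s \<in> {0..T}" for s
    using space_F[OF that] sets.top[of "F s"] by metis
  have marginal: "emeasure ?Q ((\<lambda>\<omega>. L t \<omega> - L s \<omega>) -` B \<inter> space M)
      = mgf \<kappa> s * ?psi B (t - s) * (mgf \<kappa> (T - t) * ?c)"
    if st: "0 \<le> s" "s \<le> t" "t \<le> T" and B: "B \<in> sets borel" for s t B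
  proof -
    have "(\<integral>\<^sup>+\<omega>. indicator (space M) \<omega> * ennreal (exp (\<kappa> * L s \<omega>)) \<partial>M) = mgf \<kappa> s"
      by (intro nn_integral_cong) simp
    moreover have "space M \<inter> ((\<lambda>\<omega>. L t \<omega> - L s \<omega>) -` B \<inter> space M) = (\<lambda>\<omega>. L t \<omega> - L s \<omega>) -` B \<inter> space M"
      by blast
    ultimately show ?thesis
      using joint[OF st space_sets B] st by simp
  qed
  show ?thesis
  proof (intro levy_process.intro levy_process_axioms.intro)
    show "prob_space ?Q"
      by (rule prob_space_esscher[OF fin])
    show "Stopping_Time.filtration (space ?Q) (\<lambda>t. F (cap T t))"
      using filtration_F by simp
    show "subalgebra ?Q (F T)"
      using T_pos by (simp add: subalgebra_def)
    show "distr ?Q borel (\<lambda>\<omega>. L (t + h) \<omega> - L (s + h) \<omega>) = distr ?Q borel (\<lambda>\<omega>. L t \<omega> - L s \<omega>)"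
      if a: "0 \<le> s" "s \<le> t" "0 \<le> h" "t + h \<le> T" for s t h
    proof (rule measure_eqI)
      have st: "0 \<le> s" "s \<le> t" "t \<le> T" and sth: "0 \<le> s + h" "s + h \<le> t + h" "t + h \<le> T"
        using a by auto
      have VQ: "(\<lambda>\<omega>. L t \<omega> - L s \<omega>) \<in> borel_measurable ?Q" "(\<lambda>\<omega>. L (t + h) \<omega> - L (s + h) \<omega>) \<in> borel_measurable ?Q"
        using V[OF st] V[OF sth] by (simp_all add: measurable_cong_sets[OF sets_esscher refl])
      fix B assume "B \<in> sets (distr ?Q borel (\<lambda>\<omega>. L (t + h) \<omega> - L (s + h) \<omega>))"
      then have B: "B \<in> sets borel"
        by simp
      have "mgf \<kappa> (s + h) * mgf \<kappa> (T - (t + h)) = mgf \<kappa> s * mgf \<kappa> h * mgf \<kappa> (T - t - h)"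
        using mgf_add[of s h \<kappa>] a by (simp add: algebra_simps)
      also have "\<dots> = mgf \<kappa> s * mgf \<kappa> (T - t)"
        using mgf_add[of h "T - t - h" \<kappa>] a by (simp add: mult.assoc)
      finally have eq: "mgf \<kappa> (s + h) * mgf \<kappa> (T - (t + h)) = mgf \<kappa> s * mgf \<kappa> (T - t)" .
      have d: "t + h - (s + h) = t - s"
        by simp
      have "mgf \<kappa> (s + h) * ?psi B (t - s) * (mgf \<kappa> (T - (t + h)) * ?c)
          = (mgf \<kappa> (s + h) * mgf \<kappa> (T - (t + h))) * (?psi B (t - s) * ?c)"
        by (simp only: ac_simps)
      also have "\<dots> = mgf \<kappa> s * ?psi B (t - s) * (mgf \<kappa> (T - t) * ?c)"
        unfolding eq by (simp only: ac_simps)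
      finally show "emeasure (distr ?Q borel (\<lambda>\<omega>. L (t + h) \<omega> - L (s + h) \<omega>)) B
          = emeasure (distr ?Q borel (\<lambda>\<omega>. L t \<omega> - L s \<omega>)) B"
        using marginal[OF st B] marginal[OF sth B] VQ B unfolding d by (simp add: emeasure_distr)
    qed simp
    show "Q.indep_set (sets (F s)) {(\<lambda>\<omega>. L t \<omega> - L s \<omega>) -` B \<inter> space ?Q | B. B \<in> sets borel}"
      if st: "0 \<le> s" "s \<le> t" "t \<le> T" for s t
    proof (rule Q.indep_setI)
      show "sets (F s) \<subseteq> sets ?Q"
        using sets_F_mono[of s T] st by simp
      show "{(\<lambda>\<omega>. L t \<omega> - L s \<omega>) -` B \<inter> space ?Q | B. B \<in> sets borel} \<subseteq> sets ?Q"
        using measurable_sets[OF V[OF st]] T_pos by auto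
      fix A b assume A: "A \<in> sets (F s)"
        and "b \<in> {(\<lambda>\<omega>. L t \<omega> - L s \<omega>) -` B \<inter> space ?Q | B. B \<in> sets borel}"
      then obtain B where b: "b = (\<lambda>\<omega>. L t \<omega> - L s \<omega>) -` B \<inter> space M" and B: "B \<in> sets borel"
        by auto
      let ?a = "\<integral>\<^sup>+\<omega>. indicator A \<omega> * ennreal (exp (\<kappa> * L s \<omega>)) \<partial>M"
      have "A \<inter> ((\<lambda>\<omega>. L t \<omega> - L s \<omega>) -` UNIV \<inter> space M) = A"
        using sets.sets_into_space[OF A] st by auto
      then have eA: "emeasure ?Q A = ?a * mgf \<kappa> (t - s) * (mgf \<kappa> (T - t) * ?c)"
        using joint[OF st A, of UNIV] by simp
      have "mgf \<kappa> s * mgf \<kappa> (t - s) = mgf \<kappa> t"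
        using mgf_add[of s "t - s" \<kappa>] st by simp
      then have one': "mgf \<kappa> s * mgf \<kappa> (t - s) * (mgf \<kappa> (T - t) * ?c) = 1"
        using one[of t] st by (simp add: mult.assoc)
      have "emeasure ?Q A * emeasure ?Q b
          = (?a * ?psi B (t - s) * (mgf \<kappa> (T - t) * ?c))
            * (mgf \<kappa> s * mgf \<kappa> (t - s) * (mgf \<kappa> (T - t) * ?c))"
        unfolding eA b marginal[OF st B] by (simp only: ac_simps)
      also have "\<dots> = emeasure ?Q (A \<inter> b)"
        unfolding one' b joint[OF st A B] by simp
      finally show "Q.prob (A \<inter> b) = Q.prob A * Q.prob b"
        by (simp add: Q.emeasure_eq_measure ennreal_mult[symmetric])
    qed
  qed (use horizon_pos adapted starts_at_0 cadlag in auto)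
qed

end

section \<open>Entropy bound and rigidity over the class of measures\<close>

lemma (in prob_space) expectation_eventually_const:
  fixes \<sigma> :: "nat \<Rightarrow> 'a \<Rightarrow> real"
  assumes meas: "\<And>k. \<sigma> k \<in> borel_measurable M" and bound: "\<And>k \<omega>. \<omega> \<in> space M \<Longrightarrow> \<bar>\<sigma> k \<omega>\<bar> \<le> b"
    and f: "f \<in> borel_measurable M"
    and ev: "\<And>\<omega>. \<omega> \<in> space M \<Longrightarrow> \<forall>\<^sub>F k in sequentially. \<sigma> k \<omega> = f \<omega>"
  shows "(\<lambda>k. expectation (\<sigma> k)) \<longlonglongrightarrow> expectation f"
proof (rule integral_dominated_convergence[where w="\<lambda>_. b"])
  show "AE \<omega> in M. (\<lambda>k. \<sigma> k \<omega>) \<longlonglongrightarrow> f \<omega>"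
    using ev by (intro AE_I2 tendsto_eventually) auto
  show "AE \<omega> in M. norm (\<sigma> k \<omega>) \<le> b" for k
    using bound by (intro AE_I2) simp
qed (use meas f in auto)

lemma eventually_localized:
  assumes "incseq (\<lambda>k. {\<omega> \<in> S. \<tau> k \<omega> = c})" "(\<Union>k. {\<omega> \<in> S. \<tau> k \<omega> = c}) = S" "\<omega> \<in> S"
  shows "\<forall>\<^sub>F k in sequentially. \<tau> k \<omega> = c"
proof -
  obtain k0 where "\<tau> k0 \<omega> = c"
    using assms(2,3) by blast
  then have "\<tau> k \<omega> = c" if "k0 \<le> k" for k
    using incseqD[OF assms(1) that] assms(3) by auto
  then show ?thesis
    by (auto simp: eventually_sequentially)
qed

context levy_process
begin

abbreviation PT :: "'a measure" where
  "PT \<equiv> restr_to_subalg M (F T)"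

lemma cap_T [simp]: "cap T (ennreal T) = T"
  using T_pos by (simp add: cap_ennreal)

lemma sets_PT: "sets PT = sets (F T)"
  by (rule sets_restr_to_subalg[OF subalgebra])

lemma prob_space_PT: "prob_space PT"
  by (rule prob_space_restr_to_subalg[OF subalgebra prob_space_axioms])

lemma measurable_PT: "f \<in> borel_measurable (F T) \<Longrightarrow> f \<in> borel_measurable PT"
  by (rule measurable_in_subalg[OF subalgebra])

lemma measurable_localizing:
  assumes "stopping_time (\<lambda>t. F (cap T t)) \<tau>"
  shows "\<tau> \<in> borel_measurable (F T)"
proof (rule measurable_stopping_time[OF assms])
  have c: "cap T t \<in> {0..T}" for t
    using cap_in[of T] T_pos by simp
  show "sets (F (cap T t)) \<subseteq> sets (F T)" for t
    using sets_F_mono[OF c] c[of t] T_pos by simp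
  show "space (F (cap T t)) = space (F T)" for t
    using space_F[OF c] T_pos by simp
qed

lemma measurable_L_stopped: "real_stopping_time \<sigma> \<Longrightarrow> (\<lambda>\<omega>. L (\<sigma> \<omega>) \<omega>) \<in> borel_measurable (F T)"
  by (rule measurable_stopped[OF _ adapted right_continuous])

lemma measurable_real_stopping_time: "real_stopping_time \<sigma> \<Longrightarrow> \<sigma> \<in> borel_measurable (F T)"
  using measurable_stopped[where Y="\<lambda>t \<omega>. t" and \<sigma>=\<sigma>] by simp

text \<open>On \<open>B\<close> the stopped exponential martingale is the Esscher density, so the extra factor
  \<open>exp s\<close> on \<open>B\<close> costs \<open>(exp s - 1)\<close> times the Esscher mass of \<open>B\<close>.\<close>
lemma exponential_stopped_tilted_le:
  assumes fin: "mgf \<kappa> T < \<infinity>" and \<sigma>: "real_stopping_time \<sigma>" and B: "B \<in> sets (F T)" and BT: "\<And>\<omega>. \<omega> \<in> B \<Longrightarrow> \<sigma> \<omega> = T"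
    and s: "0 \<le> s"
  shows "(\<integral>\<^sup>+\<omega>. ennreal (exp (\<kappa> * L (\<sigma> \<omega>) \<omega> - cgf \<kappa> * \<sigma> \<omega> / T + s * indicator B \<omega>)) \<partial>PT)
    \<le> ennreal (1 + (exp s - 1) * measure (esscher_measure M T F L \<kappa>) B)"
proof -
  let ?Q = "esscher_measure M T F L \<kappa>"
  let ?Z = "\<lambda>\<omega>. exp (\<kappa> * L (\<sigma> \<omega>) \<omega> - cgf \<kappa> * \<sigma> \<omega> / T)"
  interpret Q: prob_space ?Q
    by (rule prob_space_esscher[OF fin])
  note [measurable] = measurable_L_stopped[OF \<sigma>] measurable_real_stopping_time[OF \<sigma>] B
  have mZ: "?Z \<in> borel_measurable (F T)"
    by measurable
  have BM: "B \<in> events"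
    using B sets_F_le[of T] T_pos by auto
  have mZM: "?Z \<in> borel_measurable M"
    by (rule measurable_from_subalg[OF subalgebra mZ])
  have "(\<integral>\<^sup>+\<omega>. ennreal (exp (\<kappa> * L (\<sigma> \<omega>) \<omega> - cgf \<kappa> * \<sigma> \<omega> / T + s * indicator B \<omega>)) \<partial>PT)
      = (\<integral>\<^sup>+\<omega>. ennreal (?Z \<omega> * exp (s * indicator B \<omega>)) \<partial>M)"
    unfolding exp_add by (intro nn_integral_subalgebra2[OF subalgebra]) measurable
  also have "\<dots> = (\<integral>\<^sup>+\<omega>. ennreal (?Z \<omega>) + ennreal (exp s - 1) * (ennreal (exp (\<kappa> * L T \<omega> - cgf \<kappa>)) * indicator B \<omega>) \<partial>M)"
  proof (intro nn_integral_cong)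
    fix \<omega>
    show "ennreal (?Z \<omega> * exp (s * indicator B \<omega>))
      = ennreal (?Z \<omega>) + ennreal (exp s - 1) * (ennreal (exp (\<kappa> * L T \<omega> - cgf \<kappa>)) * indicator B \<omega>)"
    proof (cases "\<omega> \<in> B")
      case True
      then have "?Z \<omega> = exp (\<kappa> * L T \<omega> - cgf \<kappa>)"
        using BT[OF True] T_pos by simp
      moreover have "ennreal (z * exp s) = ennreal z + ennreal (exp s - 1) * ennreal z" if z: "0 \<le> z" for z
      proof -
        have "z * exp s = z + (exp s - 1) * z"
          by (simp add: algebra_simps)
        also have "ennreal \<dots> = ennreal z + ennreal ((exp s - 1) * z)"
          using s z by (intro ennreal_plus) auto
        finally show ?thesis
          using s z by (simp add: ennreal_mult)
      qed
      ultimately show ?thesis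
        using True by simp
    qed simp
  qed
  also have "\<dots> = (\<integral>\<^sup>+\<omega>. ennreal (?Z \<omega>) \<partial>M)
      + (\<integral>\<^sup>+\<omega>. ennreal (exp s - 1) * (ennreal (exp (\<kappa> * L T \<omega> - cgf \<kappa>)) * indicator B \<omega>) \<partial>M)"
    using mZM BM by (intro nn_integral_add) auto
  also have "(\<integral>\<^sup>+\<omega>. ennreal (exp s - 1) * (ennreal (exp (\<kappa> * L T \<omega> - cgf \<kappa>)) * indicator B \<omega>) \<partial>M)
      = ennreal (exp s - 1) * (\<integral>\<^sup>+\<omega>. ennreal (exp (\<kappa> * L T \<omega> - cgf \<kappa>)) * indicator B \<omega> \<partial>M)"
    using BM by (intro nn_integral_cmult) auto
  also have "(\<integral>\<^sup>+\<omega>. ennreal (exp (\<kappa> * L T \<omega> - cgf \<kappa>)) * indicator B \<omega> \<partial>M) = emeasure ?Q B"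
    using nn_integral_esscher[OF fin, of "indicator B"] B by simp
  also have "(\<integral>\<^sup>+\<omega>. ennreal (?Z \<omega>) \<partial>M) + ennreal (exp s - 1) * emeasure ?Q B
      \<le> 1 + ennreal (exp s - 1) * emeasure ?Q B"
    by (intro add_right_mono exponential_stopped_le fin \<sigma>)
  also have "\<dots> = ennreal (1 + (exp s - 1) * measure ?Q B)"
    using s by (simp add: Q.emeasure_eq_measure ennreal_mult[symmetric] ennreal_plus[symmetric] del: ennreal_plus flip: ennreal_1)
  finally show ?thesis .
qed

text \<open>The Donsker-Varadhan bound is tested against the logarithm of the exponential martingale at the
  localizing time, plus \<open>s\<close> on the part of \<open>A\<close> where that time is \<open>T\<close>. Because \<open>L\<close> at
  the localizing time has \<open>Q\<close>-mean zero, its contribution disappears, and in the limit the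
  localizing times become \<open>T\<close>. The parameter \<open>s\<close> keeps track of how much \<open>Q\<close> may differ
  from the Esscher measure on \<open>A\<close>.\<close>
lemma entropy_lower_bound:
  assumes fin: "mgf \<kappa> T < \<infinity>" and Q: "Q \<in> M_loc_a M T F L" and A: "A \<in> sets (F T)" and s: "0 \<le> s"
  shows "ereal (s * measure Q A - cgf \<kappa> - ln (1 + (exp s - 1) * measure (esscher_measure M T F L \<kappa>) A))
    \<le> rel_entropy Q PT"
proof -
  let ?E = "esscher_measure M T F L \<kappa>"
  interpret E: prob_space ?E
    by (rule prob_space_esscher[OF fin])
  have pQ: "prob_space Q" and sQ: "sets Q = sets (F T)" and ac: "absolutely_continuous PT Q"
    using Q unfolding M_loc_a_def by simp_all
  obtain \<tau> :: "nat \<Rightarrow> 'a \<Rightarrow> ennreal"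
    where \<tau>': "\<forall>k. stopping_time (\<lambda>t. F (cap T t)) (\<tau> k)"
    and inc: "incseq (\<lambda>k. {\<omega> \<in> space M. \<tau> k \<omega> = ennreal T})"
    and un: "(\<Union>k. {\<omega> \<in> space M. \<tau> k \<omega> = ennreal T}) = space M"
    and centred: "\<forall>k. integrable Q (\<lambda>\<omega>. L (cap T (\<tau> k \<omega>)) \<omega>) \<and>
      (\<integral>\<omega>. L (cap T (\<tau> k \<omega>)) \<omega> \<partial>Q) = 0"
    using Q unfolding M_loc_a_def by (elim CollectE conjE exE) (rule that)
  have \<tau>: "stopping_time (\<lambda>t. F (cap T t)) (\<tau> k)" for k
    using \<tau>' by blast
  have int: "integrable Q (\<lambda>\<omega>. L (cap T (\<tau> k \<omega>)) \<omega>)"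
    and zero: "(\<integral>\<omega>. L (cap T (\<tau> k \<omega>)) \<omega> \<partial>Q) = 0" for k
    using centred by blast+
  interpret Q: prob_space Q by fact
  have spQ: "space Q = space M"
    using sets_eq_imp_space_eq[OF sQ] T_pos by simp
  define \<sigma> where "\<sigma> = (\<lambda>k \<omega>. cap T (\<tau> k \<omega>))"
  define B where "B = (\<lambda>k. A \<inter> {\<omega> \<in> space M. \<tau> k \<omega> = ennreal T})"
  have intL: "integrable Q (\<lambda>\<omega>. L (\<sigma> k \<omega>) \<omega>)" and zeroL: "(\<integral>\<omega>. L (\<sigma> k \<omega>) \<omega> \<partial>Q) = 0" for k
    unfolding \<sigma>_def by (rule int zero)+
  have \<sigma>: "real_stopping_time (\<sigma> k)" for k
    unfolding \<sigma>_def by (rule real_stopping_time_cap[OF \<tau>])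
  have \<sigma>b: "\<bar>\<sigma> k \<omega>\<bar> \<le> T" for k \<omega>
    using cap_in[of T "\<tau> k \<omega>"] T_pos by (simp add: \<sigma>_def)
  have AM: "\<omega> \<in> A \<Longrightarrow> \<omega> \<in> space M" for \<omega>
    using sets.sets_into_space[OF A] T_pos by auto
  have B: "B k \<in> sets (F T)" for k
  proof -
    have "{\<omega> \<in> space (F T). \<tau> k \<omega> = ennreal T} \<in> sets (F T)"
      using measurable_localizing[OF \<tau>[of k]] by simp
    then show ?thesis
      using A T_pos by (auto simp: B_def)
  qed
  have BT: "\<sigma> k \<omega> = T" if "\<omega> \<in> B k" for k \<omega>
    using that by (simp add: B_def \<sigma>_def)
  have mQ: "f \<in> borel_measurable (F T) \<Longrightarrow> f \<in> borel_measurable Q" for f :: "'a \<Rightarrow> real"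
    by (simp add: measurable_cong_sets[OF sQ refl])
  have int\<sigma>: "integrable Q (\<sigma> k)" for k
    using \<sigma>b mQ[OF measurable_real_stopping_time[OF \<sigma>]]
    by (intro Q.integrable_const_bound[where B=T]) auto
  have BQ: "B k \<in> sets Q" "A \<in> sets Q" for k
    using B A sQ by auto
  have intB: "integrable Q (indicator (B k) :: 'a \<Rightarrow> real)" for k
    using BQ by (simp add: Q.emeasure_eq_measure)
  let ?p = "measure ?E A"
  let ?C = "1 + (exp s - 1) * ?p"
  have C: "0 < ?C"
    using s by (simp add: add_pos_nonneg)
  let ?g = "\<lambda>k \<omega>. \<kappa> * L (\<sigma> k \<omega>) \<omega> - cgf \<kappa> * \<sigma> k \<omega> / T + s * indicator (B k) \<omega>"
  have intg: "integrable Q (?g k)" for k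
    using intL[of k] int\<sigma>[of k] intB[of k]
    by (intro Bochner_Integration.integrable_add Bochner_Integration.integrable_diff integrable_mult_right integrable_divide) auto
  have Eg: "(\<integral>\<omega>. ?g k \<omega> \<partial>Q) = s * (\<integral>\<omega>. indicator (B k) \<omega> \<partial>Q) - cgf \<kappa> * (\<integral>\<omega>. \<sigma> k \<omega> \<partial>Q) / T" for k
    using intL[of k] int\<sigma>[of k] intB[of k] zeroL[of k]
    by (simp del: integral_indicator)
  have step: "ereal (s * (\<integral>\<omega>. indicator (B k) \<omega> \<partial>Q) - cgf \<kappa> * (\<integral>\<omega>. \<sigma> k \<omega> \<partial>Q) / T - ln ?C) \<le> rel_entropy Q PT" for k
    unfolding Eg[symmetric]
  proof (rule donsker_varadhan[OF prob_space_PT pQ _ ac intg _ C])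
    show "sets Q = sets PT"
      by (simp add: sQ sets_PT)
    have "measure ?E (B k) \<le> ?p"
      using A by (intro E.finite_measure_mono) (auto simp: B_def)
    then have "1 + (exp s - 1) * measure ?E (B k) \<le> ?C"
      using s by (simp add: mult_left_mono)
    then show "(\<integral>\<^sup>+\<omega>. ennreal (exp (?g k \<omega>)) \<partial>PT) \<le> ennreal ?C"
      using exponential_stopped_tilted_le[OF fin \<sigma> B BT s, of k]
      by (meson ennreal_leI order_trans)
  qed
  have "(\<lambda>k. \<integral>\<omega>. \<sigma> k \<omega> \<partial>Q) \<longlonglongrightarrow> (\<integral>\<omega>. T \<partial>Q)"
  proof (rule Q.expectation_eventually_const)
    show "\<forall>\<^sub>F k in sequentially. \<sigma> k \<omega> = T" if "\<omega> \<in> space Q" for \<omega>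
      using eventually_localized[OF inc un, of \<omega>] that spQ by (auto elim!: eventually_mono simp: \<sigma>_def)
  qed (use \<sigma>b mQ[OF measurable_real_stopping_time[OF \<sigma>]] in auto)
  moreover have "(\<lambda>k. \<integral>\<omega>. indicator (B k) \<omega> \<partial>Q) \<longlonglongrightarrow> (\<integral>\<omega>. indicator A \<omega> \<partial>Q :: real)"
  proof (rule Q.expectation_eventually_const)
    show "\<forall>\<^sub>F k in sequentially. indicator (B k) \<omega> = (indicator A \<omega> :: real)" if "\<omega> \<in> space Q" for \<omega>
      using eventually_localized[OF inc un, of \<omega>] that spQ
      by (auto elim!: eventually_mono simp: B_def indicator_def)
    show "\<bar>indicator (B k) \<omega> :: real\<bar> \<le> 1" for k \<omega>
      by (simp split: split_indicator)
  qed (use BQ in auto)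
  ultimately have "(\<lambda>k. s * (\<integral>\<omega>. indicator (B k) \<omega> \<partial>Q) - cgf \<kappa> * (\<integral>\<omega>. \<sigma> k \<omega> \<partial>Q) / T - ln ?C)
      \<longlonglongrightarrow> s * (\<integral>\<omega>. indicator A \<omega> \<partial>Q) - cgf \<kappa> * (\<integral>\<omega>. T \<partial>Q) / T - ln ?C"
    using T_pos by (intro tendsto_intros) auto
  also have "s * (\<integral>\<omega>. indicator A \<omega> \<partial>Q) - cgf \<kappa> * (\<integral>\<omega>. T \<partial>Q) / T - ln ?C
      = s * measure Q A - cgf \<kappa> - ln ?C"
    using T_pos BQ Q.prob_space by simp
  finally have "(\<lambda>k. ereal (s * (\<integral>\<omega>. indicator (B k) \<omega> \<partial>Q) - cgf \<kappa> * (\<integral>\<omega>. \<sigma> k \<omega> \<partial>Q) / T - ln ?C))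
      \<longlonglongrightarrow> ereal (s * measure Q A - cgf \<kappa> - ln ?C)"
    by (rule tendsto_ereal)
  then show ?thesis
    by (rule LIMSEQ_le_const2) (intro exI allI impI step)
qed

lemma entropy_ge:
  assumes fin: "mgf \<kappa> T < \<infinity>" and Q: "Q \<in> M_loc_a M T F L"
  shows "ereal (- cgf \<kappa>) \<le> rel_entropy Q PT"
  using entropy_lower_bound[OF fin Q, of "{}" 0] by simp

text \<open>If the lower bound is attained, then \<open>s Q(A) \<le> ln (1 + (exp s - 1) E(A))\<close> for all
  \<open>s > 0\<close>, where \<open>E\<close> is the Esscher measure. For small \<open>s\<close> this says \<open>Q(A) \<le> E(A)\<close>; for
  probability measures, the same at the complement of \<open>A\<close> gives equality.\<close>
lemma entropy_rigidity:
  assumes fin: "mgf \<kappa> T < \<infinity>" and Q: "Q \<in> M_loc_a M T F L"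
    and le: "rel_entropy Q PT \<le> ereal (- cgf \<kappa>)"
  shows "Q = esscher_measure M T F L \<kappa>"
proof -
  let ?E = "esscher_measure M T F L \<kappa>"
  interpret E: prob_space ?E
    by (rule prob_space_esscher[OF fin])
  have pQ: "prob_space Q" and sQ: "sets Q = sets (F T)"
    using Q unfolding M_loc_a_def by auto
  interpret Q: prob_space Q by fact
  have dominated: "measure Q A \<le> measure ?E A" if A: "A \<in> sets (F T)" for A
  proof (rule field_le_epsilon)
    fix e :: real assume e: "0 < e"
    let ?p = "measure ?E A"
    \<comment> \<open>At most \<open>1 / 2\<close> for the quadratic bound on \<open>exp\<close>, at most \<open>e / 2\<close> for its error term.\<close>
    define s where "s = min (1 / 2) (e / 2)"
    have s: "0 < s" "s \<le> 1 / 2" "2 * s \<le> e"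
      using e by (auto simp: s_def)
    have "s * measure Q A \<le> ln (1 + (exp s - 1) * ?p)"
      using entropy_lower_bound[OF fin Q A, of s] le s(1) by (auto dest: order_trans)
    also have "\<dots> \<le> (exp s - 1) * ?p"
      using s(1) by (intro ln_add_one_self_le_self) simp
    also have "\<dots> \<le> (s + 2 * s\<^sup>2) * ?p"
      using exp_upper_quadratic[of s] s by (intro mult_right_mono) auto
    also have "\<dots> = s * (?p + 2 * s * ?p)"
      by (simp add: power2_eq_square algebra_simps)
    finally have "measure Q A \<le> ?p + 2 * s * ?p"
      using s(1) by simp
    also have "2 * s * ?p \<le> 2 * s * 1"
      using s(1) by (intro mult_left_mono) auto
    finally show "measure Q A \<le> ?p + e"
      using s(3) by simp
  qed
  show ?thesis
  proof (rule measure_eqI)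
    show "sets Q = sets ?E"
      by (simp add: sQ)
    fix A assume "A \<in> sets Q"
    then have A: "A \<in> sets (F T)"
      by (simp add: sQ)
    have sp: "space Q = space (F T)"
      by (rule sets_eq_imp_space_eq[OF sQ])
    have "measure Q (space Q - A) \<le> measure ?E (space Q - A)"
      unfolding sp using A by (intro dominated) auto
    moreover have "measure Q (space Q - A) = 1 - measure Q A"
      using A sQ by (intro Q.prob_compl) auto
    moreover have "measure ?E (space Q - A) = 1 - measure ?E A"
      using A E.prob_compl[of A] sp T_pos by simp
    ultimately have "measure Q A = measure ?E A"
      using dominated[OF A] by simp
    then show "emeasure Q A = emeasure ?E A"
      by (simp add: Q.emeasure_eq_measure E.emeasure_eq_measure)
  qed
qed

lemma in_M_loc_a_of_centred:
  assumes "prob_space Q" "sets Q = sets (F T)" "absolutely_continuous PT Q"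
    and "integrable Q (L T)" "(\<integral>\<omega>. L T \<omega> \<partial>Q) = 0"
  shows "Q \<in> M_loc_a M T F L"
  unfolding M_loc_a_def using assms
  by (intro CollectI conjI exI[of _ "\<lambda>_ _. ennreal T"]) (auto simp: stopping_time_const incseq_def)

lemma esscher_centred:
  assumes fin: "mgf \<kappa> T < \<infinity>"
    and int: "integrable (esscher_measure M T F L \<kappa>) (L T)"
    and zero: "(\<integral>\<omega>. L T \<omega> \<partial>esscher_measure M T F L \<kappa>) = 0"
  shows "esscher_measure M T F L \<kappa> \<in> M_loc_a M T F L"
    and "rel_entropy (esscher_measure M T F L \<kappa>) PT = ereal (- cgf \<kappa>)"
proof -
  let ?E = "esscher_measure M T F L \<kappa>"
  interpret E: prob_space ?E
    by (rule prob_space_esscher[OF fin])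
  show "?E \<in> M_loc_a M T F L"
    by (intro in_M_loc_a_of_centred prob_space_esscher fin sets_esscher absolutely_continuous_esscher int zero)
  let ?d = "\<lambda>\<omega>. exp (\<kappa> * L T \<omega> - cgf \<kappa>)"
  have LT [measurable]: "L T \<in> borel_measurable PT"
    using adapted[of T] T_pos by (intro measurable_PT) simp
  have intd: "integrable PT (\<lambda>\<omega>. ?d \<omega> * f \<omega>)" "(\<integral>\<omega>. ?d \<omega> * f \<omega> \<partial>PT) = (\<integral>\<omega>. f \<omega> \<partial>?E)"
    if f: "integrable ?E f" "f \<in> borel_measurable PT" for f :: "'a \<Rightarrow> real"
  proof -
    have d: "?d \<in> borel_measurable PT" "AE \<omega> in PT. 0 \<le> ?d \<omega>"
      by auto
    show "integrable PT (\<lambda>\<omega>. ?d \<omega> * f \<omega>)"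
      using f(1) unfolding esscher_measure_eq[OF fin] integrable_density[OF f(2) d] by simp
    show "(\<integral>\<omega>. ?d \<omega> * f \<omega> \<partial>PT) = (\<integral>\<omega>. f \<omega> \<partial>?E)"
      unfolding esscher_measure_eq[OF fin] integral_density[OF f(2) d] by simp
  qed
  have i1: "integrable PT (\<lambda>\<omega>. ?d \<omega> * 1)" "(\<integral>\<omega>. ?d \<omega> * 1 \<partial>PT) = 1"
    using intd[of "\<lambda>_. 1"] E.prob_space by auto
  have iL: "integrable PT (\<lambda>\<omega>. ?d \<omega> * L T \<omega>)" "(\<integral>\<omega>. ?d \<omega> * L T \<omega> \<partial>PT) = 0"
    using intd[OF int LT] zero by auto
  have dln: "?d \<omega> * ln (?d \<omega>) = \<kappa> * (?d \<omega> * L T \<omega>) - cgf \<kappa> * (?d \<omega> * 1)" for \<omega>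
    by (simp add: algebra_simps)
  have "rel_entropy ?E PT = ereal (\<integral>\<omega>. ?d \<omega> * ln (?d \<omega>) \<partial>PT)"
    unfolding esscher_measure_eq[OF fin]
  proof (intro rel_entropy_density prob_space_PT)
    show "integrable PT (\<lambda>\<omega>. ?d \<omega> * ln (?d \<omega>))"
      unfolding dln by (intro Bochner_Integration.integrable_diff integrable_mult_right i1 iL)
  qed auto
  also have "(\<integral>\<omega>. ?d \<omega> * ln (?d \<omega>) \<partial>PT) = - cgf \<kappa>"
    unfolding dln
    by (subst Bochner_Integration.integral_diff) (use i1 iL in auto)
  finally show "rel_entropy ?E PT = ereal (- cgf \<kappa>)" .
qed

lemma expectation_0_of_martingale:
  assumes fin: "mgf \<kappa> T < \<infinity>" and mart: "martingale (esscher_measure M T F L \<kappa>) T F L"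
  shows "integrable (esscher_measure M T F L \<kappa>) (L T)" "(\<integral>\<omega>. L T \<omega> \<partial>esscher_measure M T F L \<kappa>) = 0"
proof -
  let ?E = "esscher_measure M T F L \<kappa>"
  interpret E: levy_process ?E T F L
    by (rule levy_process_esscher[OF fin])
  show int: "integrable ?E (L T)"
    using mart T_pos by (auto simp: martingale_def)
  have z: "0 \<in> {0..T}"
    using T_pos by simp
  interpret sigma_finite_subalgebra ?E "F 0"
    using E.subalgebra_t[OF z] by (intro finite_measure_subalgebra_is_sigma_finite
      finite_measure_subalgebra.intro E.finite_measure_axioms finite_measure_subalgebra_axioms.intro)
  have "AE \<omega> in ?E. real_cond_exp ?E (F 0) (L T) \<omega> = L 0 \<omega>"
    using mart T_pos by (auto simp: martingale_def)
  then have "AE \<omega> in ?E. real_cond_exp ?E (F 0) (L T) \<omega> = 0"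
    using AE_space by eventually_elim (simp add: starts_at_0)
  then have "(\<integral>\<omega>. real_cond_exp ?E (F 0) (L T) \<omega> \<partial>?E) = (\<integral>\<omega>. 0 \<partial>?E)"
    by (intro integral_cong_AE) auto
  then show "(\<integral>\<omega>. L T \<omega> \<partial>?E) = 0"
    using real_cond_exp_int(2)[OF int] by simp
qed

text \<open>A centred Esscher measure attains the lower bound, and rigidity excludes every other minimiser.\<close>
lemma is_MEMM_of_is_EMM:
  assumes "is_EMM M T F L P"
  shows "is_MEMM M T F (M_loc_a M T F L) P" "is_MEMM M T F (M_loc_a M T F L) P' \<Longrightarrow> P' = P"
proof -
  obtain \<kappa> where fin: "mgf \<kappa> T < \<infinity>" and P: "P = esscher_measure M T F L \<kappa>" and mart: "martingale P T F L"
    using assms unfolding is_EMM_def phi_def by blast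
  note ec = esscher_centred[OF fin expectation_0_of_martingale[OF fin mart[unfolded P]], folded P]
  have inf: "(INF Q'\<in>M_loc_a M T F L. rel_entropy Q' PT) = ereal (- cgf \<kappa>)"
    using ec entropy_ge[OF fin] by (intro antisym INF_greatest INF_lower2[of P]) auto
  show "is_MEMM M T F (M_loc_a M T F L) P"
    unfolding is_MEMM_def using ec inf by simp
  assume "is_MEMM M T F (M_loc_a M T F L) P'"
  then show "P' = P"
    unfolding P is_MEMM_def inf by (intro entropy_rigidity fin) auto
qed

section \<open>From a minimiser to a centred Esscher measure\<close>

text \<open>Members of the class whose entropies approach the infimum. A measure under which \<open>L T\<close> is
  centred belongs to the class with the constant localizing time \<open>T\<close>, so \<open>L\<close> itself need not
  be a martingale under it.\<close>
lemma truncated_tilt: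
  assumes centred: "(\<integral>\<omega>. L T \<omega> * (exp (u * L T \<omega>) * indicator {\<omega>\<in>space PT. \<bar>L T \<omega>\<bar> \<le> real n} \<omega>) \<partial>PT) = 0"
    and pos: "0 < (\<integral>\<omega>. exp (u * L T \<omega>) * indicator {\<omega>\<in>space PT. \<bar>L T \<omega>\<bar> \<le> real n} \<omega> \<partial>PT)"
  shows "\<exists>Q\<in>M_loc_a M T F L. rel_entropy Q PT = ereal (- ln (\<integral>\<omega>. exp (u * L T \<omega>) * indicator {\<omega>\<in>space PT. \<bar>L T \<omega>\<bar> \<le> real n} \<omega> \<partial>PT))"
proof -
  interpret PT: prob_space PT
    by (rule prob_space_PT)
  have LT [measurable]: "L T \<in> borel_measurable PT"
    using adapted[of T] T_pos by (intro measurable_PT) simp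
  let ?B = "{\<omega>\<in>space PT. \<bar>L T \<omega>\<bar> \<le> real n}"
  let ?c = "\<integral>\<omega>. exp (u * L T \<omega>) * indicator {\<omega>\<in>space PT. \<bar>L T \<omega>\<bar> \<le> real n} \<omega> \<partial>PT"
  define Q where "Q = density PT (\<lambda>\<omega>. ennreal (exp (u * L T \<omega>) * indicator {\<omega>\<in>space PT. \<bar>L T \<omega>\<bar> \<le> real n} \<omega> / ?c))"
  have bound: "exp (u * L T \<omega>) \<le> exp (\<bar>u\<bar> * real n)" if "\<bar>L T \<omega>\<bar> \<le> real n" for \<omega>
  proof -
    have "u * L T \<omega> \<le> \<bar>u\<bar> * \<bar>L T \<omega>\<bar>"
      by (metis abs_ge_self abs_mult)
    also have "\<dots> \<le> \<bar>u\<bar> * real n"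
      using that by (intro mult_left_mono) auto
    finally show ?thesis by simp
  qed
  have int: "integrable PT (\<lambda>\<omega>. exp (u * L T \<omega>) * indicator {\<omega>\<in>space PT. \<bar>L T \<omega>\<bar> \<le> real n} \<omega>)"
    using bound
    by (intro PT.integrable_const_bound[where B="exp (\<bar>u\<bar> * real n)"]) (auto simp: indicator_def)
  have intX: "integrable PT (\<lambda>\<omega>. L T \<omega> * (exp (u * L T \<omega>) * indicator {\<omega>\<in>space PT. \<bar>L T \<omega>\<bar> \<le> real n} \<omega>))"
  proof (rule Bochner_Integration.integrable_bound)
    show "integrable PT (\<lambda>\<omega>. real n * (exp (u * L T \<omega>) * indicator {\<omega>\<in>space PT. \<bar>L T \<omega>\<bar> \<le> real n} \<omega>))"
      using int by simp
  qed (auto simp: indicator_def abs_mult)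
  have B: "?B \<in> sets PT"
    by measurable
  note tilt = exponential_tilt[OF prob_space_PT LT B int refl pos intX centred, folded Q_def]
  have "Q \<in> M_loc_a M T F L"
  proof (rule in_M_loc_a_of_centred[OF tilt(1) _ _ tilt(2,3)])
    show "sets Q = sets (F T)"
      by (simp add: Q_def sets_PT)
    show "absolutely_continuous PT Q"
      unfolding Q_def by (intro absolutely_continuousI_density) measurable
  qed
  then show ?thesis
    using tilt(4) by blast
qed

text \<open>A minimiser \<open>Q\<close> has at most the entropy \<open>- ln (g n u)\<close> of each centred truncation. Letting
  \<open>n\<close> grow bounds its entropy by \<open>- cgf \<kappa>\<close>, so rigidity identifies \<open>Q\<close>. Then \<open>Q\<close> has
  entropy at most \<open>- cgf \<kappa>\<close> and, being in the class, at least \<open>- cgf u\<close> for every admissible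
  \<open>u\<close>, so \<open>\<kappa>\<close> minimises \<open>mgf\<close>.\<close>
lemma esscher_of_is_MEMM:
  assumes MEMM: "is_MEMM M T F (M_loc_a M T F L) Q"
    and pos: "0 < prob {\<omega>\<in>space M. 0 < L T \<omega>}" "0 < prob {\<omega>\<in>space M. L T \<omega> < 0}"
  shows "\<exists>\<kappa>. mgf \<kappa> T < \<infinity> \<and> Q = esscher_measure M T F L \<kappa> \<and> (\<forall>u. mgf \<kappa> T \<le> mgf u T)"
proof -
  interpret PT: prob_space PT
    by (rule prob_space_PT)
  have LTF [measurable]: "L T \<in> borel_measurable (F T)"
    using adapted[of T] T_pos by simp
  have LT [measurable]: "L T \<in> borel_measurable PT"
    by (rule measurable_PT[OF LTF])
  have spF: "space PT = space M" "space (F T) = space M"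
    using T_pos by (simp_all add: space_restr_to_subalg)
  have QC: "Q \<in> M_loc_a M T F L" and inf: "rel_entropy Q PT = (INF Q'\<in>M_loc_a M T F L. rel_entropy Q' PT)"
    using MEMM by (auto simp: is_MEMM_def)
  have ac: "absolutely_continuous PT Q"
    using QC by (simp add: M_loc_a_def)
  define I where "I = (\<lambda>n \<omega>. indicator {\<omega>\<in>space PT. \<bar>L T \<omega>\<bar> \<le> real n} \<omega> :: real)"
  define g where "g = (\<lambda>n u. \<integral>\<omega>. exp (u * L T \<omega>) * I n \<omega> \<partial>PT)"
  have posPT: "0 < PT.prob {\<omega>\<in>space PT. 0 < L T \<omega>}" "0 < PT.prob {\<omega>\<in>space PT. L T \<omega> < 0}"
  proof -
    have "{\<omega>\<in>space (F T). 0 < L T \<omega>} \<in> sets (F T)" "{\<omega>\<in>space (F T). L T \<omega> < 0} \<in> sets (F T)"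
      by measurable
    then show "0 < PT.prob {\<omega>\<in>space PT. 0 < L T \<omega>}" "0 < PT.prob {\<omega>\<in>space PT. L T \<omega> < 0}"
      using pos unfolding spF by (simp_all add: measure_def emeasure_restr_to_subalg[OF subalgebra])
  qed
  obtain \<kappa> where \<kappa>: "\<And>C. (\<And>n u. (\<integral>\<omega>. L T \<omega> * (exp (u * L T \<omega>) * I n \<omega>) \<partial>PT) = 0 \<Longrightarrow> ennreal (g n u) \<le> C) \<Longrightarrow>
      (\<integral>\<^sup>+\<omega>. ennreal (exp (\<kappa> * L T \<omega>)) \<partial>PT) \<le> C"
    using PT.mgf_minimiser_of_centred_truncations[OF LT posPT] unfolding I_def g_def by blast
  have mgf_PT: "(\<integral>\<^sup>+\<omega>. ennreal (exp (\<kappa> * L T \<omega>)) \<partial>PT) = mgf \<kappa> T"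
    by (intro nn_integral_subalgebra2[OF subalgebra]) measurable
  have mpos: "0 < mgf \<kappa> T"
    using T_pos by (intro mgf_pos) auto
  have le: "rel_entropy Q PT \<le> ereal (- ln (g n u))"
    if "(\<integral>\<omega>. L T \<omega> * (exp (u * L T \<omega>) * I n \<omega>) \<partial>PT) = 0" "0 < g n u" for n u
    using truncated_tilt[OF that[unfolded I_def g_def]] unfolding inf g_def I_def
    by (auto intro: INF_lower2)
  have "\<exists>y. rel_entropy Q PT = ereal y"
  proof (rule ccontr)
    assume "\<not> ?thesis"
    then have top: "rel_entropy Q PT = \<infinity>"
      using rel_entropy_eq[OF prob_space_PT ac] by metis
    have "mgf \<kappa> T \<le> 0"
      unfolding mgf_PT[symmetric]
    proof (rule \<kappa>)
      fix n u assume "(\<integral>\<omega>. L T \<omega> * (exp (u * L T \<omega>) * I n \<omega>) \<partial>PT) = 0"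
      then have "\<not> 0 < g n u"
        using le[of u n] top by auto
      then show "ennreal (g n u) \<le> 0"
        by (simp add: ennreal_neg)
    qed
    then show False
      using mpos by simp
  qed
  then obtain y where y: "rel_entropy Q PT = ereal y"
    by blast
  have mle: "mgf \<kappa> T \<le> ennreal (exp (- y))"
    unfolding mgf_PT[symmetric]
  proof (rule \<kappa>)
    fix n u assume a: "(\<integral>\<omega>. L T \<omega> * (exp (u * L T \<omega>) * I n \<omega>) \<partial>PT) = 0"
    show "ennreal (g n u) \<le> ennreal (exp (- y))"
    proof (cases "0 < g n u")
      case True
      then have "ln (g n u) \<le> - y"
        using le[OF a True] y by simp
      then have "g n u \<le> exp (- y)"
        using True by (metis exp_le_cancel_iff exp_ln)
      then show ?thesis
        by (rule ennreal_leI)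
    qed (simp add: ennreal_neg)
  qed
  then have fin: "mgf \<kappa> T < \<infinity>"
    by (auto intro: le_less_trans)
  have "ennreal (exp (cgf \<kappa>)) \<le> ennreal (exp (- y))"
    using mle exp_cgf[OF fin] by simp
  then have cy: "y \<le> - cgf \<kappa>"
    by (simp add: ennreal_le_iff)
  have "Q = esscher_measure M T F L \<kappa>"
    using cy y by (intro entropy_rigidity[OF fin QC]) simp
  moreover have "mgf \<kappa> T \<le> mgf u T" for u
  proof (cases "mgf u T < \<infinity>")
    case True
    have "cgf \<kappa> \<le> cgf u"
      using entropy_ge[OF True QC] cy y by simp
    then have "ennreal (exp (cgf \<kappa>)) \<le> ennreal (exp (cgf u))"
      by (intro ennreal_leI) simp
    then show ?thesis
      using exp_cgf[OF fin] exp_cgf[OF True] by simp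
  qed (auto simp: not_less top_unique)
  ultimately show ?thesis
    using fin by blast
qed

text \<open>Under the Esscher measure the moment generating function of \<open>L T\<close> is minimal at \<open>0\<close>.
  Finiteness at a second exponent gives one-sided exponential moments, and minimality then controls
  the other tail.\<close>
lemma integrable_esscher_of_minimal:
  assumes fin: "mgf \<kappa> T < \<infinity>" and min: "\<And>u. mgf \<kappa> T \<le> mgf u T"
    and fin': "mgf \<kappa>' T < \<infinity>" and ne: "\<kappa>' \<noteq> \<kappa>"
  shows "integrable (esscher_measure M T F L \<kappa>) (L T)"
proof -
  let ?E = "esscher_measure M T F L \<kappa>"
  interpret E: prob_space ?E
    by (rule prob_space_esscher[OF fin])
  have LTF [measurable]: "L T \<in> borel_measurable (F T)"
    using adapted[of T] T_pos by simp
  have LE: "L T \<in> borel_measurable ?E"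
    by (simp add: measurable_cong_sets[OF sets_esscher refl])
  have E: "(\<integral>\<^sup>+\<omega>. ennreal (exp (s * ((\<kappa>' - \<kappa>) * L T \<omega>))) \<partial>?E)
      = mgf (\<kappa> + s * (\<kappa>' - \<kappa>)) T * ennreal (exp (- cgf \<kappa>))" for s
  proof -
    have "(\<integral>\<^sup>+\<omega>. ennreal (exp (s * ((\<kappa>' - \<kappa>) * L T \<omega>))) \<partial>?E)
        = (\<integral>\<^sup>+\<omega>. ennreal (exp (\<kappa> * L T \<omega> - cgf \<kappa>)) * ennreal (exp (s * ((\<kappa>' - \<kappa>) * L T \<omega>))) \<partial>M)"
      by (intro nn_integral_esscher[OF fin]) measurable
    also have "\<dots> = (\<integral>\<^sup>+\<omega>. ennreal (exp ((\<kappa> + s * (\<kappa>' - \<kappa>)) * L T \<omega>)) * ennreal (exp (- cgf \<kappa>)) \<partial>M)"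
      by (intro nn_integral_cong) (simp add: ennreal_mult[symmetric] exp_add[symmetric] algebra_simps)
    also have "\<dots> = mgf (\<kappa> + s * (\<kappa>' - \<kappa>)) T * ennreal (exp (- cgf \<kappa>))"
      by (intro nn_integral_multc) measurable
    finally show ?thesis .
  qed
  have "integrable ?E (\<lambda>\<omega>. (\<kappa>' - \<kappa>) * L T \<omega>)"
  proof (rule E.integrable_of_mgf_min_at_0)
    show "(\<lambda>\<omega>. (\<kappa>' - \<kappa>) * L T \<omega>) \<in> borel_measurable ?E"
      using LE by simp
    show "(\<integral>\<^sup>+\<omega>. ennreal (exp ((\<kappa>' - \<kappa>) * L T \<omega>)) \<partial>?E) < \<infinity>"
      using E[of 1] fin' by (simp add: ennreal_mult_less_top)
    fix s :: real
    have "1 = mgf \<kappa> T * ennreal (exp (- cgf \<kappa>))"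
      unfolding exp_cgf[OF fin, symmetric] by (simp add: ennreal_mult[symmetric] exp_add[symmetric])
    also have "\<dots> \<le> mgf (\<kappa> + s * (\<kappa>' - \<kappa>)) T * ennreal (exp (- cgf \<kappa>))"
      by (intro mult_right_mono min) simp
    finally show "1 \<le> (\<integral>\<^sup>+\<omega>. ennreal (exp (s * ((\<kappa>' - \<kappa>) * L T \<omega>))) \<partial>?E)"
      unfolding E .
  qed
  then show ?thesis
    using ne by simp
qed

text \<open>By Wald's identity the means of \<open>L\<close> at the localizing times are the means of these times,
  multiplied by the drift; the former are zero and the latter tend to \<open>T > 0\<close>.\<close>
lemma expectation_0_of_M_loc_a:
  assumes int: "integrable M (L T)" and MC: "M \<in> M_loc_a M' T F L" and sp: "space M' = space M"
  shows "expectation (L T) = 0"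
proof -
  obtain \<tau> :: "nat \<Rightarrow> 'a \<Rightarrow> ennreal"
    where \<tau>': "\<forall>k. stopping_time (\<lambda>t. F (cap T t)) (\<tau> k)"
    and inc: "incseq (\<lambda>k. {\<omega> \<in> space M'. \<tau> k \<omega> = ennreal T})"
    and un: "(\<Union>k. {\<omega> \<in> space M'. \<tau> k \<omega> = ennreal T}) = space M'"
    and centred: "\<forall>k. integrable M (\<lambda>\<omega>. L (cap T (\<tau> k \<omega>)) \<omega>) \<and>
      (\<integral>\<omega>. L (cap T (\<tau> k \<omega>)) \<omega> \<partial>M) = 0"
    using MC unfolding M_loc_a_def by (elim CollectE conjE exE) (rule that)
  define \<sigma> where "\<sigma> = (\<lambda>k \<omega>. cap T (\<tau> k \<omega>))"
  have \<sigma>: "real_stopping_time (\<sigma> k)" for k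
    unfolding \<sigma>_def using \<tau>' by (intro real_stopping_time_cap) blast
  have \<sigma>b: "\<bar>\<sigma> k \<omega>\<bar> \<le> T" for k \<omega>
    using cap_in[of T "\<tau> k \<omega>"] T_pos by (simp add: \<sigma>_def)
  have "(\<lambda>k. expectation (\<sigma> k)) \<longlonglongrightarrow> expectation (\<lambda>_. T)"
  proof (rule expectation_eventually_const)
    show "\<sigma> k \<in> borel_measurable M" for k
      by (rule measurable_from_subalg[OF subalgebra measurable_real_stopping_time[OF \<sigma>]])
    show "\<forall>\<^sub>F k in sequentially. \<sigma> k \<omega> = T" if "\<omega> \<in> space M" for \<omega>
      using eventually_localized[OF inc un, of \<omega>] that sp by (auto elim!: eventually_mono simp: \<sigma>_def)
  qed (use \<sigma>b in auto)
  then have lim: "(\<lambda>k. expectation (L T) / T * expectation (\<sigma> k)) \<longlonglongrightarrow> expectation (L T) / T * T"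
    using prob_space by (intro tendsto_mult_left) simp
  have zero: "expectation (L T) / T * expectation (\<sigma> k) = 0" for k
    using optional_sampling_L(2)[OF int \<sigma>, of k] centred unfolding \<sigma>_def by metis
  have "expectation (L T) / T * T = 0"
    using lim unfolding zero by (rule LIMSEQ_unique[OF _ tendsto_const])
  then show ?thesis
    using T_pos by simp
qed

section \<open>Monotone paths\<close>

lemma levy_process_uminus: "levy_process M T F (\<lambda>t \<omega>. - L t \<omega>)"
proof (intro levy_process.intro levy_process_axioms.intro)
  show "prob_space M"
    by (rule prob_space_axioms)
  show "(\<lambda>\<omega>. - L t \<omega>) \<in> borel_measurable (F t)" if "t \<in> {0..T}" for t
    using adapted[OF that] by simp
  show "cadlag_on T (\<lambda>t. - L t \<omega>)" if "\<omega> \<in> space M" for \<omega>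
    unfolding cadlag_on_def
  proof (intro conjI ballI)
    show "continuous (at_right t) (\<lambda>t. - L t \<omega>)" if "t \<in> {0..<T}" for t
      using right_continuous[OF \<open>\<omega> \<in> space M\<close> that] by (intro continuous_intros)
    show "\<exists>l. ((\<lambda>t. - L t \<omega>) \<longlongrightarrow> l) (at_left t)" if "t \<in> {0<..T}" for t
    proof -
      obtain l where "((\<lambda>t. L t \<omega>) \<longlongrightarrow> l) (at_left t)"
        using cadlag[OF \<open>\<omega> \<in> space M\<close>] \<open>t \<in> {0<..T}\<close> unfolding cadlag_on_def by blast
      then show ?thesis
        by (intro exI[of _ "- l"] tendsto_minus)
    qed
  qed
  have incr: "- L t \<omega> - - L s \<omega> = - (L t \<omega> - L s \<omega>)" for s t \<omega>
    by simp
  have distr: "distr M borel (\<lambda>\<omega>. - L t \<omega> - - L s \<omega>) = distr (distr M borel (\<lambda>\<omega>. L t \<omega> - L s \<omega>)) borel uminus"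
    if "s \<in> {0..T}" "t \<in> {0..T}" for s t
    unfolding incr using measurable_increment[OF that] by (subst distr_distr) (auto simp: comp_def)
  show "distr M borel (\<lambda>\<omega>. - L (t + h) \<omega> - - L (s + h) \<omega>) = distr M borel (\<lambda>\<omega>. - L t \<omega> - - L s \<omega>)"
    if "0 \<le> s" "s \<le> t" "0 \<le> h" "t + h \<le> T" for s t h
    using distr[of s t] distr[of "s + h" "t + h"] stationary_increments[OF that] that by simp
  show "indep_set (sets (F s)) {(\<lambda>\<omega>. - L t \<omega> - - L s \<omega>) -` B \<inter> space M | B. B \<in> sets borel}"
    if st: "0 \<le> s" "s \<le> t" "t \<le> T" for s t
  proof -
    have "{(\<lambda>\<omega>. - L t \<omega> - - L s \<omega>) -` B \<inter> space M | B. B \<in> sets borel}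
        \<subseteq> {(\<lambda>\<omega>. L t \<omega> - L s \<omega>) -` B \<inter> space M | B. B \<in> sets borel}"
    proof safe
      fix B :: "real set" assume B: "B \<in> sets borel"
      have "uminus -` B \<inter> space borel \<in> sets (borel :: real measure)"
        using B by (intro measurable_sets[of uminus borel borel]) auto
      then show "\<exists>B'. (\<lambda>\<omega>. - L t \<omega> - - L s \<omega>) -` B \<inter> space M = (\<lambda>\<omega>. L t \<omega> - L s \<omega>) -` B' \<inter> space M \<and> B' \<in> sets borel"
        by (intro exI[of _ "uminus -` B"]) auto
    qed
    note sub = this and ind = independent_increments[OF st]
    show ?thesis
    proof (rule indep_setI)
      show "sets (F s) \<subseteq> events"
        by (rule indep_setD_ev1[OF ind])
      show "{(\<lambda>\<omega>. - L t \<omega> - - L s \<omega>) -` B \<inter> space M | B. B \<in> sets borel} \<subseteq> events"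
        by (rule order_trans[OF sub indep_setD_ev2[OF ind]])
    qed (rule indep_setD[OF ind _ subsetD[OF sub]])
  qed
qed (use horizon_pos filtration_F subalgebra_F starts_at_0 in auto)

text \<open>If \<open>L (T / 2 ^ n)\<close> were negative with positive probability, two independent negative increments
  of this length would make \<open>L (2 T / 2 ^ n)\<close> negative with positive probability. Hence no dyadic
  increment is negative, and right continuity extends this to all times.\<close>
lemma mono_of_terminal_nonneg:
  assumes "prob {\<omega>\<in>space M. L T \<omega> < 0} = 0"
  shows "AE \<omega> in M. mono_on {0..T} (\<lambda>t. L t \<omega>)"
proof -
  let ?neg = "\<lambda>t. \<integral>\<^sup>+\<omega>. indicator {..<0} (L t \<omega>) \<partial>M"
  have neg: "?neg (T / 2 ^ n) = 0" for n
  proof (induction n)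
    case 0
    have "?neg T = (\<integral>\<^sup>+\<omega>. indicator {\<omega>\<in>space M. L T \<omega> < 0} \<omega> \<partial>M)"
      by (intro nn_integral_cong) (simp split: split_indicator)
    then show ?case
      using assms by (simp add: emeasure_eq_measure)
  next
    case (Suc n)
    let ?t = "T / 2 ^ Suc n"
    have t: "0 \<le> ?t" "?t \<le> ?t + ?t" "?t + ?t \<le> T" and t2: "?t + ?t = T / 2 ^ n"
      using T_pos by (auto simp: field_simps)
    have "?neg ?t * ?neg ?t = (\<integral>\<^sup>+\<omega>. indicator {..<0} (L ?t \<omega>) * indicator {..<0} (L (?t + ?t) \<omega> - L ?t \<omega>) \<partial>M)"
      using nn_integral_past_times_increment[OF t, of "\<lambda>\<omega>. indicator {..<0} (L ?t \<omega>)" "indicator {..<0}"]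
        adapted[of ?t] t by simp
    also have "\<dots> \<le> ?neg (?t + ?t)"
      by (intro nn_integral_mono) (simp split: split_indicator)
    also have "\<dots> = 0"
      using Suc unfolding t2 .
    finally show ?case
      by simp
  qed
  have "AE \<omega> in M. \<forall>n j. j < 2 ^ n \<longrightarrow> L (real j * T / 2 ^ n) \<omega> \<le> L (real (Suc j) * T / 2 ^ n) \<omega>"
    unfolding AE_all_countable
  proof (intro allI)
    fix n j
    show "AE \<omega> in M. j < 2 ^ n \<longrightarrow> L (real j * T / 2 ^ n) \<omega> \<le> L (real (Suc j) * T / 2 ^ n) \<omega>"
    proof (cases "j < 2 ^ n")
      case True
      let ?s = "real j * T / 2 ^ n" and ?t = "real (Suc j) * T / 2 ^ n"
      have I: "?s \<in> {0..T}" "?t \<in> {0..T}"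
        using grid_in[of j n] grid_in[of "Suc j" n] True by auto
      have d: "?t - ?s = T / 2 ^ n"
        by (simp add: field_simps)
      have "?s \<le> ?t"
        using T_pos by (intro divide_right_mono mult_right_mono) auto
      then have st: "0 \<le> ?s" "?s \<le> ?t" "?t \<le> T"
        using I by auto
      have [measurable]: "L ?s \<in> borel_measurable M" "L ?t \<in> borel_measurable M"
        using I by (auto intro: measurable_L)
      have "(\<integral>\<^sup>+\<omega>. 1 * indicator {..<0} (L ?t \<omega> - L ?s \<omega>) \<partial>M) = (\<integral>\<^sup>+\<omega>. 1 \<partial>M) * ?neg (?t - ?s)"
        by (intro nn_integral_past_times_increment[OF st]) auto
      then have "(\<integral>\<^sup>+\<omega>. indicator {..<0} (L ?t \<omega> - L ?s \<omega>) \<partial>M) = 0"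
        unfolding d neg by simp
      moreover have m: "(\<lambda>\<omega>. indicator {..<0} (L ?t \<omega> - L ?s \<omega>) :: ennreal) \<in> borel_measurable M"
        by measurable
      ultimately have "AE \<omega> in M. indicator {..<0} (L ?t \<omega> - L ?s \<omega>) = (0 :: ennreal)"
        by (simp only: nn_integral_0_iff_AE)
      then show ?thesis
        by eventually_elim (auto split: split_indicator_asm)
    qed simp
  qed
  then show ?thesis
    using AE_space
  proof eventually_elim
    case (elim \<omega>)
    have grid: "L (real i * T / 2 ^ n) \<omega> \<le> L (real j * T / 2 ^ n) \<omega>" if "i \<le> j" "j \<le> 2 ^ n" for i j n
      using that
    proof (induction j rule: dec_induct)
      case (step j)
      then show ?case
        using elim(1)[rule_format, of j n] by simp
    qed simp
    show "mono_on {0..T} (\<lambda>t. L t \<omega>)"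
    proof (rule mono_onI)
      fix s t assume s: "s \<in> {0..T}" and t: "t \<in> {0..T}" and st: "s \<le> t"
      have "L (dyadic_ceiling n s) \<omega> \<le> L (dyadic_ceiling n t) \<omega>" for n
      proof -
        obtain i j where i: "dyadic_ceiling n s = real i * T / 2 ^ n" and j: "j \<le> 2 ^ n" "dyadic_ceiling n t = real j * T / 2 ^ n"
          using dyadic_ceiling_grid[OF s] dyadic_ceiling_grid[OF t] by metis
        have "i \<le> j"
          using dyadic_ceiling_mono[OF st, of n] T_pos unfolding i j(2) by (simp add: divide_le_cancel)
        then show ?thesis
          unfolding i j(2) using j(1) by (rule grid)
      qed
      moreover have "(\<lambda>n. L (dyadic_ceiling n s) \<omega>) \<longlonglongrightarrow> L s \<omega>" "(\<lambda>n. L (dyadic_ceiling n t) \<omega>) \<longlonglongrightarrow> L t \<omega>"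
        using right_continuous[OF elim(2)] s t by (auto intro: tendsto_dyadic_ceiling[where f="\<lambda>t. L t \<omega>"])
      ultimately show "L s \<omega> \<le> L t \<omega>"
        by (intro LIMSEQ_le) auto
    qed
  qed
qed

lemma prob_neg_of_not_subordinator:
  assumes "\<not> subordinator M T F L"
  shows "0 < prob {\<omega>\<in>space M. L T \<omega> < 0}"
  using assms mono_of_terminal_nonneg levy_process_axioms unfolding subordinator_def zero_less_measure_iff by blast

section \<open>The minimal entropy measure is the Esscher martingale measure\<close>

lemma is_EMM_of_is_MEMM:
  assumes MEMM: "is_MEMM M T F (M_loc_a M T F L) Q"
    and pos: "0 < prob {\<omega>\<in>space M. 0 < L T \<omega>}" "0 < prob {\<omega>\<in>space M. L T \<omega> < 0}"
    and ne: "u \<noteq> 0" "mgf u T < \<infinity>"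
  shows "is_EMM M T F L Q"
proof -
  obtain \<kappa> where fin: "mgf \<kappa> T < \<infinity>" and Q: "Q = esscher_measure M T F L \<kappa>"
    and min: "\<And>v. mgf \<kappa> T \<le> mgf v T"
    using esscher_of_is_MEMM[OF MEMM pos] by blast
  have "mgf 0 T < \<infinity>"
    by (simp add: emeasure_space_1)
  \<comment> \<open>One of the exponents \<open>0\<close> and \<open>u\<close> differs from \<open>\<kappa>\<close>.\<close>
  then obtain \<kappa>' where "\<kappa>' \<noteq> \<kappa>" "mgf \<kappa>' T < \<infinity>"
    using ne by metis
  then have int: "integrable Q (L T)"
    unfolding Q by (intro integrable_esscher_of_minimal[OF fin min]) auto
  interpret Q: levy_process Q T F L
    unfolding Q by (rule levy_process_esscher[OF fin])
  have "Q \<in> M_loc_a M T F L"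
    using MEMM by (simp add: is_MEMM_def)
  then have "Q.expectation (L T) = 0"
    by (rule Q.expectation_0_of_M_loc_a[OF int]) (simp add: Q)
  then have "martingale Q T F L"
    by (rule Q.martingale_of_centred[OF int])
  then show ?thesis
    unfolding is_EMM_def phi_def using fin Q by blast
qed

end

theorem corollary4p8:
  fixes M :: "'a measure" and T :: real
    and F :: "real \<Rightarrow> 'a measure" and L :: "real \<Rightarrow> 'a \<Rightarrow> real"
  assumes "levy_process M T F L"
    and "\<not> subordinator M T F L"
    and "\<not> subordinator M T F (\<lambda>t \<omega>. - L t \<omega>)"
    and "\<not> (\<forall>\<kappa>. \<kappa> \<noteq> 0 \<longrightarrow> phi M T L \<kappa> = \<infinity>)"
  shows "((\<exists>P. is_MEMM M T F (M_loc_a M T F L) P) \<longleftrightarrow> (\<exists>P. is_EMM M T F L P)) \<and>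
    (\<forall>P P'. is_MEMM M T F (M_loc_a M T F L) P \<longrightarrow> is_EMM M T F L P' \<longrightarrow> P = P')"
proof -
  interpret levy_process M T F L
    by fact
  interpret neg: levy_process M T F "\<lambda>t \<omega>. - L t \<omega>"
    by (rule levy_process_uminus)
  have pos: "0 < prob {\<omega>\<in>space M. 0 < L T \<omega>}" "0 < prob {\<omega>\<in>space M. L T \<omega> < 0}"
    using neg.prob_neg_of_not_subordinator[OF assms(3)] prob_neg_of_not_subordinator[OF assms(2)] by simp_all
  obtain u where u: "u \<noteq> 0" "mgf u T < \<infinity>"
    using assms(4) unfolding phi_def by (auto simp: less_top[symmetric])
  have "is_EMM M T F L P" if "is_MEMM M T F (M_loc_a M T F L) P" for P
    using that pos u by (rule is_EMM_of_is_MEMM)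
  then show ?thesis
    using is_MEMM_of_is_EMM by blast
qed

end
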